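(* Let $W$ be a $K$-vector space of dimension $3$. For $\phi\in S^3W$ let $A_\phi\colon\Gamma^{2,1}W\to\Gamma^{2,1}W$ be the $SL(W)$-invariant contraction operator. Then $A_\phi$ is skew-symmetric for every $\phi\in S^3W$, and the pfaffian $\mathrm{Pf}\,A_\phi$, as a polynomial in $\phi\in S^3W$, is the equation of $\sigma_3(\mathbf{P}(W),\mathcal{O}(3))\subset\mathbf{P}(S^3W)$, i.e. it is the Aronhold invariant (up to a nonzero constant).
   Context: $K$ is an algebraically closed field of characteristic zero. $\mathbf{P}(W)$ is embedded in $\mathbf{P}(S^3W)$ as the Veronese variety of cubes $[w^3]$, $0\ne w\in W$; elements of $S^3W$ are regarded as homogeneous cubic polynomials in $3$ variables. $\sigma_3(\mathbf{P}(W),\mathcal{O}(3))$ is the Zariski closure in $\mathbf{P}(S^3W)$ of the set of classes of cubics $g_1^3+g_2^3+g_3^3$ with $g_i\in W$. The Aronhold invariant is the degree $4$ equation of the hypersurface $\sigma_3(\mathbf{P}(W),\mathcal{O}(3))$ (defined up to a nonzero scalar). The Schur module $\Gamma^{2,1}W$ is identified with $\mathrm{ad}\,W$, the $8$-dimensional space of endomorphisms of $W$ of trace zero. The contraction operator $A_\phi$ is determined up to a nonzero scalar multiple independent of $\phi$, and is realized as follows. Fix a basis $e_0,e_1,e_2$ of $W$ and the identification $\wedge^3W\simeq K$ given by $e_0\wedge e_1\wedge e_2\mapsto1$. For $\phi\in S^3W$ define $A'_\phi\colon\mathrm{End}\,W\to\mathrm{End}\,W$, linearly in $\phi$, by the following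 formula for $\phi=u_1u_2u_3$ with $u_i\in W$, $M\in\mathrm{End}\,W$, $w\in W$: $$A'_{u_1u_2u_3}(M)(w)=\sum_{\sigma\in\Sigma_3}\bigl(M(u_{\sigma(1)})\wedge u_{\sigma(2)}\wedge w\bigr)\,u_{\sigma(3)},$$ where $\Sigma_3$ is the symmetric group. $A'_\phi$ takes values in $\mathrm{ad}\,W$, and $A_\phi$ is the restriction of $A'_\phi$ to $\mathrm{ad}\,W$, viewed as a map $\mathrm{ad}\,W\to\mathrm{ad}\,W$. Skew-symmetry is with respect to the symmetric bilinear form $(M,N)\mapsto\mathrm{tr}(M\cdot N)$, i.e. $\mathrm{tr}(A_\phi(M)\cdot N)=-\mathrm{tr}(A_\phi(N)\cdot M)$. $\mathrm{Pf}\,A_\phi$ is the pfaffian of the $8\times8$ skew-symmetric matrix of the bilinear form $(M,N)\mapsto\mathrm{tr}(A_\phi(M)\cdot N)$ with respect to a fixed basis of $\mathrm{ad}\,W$; it is well defined up to a nonzero constant independent of $\phi$. *)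

theory Defs
  imports
    "HOL-Analysis.Determinants"
    "HOL-Computational_Algebra.Polynomial"
    "HOL-Combinatorics.Permutations"
    "HOL-Library.Poly_Mapping"
    "HOL-Library.Function_Algebras"
begin

section \<open>Polynomials and projective varieties of cubics\<close>

text \<open>Polynomials over \<open>'k\<close> with variables in \<open>'x\<close> are elements of the monoid algebra
  \<open>('x \<Rightarrow>\<^sub>0 nat) \<Rightarrow>\<^sub>0 'k\<close>: a monomial is its exponent vector \<open>'x \<Rightarrow>\<^sub>0 nat\<close>.\<close>

type_synonym ('x, 'k) mpoly = "('x \<Rightarrow>\<^sub>0 nat) \<Rightarrow>\<^sub>0 'k"

definition mdeg :: "('x \<Rightarrow>\<^sub>0 nat) \<Rightarrow> nat" where
  "mdeg m = (\<Sum>x\<in>Poly_Mapping.keys m. Poly_Mapping.lookup m x)"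

definition const :: "'k::zero \<Rightarrow> ('x, 'k) mpoly" where
  "const c = Poly_Mapping.single 0 c"

definition var :: "'x \<Rightarrow> ('x, 'k::zero_neq_one) mpoly" where
  "var x = Poly_Mapping.single (Poly_Mapping.single x 1) 1"

definition homogeneous :: "nat \<Rightarrow> ('x, 'k::zero) mpoly \<Rightarrow> bool" where
  "homogeneous d p \<longleftrightarrow> (\<forall>m\<in>Poly_Mapping.keys p. mdeg m = d)"

definition peval :: "('x \<Rightarrow> 'k) \<Rightarrow> ('x, 'k::comm_semiring_1) mpoly \<Rightarrow> 'k" where
  "peval a p = (\<Sum>m\<in>Poly_Mapping.keys p. Poly_Mapping.lookup p m *
     (\<Prod>x\<in>Poly_Mapping.keys m. a x ^ Poly_Mapping.lookup m x))"

text \<open>\<open>S\<^sup>3W\<close>, as the space of homogeneous cubic polynomials in three variables;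
  the variable with index \<open>i :: 3\<close> stands for the basis vector \<open>e i\<close> of \<open>W\<close>.\<close>

definition cubics :: "(3, 'k::zero) mpoly set" where
  "cubics = {\<phi>. homogeneous 3 \<phi>}"

text \<open>The homogeneous coordinate ring of \<open>P(S\<^sup>3W)\<close>: its variables are the ten coefficients of a
  cubic, hence are indexed by the monomials of degree 3. A polynomial \<open>F\<close> in this ring takes the
  value \<open>peval (lookup \<phi>) F\<close> at the cubic \<open>\<phi>\<close>.\<close>

definition coord_ring :: "(3 \<Rightarrow>\<^sub>0 nat, 'k::zero) mpoly set" where
  "coord_ring = {F. \<forall>t\<in>Poly_Mapping.keys F. \<forall>m\<in>Poly_Mapping.keys t. mdeg m = 3}"

definition proj_class :: "(3, 'k::field) mpoly \<Rightarrow> (3, 'k) mpoly set" where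
  "proj_class \<phi> = {const c * \<phi> | c. c \<noteq> 0}"

definition proj_cubics :: "(3, 'k::field) mpoly set set" where
  "proj_cubics = proj_class ` (cubics - {0})"

definition vanishes_at :: "(3 \<Rightarrow>\<^sub>0 nat, 'k::field) mpoly \<Rightarrow> (3, 'k) mpoly set \<Rightarrow> bool" where
  "vanishes_at F x \<longleftrightarrow> (\<forall>\<phi>\<in>x. peval (Poly_Mapping.lookup \<phi>) F = 0)"

definition zero_locus :: "(3 \<Rightarrow>\<^sub>0 nat, 'k::field) mpoly set \<Rightarrow> (3, 'k) mpoly set set" where
  "zero_locus S = {x \<in> proj_cubics. \<forall>F\<in>S. vanishes_at F x}"

definition zariski_closed :: "(3, 'k::field) mpoly set set \<Rightarrow> bool" where
  "zariski_closed Y \<longleftrightarrow>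
     (\<exists>S \<subseteq> {F \<in> coord_ring. \<exists>d. homogeneous d F}. Y = zero_locus S)"

definition zariski_closure :: "(3, 'k::field) mpoly set set \<Rightarrow> (3, 'k) mpoly set set" where
  "zariski_closure X = \<Inter>{Y. zariski_closed Y \<and> X \<subseteq> Y}"

definition vanishing_ideal ::
    "(3, 'k::field) mpoly set set \<Rightarrow> (3 \<Rightarrow>\<^sub>0 nat, 'k) mpoly set" where
  "vanishing_ideal Y = {G \<in> coord_ring. \<forall>x\<in>Y. vanishes_at G x}"

text \<open>\<open>F\<close> is the equation of the hypersurface \<open>Y\<close>: not only is \<open>Y\<close> its zero locus, but
  \<open>F\<close> generates the ideal of \<open>Y\<close> (so a proper power of an equation is not one).\<close>

definition is_equation_of ::
    "(3 \<Rightarrow>\<^sub>0 nat, 'k::field) mpoly \<Rightarrow> (3, 'k) mpoly set set \<Rightarrow> bool" where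
  "is_equation_of F Y \<longleftrightarrow> F \<in> coord_ring \<and> F \<noteq> 0 \<and> (\<exists>d. homogeneous d F) \<and>
     zero_locus {F} = Y \<and> vanishing_ideal Y = {F * H | H. H \<in> coord_ring}"

definition pfaffian :: "nat \<Rightarrow> (nat \<Rightarrow> nat \<Rightarrow> 'k::field) \<Rightarrow> 'k" where
  "pfaffian n a = (\<Sum>p | p permutes {..<2*n}.
      of_int (sign p) * (\<Prod>i<n. a (p (2*i)) (p (2*i+1)))) / (2^n * of_nat (fact n))"


section \<open>The space \<open>W\<close> and the contraction operator\<close>

locale ternary_space = vector_space scale
  for scale :: "'k::field \<Rightarrow> 'w::ab_group_add \<Rightarrow> 'w" +
  fixes e :: "3 \<Rightarrow> 'w"
  assumes inj_e: "inj e"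
    and independent_e: "independent (range e)"
    and span_e: "span (range e) = UNIV"
begin

definition coord :: "'w \<Rightarrow> 3 \<Rightarrow> 'k" where
  "coord w i = representation (range e) w (e i)"

text \<open>The inclusion of \<open>W = S\<^sup>1W\<close> in the symmetric algebra.\<close>

definition lin :: "'w \<Rightarrow> (3, 'k) mpoly" where
  "lin w = (\<Sum>i\<in>UNIV. const (coord w i) * var i)"

definition sigma3 :: "(3, 'k) mpoly set set" where
  "sigma3 = zariski_closure
     {proj_class (\<Sum>i\<in>UNIV. lin (g i) ^ 3) | g :: 3 \<Rightarrow> 'w. (\<Sum>i\<in>UNIV. lin (g i) ^ 3) \<noteq> 0}"

definition is_aronhold_invariant :: "(3 \<Rightarrow>\<^sub>0 nat, 'k) mpoly \<Rightarrow> bool" where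
  "is_aronhold_invariant F \<longleftrightarrow> homogeneous 4 F \<and> is_equation_of F sigma3"

definition endo :: "('w \<Rightarrow> 'w) set" where
  "endo = {M. Vector_Spaces.linear scale scale M}"

definition tr :: "('w \<Rightarrow> 'w) \<Rightarrow> 'k" where
  "tr M = trace (\<chi> i j. coord (M (e j)) i)"

definition ad :: "('w \<Rightarrow> 'w) set" where
  "ad = {M \<in> endo. tr M = 0}"

definition scale_fun :: "'k \<Rightarrow> ('w \<Rightarrow> 'w) \<Rightarrow> 'w \<Rightarrow> 'w" where
  "scale_fun c M = (\<lambda>w. scale c (M w))"

definition is_ad_basis :: "(nat \<Rightarrow> 'w \<Rightarrow> 'w) \<Rightarrow> bool" where
  "is_ad_basis B \<longleftrightarrow> inj_on B {..<8} \<and>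
     \<not> module.dependent scale_fun (B ` {..<8}) \<and> module.span scale_fun (B ` {..<8}) = ad"

text \<open>The image of \<open>x \<and> y \<and> z\<close> under the identification of \<open>\<and>\<^sup>3W\<close> with \<open>K\<close> that maps
  \<open>e 0 \<and> e 1 \<and> e 2\<close> to 1.\<close>

definition wedge3 :: "'w \<Rightarrow> 'w \<Rightarrow> 'w \<Rightarrow> 'k" where
  "wedge3 x y z = det (\<chi> i j. coord (if i = 0 then x else if i = 1 then y else z) j)"

text \<open>The value of the contraction operator at the product \<open>u 0 * u 1 * u 2\<close>.\<close>

definition contraction_prod :: "(3 \<Rightarrow> 'w) \<Rightarrow> ('w \<Rightarrow> 'w) \<Rightarrow> 'w \<Rightarrow> 'w" where
  "contraction_prod u M w =
     (\<Sum>\<sigma> | \<sigma> permutes UNIV. scale (wedge3 (M (u (\<sigma> 0))) (u (\<sigma> 1)) w) (u (\<sigma> 2)))"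

text \<open>The linear extension of \<open>contraction_prod\<close> from the monomial basis of \<open>S\<^sup>3W\<close>. The monomials
  of degree 3 are the products \<open>var (v 0) * var (v 1) * var (v 2)\<close> for weakly increasing
  \<open>v :: 3 \<Rightarrow> 3\<close>, each obtained exactly once. The lemmas \<open>contraction_add\<close>, \<open>contraction_scale\<close> and
  \<open>contraction_lin_prod\<close> below show that the operator is linear in the cubic and agrees with
  \<open>contraction_prod\<close> on all products of three vectors.\<close>

definition contraction :: "(3, 'k) mpoly \<Rightarrow> ('w \<Rightarrow> 'w) \<Rightarrow> 'w \<Rightarrow> 'w" where
  "contraction \<phi> M w = (\<Sum>v | mono v.
     scale (Poly_Mapping.lookup \<phi> (\<Sum>i\<in>UNIV. Poly_Mapping.single (v i) 1))
       (contraction_prod (e \<circ> v) M w))"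

definition contraction_pf :: "(nat \<Rightarrow> 'w \<Rightarrow> 'w) \<Rightarrow> (3, 'k) mpoly \<Rightarrow> 'k" where
  "contraction_pf B \<phi> = pfaffian 4 (\<lambda>i j. tr (contraction \<phi> (B i) \<circ> B j))"

end


section \<open>The contraction operator on products of three vectors\<close>

lemma UNIV3: "(UNIV :: 3 set) = {0, 1, 2}"
  using UNIV_3 by auto

lemma three_eq_zero: "(3 :: 3) = 0"
  by simp

lemma cases3: "(x :: 3) = 0 \<or> x = 1 \<or> x = 2"
  using exhaust_3[of x] by auto

lemma less3: "(0::3) < 1" "(1::3) < 2" "(0::3) < 2"
proof -
  have "Rep_bit1 (0::3) = 0" by (rule bit1.Rep_0)
  moreover have "Rep_bit1 (1::3) = 1" by (rule bit1.Rep_1)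
  moreover have "Rep_bit1 (2::3) = 2" by (subst bit1.Rep_numeral) simp
  ultimately show "(0::3) < 1" "(1::3) < 2" "(0::3) < 2"
    by (simp_all only: less_bit1_def zero_less_one zero_less_numeral one_less_numeral_iff
        semiring_norm)
qed

lemma neq3: "(0::3) \<noteq> 1" "(1::3) \<noteq> 2" "(0::3) \<noteq> 2" "(1::3) \<noteq> 0" "(2::3) \<noteq> 1" "(2::3) \<noteq> 0"
  using less3 by (metis less_irrefl)+

lemma nle3: "\<not> (1::3) \<le> 0" "\<not> (2::3) \<le> 1" "\<not> (2::3) \<le> 0"
  using less3 by (simp_all only: not_le)

lemma all3: "(\<forall>x::3. P x) \<longleftrightarrow> P 0 \<and> P 1 \<and> P 2"
  using cases3 by metis

lemma mono3: "mono (v :: 3 \<Rightarrow> 3) \<longleftrightarrow> v 0 \<le> v 1 \<and> v 1 \<le> v 2"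
proof
  assume "mono v"
  thus "v 0 \<le> v 1 \<and> v 1 \<le> v 2"
    using less3[THEN less_imp_le] by (blast dest: monoD)
next
  assume v: "v 0 \<le> v 1 \<and> v 1 \<le> v 2"
  show "mono v"
  proof (rule monoI)
    fix x y :: 3
    assume "x \<le> y"
    thus "v x \<le> v y"
      using v cases3[of x] cases3[of y] less3 by (metis leD order.refl order.trans)
  qed
qed

definition mon :: "(3 \<Rightarrow> 3) \<Rightarrow> 3 \<Rightarrow>\<^sub>0 nat" where
  "mon v = (\<Sum>i\<in>UNIV. Poly_Mapping.single (v i) 1)"

lemma mon_permute: "\<tau> permutes UNIV \<Longrightarrow> mon (v \<circ> \<tau>) = mon v"
  unfolding mon_def
  using sum.permute[of \<tau> UNIV "\<lambda>i. Poly_Mapping.single (v i) (1::nat)", symmetric]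
  by (simp only: o_def)

lemma prod_UNIV3: "(\<Prod>i\<in>UNIV. f i) = f 0 * f 1 * f (2 :: 3)" for f :: "3 \<Rightarrow> 'a::comm_monoid_mult"
  unfolding UNIV3 by (simp add: neq3 mult.assoc)

definition tri :: "'a \<Rightarrow> 'a \<Rightarrow> 'a \<Rightarrow> 3 \<Rightarrow> 'a" where
  "tri a b c i = (if i = 0 then a else if i = 1 then b else c)"

lemma tri_simps [simp]: "tri a b c 0 = a" "tri a b c 1 = b" "tri a b c 2 = c"
  by (simp_all add: tri_def neq3)

lemma tri_permutes: "a \<noteq> b \<Longrightarrow> a \<noteq> c \<Longrightarrow> b \<noteq> c \<Longrightarrow> tri a b c permutes UNIV"
proof -
  assume "a \<noteq> b" "a \<noteq> c" "b \<noteq> c"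
  hence "inj (tri a b c)" by (simp add: inj_def all3)
  hence "bij (tri a b c)" by (simp add: bij_def finite_UNIV_inj_surj)
  thus ?thesis by (intro bij_imp_permutes) auto
qed

lemma sort3: "\<exists>\<tau>. \<tau> permutes UNIV \<and> mono (v \<circ> \<tau>)" for v :: "3 \<Rightarrow> 3"
proof -
  note n = neq3
  have *: "\<exists>\<tau>. \<tau> permutes UNIV \<and> mono (v \<circ> \<tau>)"
    if "v a \<le> v b" "v b \<le> v c" "a \<noteq> b" "a \<noteq> c" "b \<noteq> c" for a b c
    using that tri_permutes[of a b c] by (intro exI[of _ "tri a b c"]) (auto simp: mono3)
  consider "v 0 \<le> v 1" "v 1 \<le> v 2" | "v 0 \<le> v 2" "v 2 \<le> v 1" | "v 1 \<le> v 0" "v 0 \<le> v 2"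
    | "v 1 \<le> v 2" "v 2 \<le> v 0" | "v 2 \<le> v 0" "v 0 \<le> v 1" | "v 2 \<le> v 1" "v 1 \<le> v 0"
    using linear by blast
  thus ?thesis
    by cases (rule *, assumption, assumption, rule n, rule n, rule n)+
qed

lemma lookup_mon: "Poly_Mapping.lookup (mon v) k =
    (if v 0 = k then 1 else 0) + (if v 1 = k then 1 else 0) + (if v 2 = k then 1 else 0)"
  unfolding mon_def UNIV3 by (simp add: neq3 lookup_add lookup_single when_def)

lemma mono_eq_mon:
  assumes "mono v"
  defines "l \<equiv> Poly_Mapping.lookup (mon v)"
  shows "v = tri (if l 0 \<ge> 1 then 0 else if l 1 \<ge> 1 then 1 else 2)
                 (if l 0 \<ge> 2 then 0 else if l 2 \<ge> 2 then 2 else 1)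
                 (if l 2 \<ge> 1 then 2 else if l 1 \<ge> 1 then 1 else 0)"
proof -
  note n = neq3 nle3
  show ?thesis
    using assms(1) n cases3[of "v 0"] cases3[of "v 1"] cases3[of "v 2"]
    unfolding mono3 l_def lookup_mon fun_eq_iff all3 tri_simps
    by (elim disjE; simp)
qed

lemma mon_inj:
  assumes "mono v" "mono v'" "mon v = mon v'"
  shows "v = v'"
  using mono_eq_mon[OF assms(1)] mono_eq_mon[OF assms(2)] assms(3) by metis

lemma sum_fun3: "(\<Sum>v\<in>UNIV. g v) = (\<Sum>a\<in>UNIV. \<Sum>b\<in>UNIV. \<Sum>c\<in>UNIV. g (tri a b c))"
  for g :: "(3 \<Rightarrow> 'a::finite) \<Rightarrow> 'b::comm_monoid_add"
proof -
  have "bij_betw (\<lambda>(a,b,c). tri a b c) (UNIV :: ('a \<times> 'a \<times> 'a) set) (UNIV :: (3 \<Rightarrow> 'a) set)"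
    by (rule bij_betw_byWitness[where f' = "\<lambda>v. (v 0, v 1, v 2)"])
       (auto simp: fun_eq_iff all3)
  from sum.reindex_bij_betw[OF this, of g, symmetric]
  show ?thesis
    by (simp add: sum.cartesian_product UNIV_Times_UNIV[symmetric] split_def
        del: UNIV_Times_UNIV)
qed

lemma sum_swap3: "(\<Sum>c\<in>C. \<Sum>b\<in>B. \<Sum>a\<in>A. f a b c) = (\<Sum>a\<in>A. \<Sum>b\<in>B. \<Sum>c\<in>C. f a b c)"
proof -
  have "(\<Sum>c\<in>C. \<Sum>b\<in>B. \<Sum>a\<in>A. f a b c) = (\<Sum>c\<in>C. \<Sum>a\<in>A. \<Sum>b\<in>B. f a b c)"
    by (intro sum.cong refl sum.swap)
  also have "\<dots> = (\<Sum>a\<in>A. \<Sum>c\<in>C. \<Sum>b\<in>B. f a b c)" by (rule sum.swap)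
  also have "\<dots> = (\<Sum>a\<in>A. \<Sum>b\<in>B. \<Sum>c\<in>C. f a b c)"
    by (intro sum.cong refl sum.swap)
  finally show ?thesis .
qed

lemma lookup_const_mult:
  "Poly_Mapping.lookup (const c * p) m = c * Poly_Mapping.lookup p m" for c :: "'k::field"
  unfolding const_def mult_map_scale_conv_mult[symmetric]
  by (simp add: Poly_Mapping.map.rep_eq when_def)

context ternary_space
begin

lemma contraction_add:
  "contraction (\<phi> + \<psi>) M w = contraction \<phi> M w + contraction \<psi> M w"
  by (simp add: contraction_def lookup_add scale_left_distrib sum.distrib)

lemma contraction_scale: "contraction (const c * \<phi>) M w = scale c (contraction \<phi> M w)"
  by (simp add: contraction_def lookup_const_mult scale_sum_right)

lemma coord_add: "coord (x + y) i = coord x i + coord y i"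
  using representation_add[OF independent_e] span_e by (simp add: coord_def)

lemma coord_scale: "coord (scale c x) i = c * coord x i"
  using representation_scale[OF independent_e] span_e by (simp add: coord_def)

lemma coord_sum: "coord (sum f S) i = (\<Sum>s\<in>S. coord (f s) i)"
  unfolding coord_def by (subst representation_sum[OF independent_e]) (auto simp: span_e)

lemma coord_e: "coord (e i) j = (if i = j then 1 else 0)"
  using representation_basis[OF independent_e, of "e i"] inj_e
  by (auto simp: coord_def inj_eq)

lemma coord_expand: "w = (\<Sum>i\<in>UNIV. scale (coord w i) (e i))"
proof -
  have "w = (\<Sum>b\<in>range e. scale (representation (range e) w b) b)"
    using sum_representation_eq[OF independent_e, of w "range e"] span_e by simp
  also have "\<dots> = (\<Sum>i\<in>UNIV. scale (coord w i) (e i))"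
    by (subst sum.reindex[OF inj_e]) (simp add: coord_def)
  finally show ?thesis .
qed

lemma wedge3_eq: "wedge3 x y z =
    coord x 0 * (coord y 1 * coord z 2 - coord y 2 * coord z 1)
  - coord x 1 * (coord y 0 * coord z 2 - coord y 2 * coord z 0)
  + coord x 2 * (coord y 0 * coord z 1 - coord y 1 * coord z 0)"
  unfolding wedge3_def det_3 three_eq_zero by (simp add: neq3 algebra_simps)

lemma wedge3_sum1: "wedge3 (\<Sum>a\<in>UNIV. scale (f a) (X a)) y z = (\<Sum>a\<in>UNIV. f a * wedge3 (X a) y z)"
  for X :: "3 \<Rightarrow> 'w"
  unfolding UNIV3 by (simp add: neq3 wedge3_eq coord_add coord_scale algebra_simps)

lemma wedge3_sum2: "wedge3 x (\<Sum>a\<in>UNIV. scale (f a) (X a)) z = (\<Sum>a\<in>UNIV. f a * wedge3 x (X a) z)"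
  for X :: "3 \<Rightarrow> 'w"
  unfolding UNIV3 by (simp add: neq3 wedge3_eq coord_add coord_scale algebra_simps)

lemma term_expand:
  fixes u :: "3 \<Rightarrow> 'w"
  assumes "M \<in> endo"
  shows "scale (wedge3 (M (u 0)) (u 1) w) (u 2) =
    (\<Sum>v\<in>UNIV. scale (\<Prod>i\<in>UNIV. coord (u i) (v i)) (scale (wedge3 (M (e (v 0))) (e (v 1)) w) (e (v 2))))"
proof -
  interpret M: Vector_Spaces.linear scale scale M using assms by (simp add: endo_def)
  have M: "M (u 0) = (\<Sum>a\<in>UNIV. scale (coord (u 0) a) (M (e a)))"
    by (subst coord_expand[of "u 0"]) (simp add: M.sum M.scale)
  have "scale (wedge3 (M (u 0)) (u 1) w) (u 2) =
      (\<Sum>c\<in>UNIV. scale (\<Sum>b\<in>UNIV. coord (u 1) b * (\<Sum>a\<in>UNIV. coord (u 0) a * wedge3 (M (e a)) (e b) w))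
        (scale (coord (u 2) c) (e c)))"
    unfolding M
    by (subst coord_expand[of "u 1"], subst coord_expand[of "u 2"])
       (simp only: wedge3_sum1 wedge3_sum2 scale_sum_right)
  also have "\<dots> = (\<Sum>c\<in>UNIV. \<Sum>b\<in>UNIV. \<Sum>a\<in>UNIV.
      scale (coord (u 0) a * coord (u 1) b * coord (u 2) c) (scale (wedge3 (M (e a)) (e b) w) (e c)))"
    by (simp add: scale_sum_left sum_distrib_left sum_distrib_right mult_ac)
  also have "\<dots> = (\<Sum>a\<in>UNIV. \<Sum>b\<in>UNIV. \<Sum>c\<in>UNIV.
      scale (coord (u 0) a * coord (u 1) b * coord (u 2) c) (scale (wedge3 (M (e a)) (e b) w) (e c)))"
    by (rule sum_swap3)
  finally show ?thesis
    unfolding sum_fun3 prod_UNIV3 tri_simps .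
qed

lemma contraction_prod_expand:
  assumes "M \<in> endo"
  shows "contraction_prod u M w =
    (\<Sum>v\<in>UNIV. scale (\<Prod>i\<in>UNIV. coord (u i) (v i)) (contraction_prod (e \<circ> v) M w))"
proof -
  have "scale (wedge3 (M (u (\<sigma> 0))) (u (\<sigma> 1)) w) (u (\<sigma> 2)) =
     (\<Sum>v\<in>UNIV. scale (\<Prod>i\<in>UNIV. coord (u i) (v i))
        (scale (wedge3 (M (e (v (\<sigma> 0)))) (e (v (\<sigma> 1))) w) (e (v (\<sigma> 2)))))"
    if s: "\<sigma> permutes UNIV" for \<sigma> :: "3 \<Rightarrow> 3"
  proof -
    have b: "bij_betw (\<lambda>v. v \<circ> \<sigma>) (UNIV :: (3 \<Rightarrow> 3) set) UNIV"
      by (rule bij_betw_byWitness[where f' = "\<lambda>v. v \<circ> inv \<sigma>"])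
         (auto simp: o_assoc[symmetric] permutes_inv_o[OF s])
    have p: "(\<Prod>i\<in>UNIV. coord (u (\<sigma> i)) (v (\<sigma> i))) = (\<Prod>i\<in>UNIV. coord (u i) (v i))" for v
      using prod.permute[OF s, of "\<lambda>i. coord (u i) (v i)", symmetric] by (simp only: o_def)
    have "scale (wedge3 (M (u (\<sigma> 0))) (u (\<sigma> 1)) w) (u (\<sigma> 2)) =
       (\<Sum>v\<in>UNIV. scale (\<Prod>i\<in>UNIV. coord (u (\<sigma> i)) (v i)) (scale (wedge3 (M (e (v 0))) (e (v 1)) w) (e (v 2))))"
      using term_expand[OF assms, of "u \<circ> \<sigma>"] by (simp only: o_apply)
    also have "\<dots> = (\<Sum>v\<in>UNIV. scale (\<Prod>i\<in>UNIV. coord (u (\<sigma> i)) ((v \<circ> \<sigma>) i))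
        (scale (wedge3 (M (e ((v \<circ> \<sigma>) 0))) (e ((v \<circ> \<sigma>) 1)) w) (e ((v \<circ> \<sigma>) 2))))"
      by (rule sum.reindex_bij_betw[OF b, symmetric])
    finally show ?thesis by (simp only: o_apply p)
  qed
  hence "contraction_prod u M w = (\<Sum>\<sigma> | \<sigma> permutes UNIV. \<Sum>v\<in>UNIV. scale (\<Prod>i\<in>UNIV. coord (u i) (v i))
        (scale (wedge3 (M (e (v (\<sigma> 0)))) (e (v (\<sigma> 1))) w) (e (v (\<sigma> 2)))))"
    by (simp add: contraction_prod_def)
  thus ?thesis
    unfolding contraction_prod_def scale_sum_right o_apply by (subst (asm) sum.swap)
qed

lemma contraction_prod_permute:
  assumes "\<tau> permutes UNIV"
  shows "contraction_prod (u \<circ> \<tau>) M w = contraction_prod u M w"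
  unfolding contraction_prod_def
  by (subst (2) setum_permutations_compose_left[OF assms]) (simp only: o_apply)

lemma prod_lin: "(\<Prod>i\<in>UNIV. lin (u i)) =
    (\<Sum>v\<in>UNIV. Poly_Mapping.single (mon v) (\<Prod>i\<in>UNIV. coord (u i) (v i)))"
proof -
  have "lin (u i) = (\<Sum>j\<in>UNIV. Poly_Mapping.single (Poly_Mapping.single j 1) (coord (u i) j))" for i
    by (simp add: lin_def const_def var_def mult_single)
  hence "(\<Prod>i\<in>UNIV. lin (u i)) = (\<Sum>v\<in>UNIV. \<Prod>i\<in>UNIV.
      Poly_Mapping.single (Poly_Mapping.single (v i) 1) (coord (u i) (v i)))"
    using prod_sum_PiE[of "UNIV :: 3 set" "\<lambda>_. UNIV :: 3 set"
        "\<lambda>i j. Poly_Mapping.single (Poly_Mapping.single j (1::nat)) (coord (u i) j)"]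
    by (simp add: PiE_UNIV_domain)
  moreover have "(\<Prod>i\<in>UNIV. Poly_Mapping.single (Poly_Mapping.single (v i) 1) (coord (u i) (v i)))
      = Poly_Mapping.single (mon v) (\<Prod>i\<in>UNIV. coord (u i) (v i))" for v
    unfolding mon_def UNIV3 by (simp add: neq3 mult_single add.assoc mult.assoc)
  ultimately show ?thesis by (simp only:)
qed

lemma contraction_lin_prod:
  assumes "M \<in> endo"
  shows "contraction (\<Prod>i\<in>UNIV. lin (u i)) M w = contraction_prod u M w"
proof -
  let ?C = "\<lambda>v. \<Prod>i\<in>UNIV. coord (u i) (v i)"
  have inner: "(\<Sum>v | mono v. scale (if mon v' = mon v then c else 0) (contraction_prod (e \<circ> v) M w))
      = scale c (contraction_prod (e \<circ> v') M w)" for v' c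
  proof -
    obtain \<tau> where t: "\<tau> permutes UNIV" "mono (v' \<circ> \<tau>)" using sort3 by blast
    have eq: "mon v' = mon v \<longleftrightarrow> v = v' \<circ> \<tau>" if "mono v" for v
      using mon_inj[OF that t(2)] mon_permute[OF t(1), of v'] by auto
    have "(\<Sum>v | mono v. scale (if mon v' = mon v then c else 0) (contraction_prod (e \<circ> v) M w))
      = (\<Sum>v | mono v. if v = v' \<circ> \<tau> then scale c (contraction_prod (e \<circ> (v' \<circ> \<tau>)) M w) else 0)"
      by (intro sum.cong refl) (auto simp: eq)
    also have "\<dots> = scale c (contraction_prod (e \<circ> (v' \<circ> \<tau>)) M w)"
      using t(2) by (subst sum.delta) auto
    also have "\<dots> = scale c (contraction_prod (e \<circ> v') M w)"
      using contraction_prod_permute[OF t(1), of "e \<circ> v'"] by (simp add: o_assoc)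
    finally show ?thesis .
  qed
  have "contraction (\<Prod>i\<in>UNIV. lin (u i)) M w =
      (\<Sum>v | mono v. scale (\<Sum>v'\<in>UNIV. if mon v' = mon v then ?C v' else 0) (contraction_prod (e \<circ> v) M w))"
    unfolding contraction_def mon_def[symmetric] prod_lin lookup_sum lookup_single when_def ..
  also have "\<dots> = (\<Sum>v'\<in>UNIV. \<Sum>v | mono v.
      scale (if mon v' = mon v then ?C v' else 0) (contraction_prod (e \<circ> v) M w))"
    unfolding scale_sum_left by (rule sum.swap)
  also have "\<dots> = contraction_prod u M w"
    unfolding inner by (rule contraction_prod_expand[OF assms, symmetric])
  finally show ?thesis .
qed

end

end

theory Submission
  imports Defs
begin

text \<open>A cubic is recorded by its symmetric tensor \<open>t i j k\<close>, which has ten independent entries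
  \<open>x 0, \<dots>, x 9\<close>. Let \<open>Q i\<close> be the symmetric matrix with entries \<open>t i j k\<close>. The Aronhold
  invariant \<open>S\<close>, of degree four, is the difference of the entries at \<open>(1, 2)\<close> and \<open>(2, 1)\<close> of
  \<open>Q 1 * adj (Q 0) * Q 2\<close>, where \<open>adj\<close> is the adjugate; it is the only obstruction to the symmetry
  of this product.

  On two matrix units, the bilinear form \<open>tr (A M \<circ> N)\<close> of the contraction operator is zero or an
  entry of the tensor up to sign, and exchanging \<open>M\<close> and \<open>N\<close> changes the sign
  (\<open>contr_form_skew\<close>). Expanding the pfaffian in an explicit basis of the traceless matrices gives
  \<open>- 3 * S\<close> (\<open>pfaffian_sl3_basis\<close>). Expressing either of two bases by the other multiplies the
  pfaffian by a constant (\<open>pfaffian_congruence\<close>), and the constant is not zero because both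
  directions are possible.

  It remains to see that \<open>S\<close> generates the ideal of the sums of three cubes. The form \<open>S\<close> vanishes
  on them (\<open>aronhold_cube_sum\<close>). Conversely let \<open>S = 0\<close>, let \<open>Q 0\<close> be invertible and let the pencil
  \<open>Q 1 - z * Q 0\<close> have three distinct eigenvalues. Because \<open>S = 0\<close>, its eigenvectors are orthogonal
  to each other for \<open>Q 2\<close> as well as for \<open>Q 0\<close> and \<open>Q 1\<close>, so the tensor is diagonal in the basis of
  eigenvectors and the cubic is a sum of three cubes (\<open>aronhold_zero_imp_cube_sum\<close>).

  Now let \<open>G\<close> be a polynomial that vanishes on the sums of three cubes. The form
  \<open>S = x 0 * L + R\<close> is linear in \<open>x 0\<close>, and it is monic of degree four in \<open>x 9\<close>. Division by \<open>S\<close>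
  with respect to \<open>x 9\<close> replaces \<open>G\<close> by a remainder of degree at most three in \<open>x 9\<close>, and
  pseudo-division with respect to \<open>x 0\<close> writes \<open>L ^ k\<close> times this remainder as a multiple of \<open>S\<close>
  plus a polynomial free of \<open>x 0\<close>. The latter is zero, because a generic choice of
  \<open>x 1, \<dots>, x 9\<close> extends, by \<open>x 0 = - R / L\<close>, to a sum of three cubes. The ideal of \<open>S\<close> and \<open>L\<close>
  contains a nonzero polynomial \<open>N\<close> free of \<open>x 9\<close>, so \<open>N ^ k\<close> times the remainder is a multiple of
  \<open>S\<close>; comparing degrees in \<open>x 9\<close>, the remainder is zero. Hence \<open>S\<close> divides \<open>G\<close>
  (\<open>aronhold_dvd\<close>). Neither the Nullstellensatz nor the irreducibility of \<open>S\<close> is used.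

  The divisions take place among polynomial functions of the ten coordinates. A polynomial in the
  coefficients of a cubic that vanishes at all cubics is zero (\<open>coord_ring_eq_0\<close>), which carries the
  results over to the coordinate ring.\<close>

section \<open>Polynomial functions\<close>

text \<open>The polynomial functions in the coordinates \<open>x 0, \<dots>, x (n - 1)\<close> of a sequence \<open>x\<close>. Later
  \<open>n\<close> is 10; the remaining entries of \<open>x\<close> play no role, as \<open>polyfun_cong\<close> says.\<close>

inductive polyfun :: "nat \<Rightarrow> ((nat \<Rightarrow> 'k::field) \<Rightarrow> 'k) \<Rightarrow> bool" for n where
  polyfun_const: "polyfun n (\<lambda>x. c)"
| polyfun_coord: "i < n \<Longrightarrow> polyfun n (\<lambda>x. x i)"
| polyfun_add: "polyfun n f \<Longrightarrow> polyfun n g \<Longrightarrow> polyfun n (\<lambda>x. f x + g x)"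
| polyfun_mult: "polyfun n f \<Longrightarrow> polyfun n g \<Longrightarrow> polyfun n (\<lambda>x. f x * g x)"

lemma polyfun_uminus: "polyfun n f \<Longrightarrow> polyfun n (\<lambda>x. - f x)"
  using polyfun_mult[OF polyfun_const[of n "-1"], of f] by simp

lemma polyfun_diff: "polyfun n f \<Longrightarrow> polyfun n g \<Longrightarrow> polyfun n (\<lambda>x. f x - g x)"
  using polyfun_add[OF _ polyfun_uminus, of n f g] by simp

lemma polyfun_power: "polyfun n f \<Longrightarrow> polyfun n (\<lambda>x. f x ^ k)"
  by (induction k) (auto intro: polyfun_const polyfun_mult)

lemma polyfun_sum: "(\<And>i. i \<in> I \<Longrightarrow> polyfun n (f i)) \<Longrightarrow> polyfun n (\<lambda>x. \<Sum>i\<in>I. f i x)"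
  by (induction I rule: infinite_finite_induct) (auto intro: polyfun_const polyfun_add)

lemma polyfun_prod: "(\<And>i. i \<in> I \<Longrightarrow> polyfun n (f i)) \<Longrightarrow> polyfun n (\<lambda>x. \<Prod>i\<in>I. f i x)"
  by (induction I rule: infinite_finite_induct) (auto intro: polyfun_const polyfun_mult)

lemmas polyfun_intros = polyfun_const polyfun_coord polyfun_add polyfun_mult polyfun_uminus
  polyfun_diff polyfun_power

lemma polyfun_cong:
  assumes "polyfun n f" "\<And>i. i < n \<Longrightarrow> x i = y i"
  shows "f x = f y"
  using assms by (induction rule: polyfun.induct) auto

text \<open>Along a line, a polynomial function is a polynomial in the parameter.\<close>

lemma polyfun_line:
  assumes "polyfun n f"
  shows "\<exists>p. \<forall>s. f (\<lambda>i. u i + s * v i) = poly p s"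
  using assms
proof (induction rule: polyfun.induct)
  case (polyfun_const c)
  show ?case by (rule exI[of _ "[:c:]"]) simp
next
  case (polyfun_coord i)
  show ?case by (rule exI[of _ "[:u i, v i:]"]) simp
next
  case (polyfun_add f g)
  then obtain p q where "\<forall>s. f (\<lambda>i. u i + s * v i) = poly p s" "\<forall>s. g (\<lambda>i. u i + s * v i) = poly q s"
    by blast
  thus ?case by (intro exI[of _ "p + q"]) simp
next
  case (polyfun_mult f g)
  then obtain p q where "\<forall>s. f (\<lambda>i. u i + s * v i) = poly p s" "\<forall>s. g (\<lambda>i. u i + s * v i) = poly q s"
    by blast
  thus ?case by (intro exI[of _ "p * q"]) simp
qed

lemma polyfun_update:
  assumes "polyfun n f"
  shows "\<exists>p. \<forall>s. f (x(j := s)) = poly p s"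
proof -
  have "x(j := s) = (\<lambda>i. (x(j := 0)) i + s * (if i = j then 1 else 0))" for s by auto
  thus ?thesis using polyfun_line[OF assms, of "x(j := 0)" "\<lambda>i. if i = j then 1 else 0"] by simp
qed

lemma poly_eqI_infinite:
  fixes p q :: "'k::field_char_0 poly"
  assumes "\<And>s. poly p s = poly q s"
  shows "p = q"
  using assms poly_eq_poly_eq_iff by blast

text \<open>Polynomial functions over an infinite field form an integral domain: restrict to the line
  through a point where \<open>f\<close> and a point where \<open>g\<close> does not vanish.\<close>

lemma polyfun_mult_eq_0:
  fixes f g :: "(nat \<Rightarrow> 'k::field_char_0) \<Rightarrow> 'k"
  assumes "polyfun n f" "polyfun n g" "\<And>x. f x * g x = 0" "f u \<noteq> 0"
  shows "g x = 0"
proof -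
  define l where "l s = (\<lambda>i. u i + s * (x i - u i))" for s
  obtain p where p: "\<And>s. f (l s) = poly p s"
    using polyfun_line[OF assms(1), of u "\<lambda>i. x i - u i"] unfolding l_def by blast
  obtain q where q: "\<And>s. g (l s) = poly q s"
    using polyfun_line[OF assms(2), of u "\<lambda>i. x i - u i"] unfolding l_def by blast
  have l: "l 0 = u" "l 1 = x" by (simp_all add: l_def)
  have "poly p 0 \<noteq> 0" using p[of 0] assms(4) l by simp
  hence "p \<noteq> 0" by auto
  moreover have "p * q = 0"
    by (rule poly_eqI_infinite) (simp add: assms(3) p[symmetric] q[symmetric])
  ultimately show ?thesis using q[of 1] l by simp
qed

text \<open>The function \<open>f\<close> does not depend on the coordinate \<open>j\<close>.\<close>

definition free_of :: "nat \<Rightarrow> ((nat \<Rightarrow> 'k) \<Rightarrow> 'k) \<Rightarrow> bool" where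
  "free_of j f \<longleftrightarrow> (\<forall>x s. f (x(j := s)) = f x)"

lemma free_ofD: "free_of j f \<Longrightarrow> f (x(j := s)) = f x"
  by (simp add: free_of_def)

text \<open>Pseudo-division by a polynomial of degree at most one in the coordinate \<open>j\<close>, with leading
  coefficient \<open>l\<close>.\<close>

lemma pseudo_division:
  fixes g l r :: "(nat \<Rightarrow> 'k::field) \<Rightarrow> 'k"
  assumes "polyfun n g" and l: "polyfun n l" "free_of j l" and r: "polyfun n r" "free_of j r"
  shows "\<exists>k q h. polyfun n q \<and> polyfun n h \<and> free_of j h \<and>
    (\<forall>x. l x ^ k * g x = (x j * l x + r x) * q x + h x)"
  using assms(1)
proof (induction rule: polyfun.induct)
  case (polyfun_const c)
  show ?case
    by (rule exI[of _ 0], rule exI[of _ "\<lambda>x. 0"], rule exI[of _ "\<lambda>x. c"])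
       (simp add: polyfun_intros free_of_def)
next
  case (polyfun_coord i)
  show ?case
  proof (cases "i = j")
    case True
    show ?thesis
      by (rule exI[of _ 1], rule exI[of _ "\<lambda>x. 1"], rule exI[of _ "\<lambda>x. - r x"])
         (use r True in \<open>auto simp: polyfun_intros free_of_def\<close>)
  next
    case False
    show ?thesis
      by (rule exI[of _ 0], rule exI[of _ "\<lambda>x. 0"], rule exI[of _ "\<lambda>x. x i"])
         (use False polyfun_coord in \<open>auto simp: polyfun_intros free_of_def\<close>)
  qed
next
  case (polyfun_add f g)
  from polyfun_add.IH obtain k q h k' q' h' where
    1: "polyfun n q" "polyfun n h" "free_of j h" "\<And>x. l x ^ k * f x = (x j * l x + r x) * q x + h x" and
    2: "polyfun n q'" "polyfun n h'" "free_of j h'" "\<And>x. l x ^ k' * g x = (x j * l x + r x) * q' x + h' x"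
    by blast
  have "l x ^ (k + k') * (f x + g x) = l x ^ k' * (l x ^ k * f x) + l x ^ k * (l x ^ k' * g x)" for x
    by (simp add: power_add algebra_simps)
  hence "l x ^ (k + k') * (f x + g x) = (x j * l x + r x) * (l x ^ k' * q x + l x ^ k * q' x)
      + (l x ^ k' * h x + l x ^ k * h' x)" for x
    unfolding 1(4) 2(4) by (simp add: algebra_simps)
  thus ?case using 1 2 l
    by (intro exI[of _ "k + k'"] exI[of _ "\<lambda>x. l x ^ k' * q x + l x ^ k * q' x"]
        exI[of _ "\<lambda>x. l x ^ k' * h x + l x ^ k * h' x"] conjI polyfun_intros)
      (auto simp: free_of_def)
next
  case (polyfun_mult f g)
  from polyfun_mult.IH obtain k q h k' q' h' where
    1: "polyfun n q" "polyfun n h" "free_of j h" "\<And>x. l x ^ k * f x = (x j * l x + r x) * q x + h x" and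
    2: "polyfun n q'" "polyfun n h'" "free_of j h'" "\<And>x. l x ^ k' * g x = (x j * l x + r x) * q' x + h' x"
    by blast
  have "l x ^ (k + k') * (f x * g x) = (l x ^ k * f x) * (l x ^ k' * g x)" for x
    by (simp add: power_add algebra_simps)
  hence "l x ^ (k + k') * (f x * g x) = (x j * l x + r x) * (q x * (l x ^ k' * g x) + h x * q' x)
      + h x * h' x" for x
    unfolding 1(4) 2(4) by (simp add: algebra_simps)
  thus ?case using 1 2 l polyfun_mult.hyps
    by (intro exI[of _ "k + k'"] exI[of _ "\<lambda>x. q x * (l x ^ k' * g x) + h x * q' x"]
        exI[of _ "\<lambda>x. h x * h' x"] conjI polyfun_intros)
      (auto simp: free_of_def)
qed

section \<open>Cubic tensors and sums of three cubes\<close>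

text \<open>The symmetric tensor with the ten coordinates \<open>x\<close>. The coordinates \<open>x 0\<close>, \<open>x 1\<close>, \<open>x 2\<close>
  are its entries at \<open>000\<close>, \<open>111\<close>, \<open>222\<close>; the coordinates \<open>x 3, \<dots>, x 8\<close> are those at \<open>001\<close>,
  \<open>002\<close>, \<open>011\<close>, \<open>112\<close>, \<open>022\<close>, \<open>122\<close>; and \<open>x 9\<close> is the entry at \<open>012\<close>.\<close>

definition tens :: "(nat \<Rightarrow> 'k) \<Rightarrow> 3 \<Rightarrow> 3 \<Rightarrow> 3 \<Rightarrow> 'k" where
  "tens x = tri
     (tri (tri (x 0) (x 3) (x 4)) (tri (x 3) (x 5) (x 9)) (tri (x 4) (x 9) (x 7)))
     (tri (tri (x 3) (x 5) (x 9)) (tri (x 5) (x 1) (x 6)) (tri (x 9) (x 6) (x 8)))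
     (tri (tri (x 4) (x 9) (x 7)) (tri (x 9) (x 6) (x 8)) (tri (x 7) (x 8) (x 2)))"

text \<open>The weakly increasing index triple of the entry of \<open>tens x\<close> that is the coordinate \<open>x n\<close>.\<close>

definition mono_idx :: "nat \<Rightarrow> 3 \<Rightarrow> 3" where
  "mono_idx n = [tri 0 0 0, tri 1 1 1, tri 2 2 2, tri 0 0 1, tri 0 0 2,
     tri 0 1 1, tri 1 1 2, tri 0 2 2, tri 1 2 2, tri 0 1 2] ! n"

text \<open>The coordinates of the tensor \<open>\<Sum>l. g l \<otimes> g l \<otimes> g l\<close> of a sum of three cubes.\<close>

definition cube_sum :: "(3 \<Rightarrow> 3 \<Rightarrow> 'k::comm_semiring_1) \<Rightarrow> nat \<Rightarrow> 'k" where
  "cube_sum g n = (\<Sum>l\<in>UNIV. g l (mono_idx n 0) * g l (mono_idx n 1) * g l (mono_idx n 2))"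

lemma sum_UNIV3: "(\<Sum>i\<in>UNIV. f i) = f 0 + f 1 + f (2 :: 3)" for f :: "3 \<Rightarrow> 'a::comm_monoid_add"
  unfolding UNIV3 by (simp add: neq3 add.assoc)

lemma less10: "(n::nat) < 10 \<longleftrightarrow> n = 0 \<or> n = 1 \<or> n = 2 \<or> n = 3 \<or> n = 4 \<or> n = 5 \<or> n = 6 \<or> n = 7 \<or> n = 8 \<or> n = 9"
  by auto

lemma tens_sym: "tens x i j k = tens x j i k" "tens x i j k = tens x i k j"
proof -
  have "\<forall>i j k. tens x i j k = tens x j i k \<and> tens x i j k = tens x i k j"
    unfolding all3 tens_def by simp
  thus "tens x i j k = tens x j i k" "tens x i j k = tens x i k j" by blast+
qed

lemma tens_inj: "tens x = tens y \<Longrightarrow> n < 10 \<Longrightarrow> x n = y n"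
  unfolding less10 fun_eq_iff all3 tens_def by auto

lemma tens_cube_sum: "tens (cube_sum g) i j k = (\<Sum>l\<in>UNIV. g l i * g l j * g l k)"
proof -
  have "\<forall>i j k. tens (cube_sum g) i j k = (\<Sum>l\<in>UNIV. g l i * g l j * g l k)"
    unfolding all3 tens_def cube_sum_def mono_idx_def sum_UNIV3 by (simp add: mult_ac)
  thus ?thesis by blast
qed

text \<open>Let \<open>y\<close> be a basis with dual basis \<open>f\<close>. If all values of the symmetric tensor \<open>T\<close> on two
  different basis vectors and any third vector are zero, then only its values on a triple of equal
  basis vectors remain, and \<open>T\<close> is a combination of the cubes of the \<open>f l\<close>.\<close>

lemma tensor_diagonal:
  fixes T :: "3 \<Rightarrow> 3 \<Rightarrow> 3 \<Rightarrow> 'k::comm_ring_1" and y f :: "3 \<Rightarrow> 3 \<Rightarrow> 'k"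
  assumes sym: "\<And>i j k. T i j k = T j i k" "\<And>i j k. T i j k = T i k j"
    and orth: "\<And>l m k. l \<noteq> m \<Longrightarrow> (\<Sum>i\<in>UNIV. \<Sum>j\<in>UNIV. y l i * y m j * T i j k) = 0"
    and inv: "\<And>i j. (\<Sum>l\<in>UNIV. f l i * y l j) = (if i = j then 1 else 0)"
  shows "\<exists>d. \<forall>i j k. T i j k = (\<Sum>l\<in>UNIV. d l * (f l i * f l j * f l k))"
proof -
  have expand: "v i = (\<Sum>l\<in>UNIV. f l i * (\<Sum>j\<in>UNIV. y l j * v j))" for v :: "3 \<Rightarrow> 'k" and i
  proof -
    have "(\<Sum>l\<in>UNIV. f l i * (\<Sum>j\<in>UNIV. y l j * v j)) = (\<Sum>j\<in>UNIV. (\<Sum>l\<in>UNIV. f l i * y l j) * v j)"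
      unfolding sum_distrib_left sum_distrib_right by (subst sum.swap) (simp add: mult_ac)
    thus ?thesis by (simp add: inv if_distrib[where f = "\<lambda>a. a * _"] cong: if_cong)
  qed
  define V where "V l m k = (\<Sum>i\<in>UNIV. \<Sum>j\<in>UNIV. y l i * y m j * T i j k)" for l m k
  have V0: "V l m k = 0" if "l \<noteq> m" for l m k using orth[OF that] by (simp add: V_def)
  define d where "d l = (\<Sum>k\<in>UNIV. y l k * V l l k)" for l
  have V_swap: "(\<Sum>k\<in>UNIV. y n k * V l m k) = (\<Sum>k\<in>UNIV. y m k * V l n k)" for l m n
  proof -
    have "(\<Sum>k\<in>UNIV. y n k * V l m k) = (\<Sum>k\<in>UNIV. \<Sum>i\<in>UNIV. \<Sum>j\<in>UNIV. y l i * y m j * y n k * T i j k)"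
      by (simp add: V_def sum_distrib_left mult_ac)
    also have "\<dots> = (\<Sum>j\<in>UNIV. \<Sum>i\<in>UNIV. \<Sum>k\<in>UNIV. y l i * y m j * y n k * T i k j)"
      by (subst sum_swap3, subst (2) sum.swap, subst sum.swap) (simp add: sym(2))
    finally show ?thesis by (simp add: V_def sum_distrib_left mult_ac)
  qed
  have V_diag: "V l l k = f l k * d l" for l k
  proof -
    have "V l l k = (\<Sum>n\<in>UNIV. f n k * (\<Sum>k\<in>UNIV. y n k * V l l k))"
      by (rule expand)
    also have "\<dots> = (\<Sum>n\<in>UNIV. if n = l then f l k * d l else 0)"
    proof (rule sum.cong[OF refl])
      fix n :: 3
      show "f n k * (\<Sum>k\<in>UNIV. y n k * V l l k) = (if n = l then f l k * d l else 0)"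
        unfolding V_swap[of n l l] by (auto simp: d_def V0)
    qed
    finally show ?thesis by simp
  qed
  have "T i j k = (\<Sum>l\<in>UNIV. d l * (f l i * f l j * f l k))" for i j k
  proof -
    have "T i j k = (\<Sum>l\<in>UNIV. f l i * (\<Sum>i\<in>UNIV. y l i * T i j k))"
      by (rule expand)
    also have "\<dots> = (\<Sum>l\<in>UNIV. f l i * (\<Sum>m\<in>UNIV. f m j * V l m k))"
    proof (rule sum.cong[OF refl])
      fix l :: 3
      have "(\<Sum>i\<in>UNIV. y l i * T i j k) = (\<Sum>m\<in>UNIV. f m j * (\<Sum>j\<in>UNIV. y m j * (\<Sum>i\<in>UNIV. y l i * T i j k)))"
        by (rule expand[of "\<lambda>j. \<Sum>i\<in>UNIV. y l i * T i j k"])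
      moreover have "(\<Sum>j\<in>UNIV. y m j * (\<Sum>i\<in>UNIV. y l i * T i j k)) = V l m k" for m
        unfolding V_def sum_distrib_left by (subst sum.swap) (simp add: mult_ac)
      ultimately show "f l i * (\<Sum>i\<in>UNIV. y l i * T i j k) = f l i * (\<Sum>m\<in>UNIV. f m j * V l m k)"
        by simp
    qed
    also have "\<dots> = (\<Sum>l\<in>UNIV. d l * (f l i * f l j * f l k))"
    proof (rule sum.cong[OF refl])
      fix l :: 3
      have "(\<Sum>m\<in>UNIV. f m j * V l m k) = (\<Sum>m\<in>UNIV. if m = l then f l j * (f l k * d l) else 0)"
        by (rule sum.cong[OF refl]) (auto simp: V0 V_diag)
      thus "f l i * (\<Sum>m\<in>UNIV. f m j * V l m k) = d l * (f l i * f l j * f l k)"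
        by (simp add: mult_ac)
    qed
    finally show ?thesis .
  qed
  thus ?thesis by blast
qed

definition det3 :: "(3 \<Rightarrow> 3 \<Rightarrow> 'k::comm_ring) \<Rightarrow> 'k" where
  "det3 m = m 0 0 * (m 1 1 * m 2 2 - m 1 2 * m 2 1) - m 0 1 * (m 1 0 * m 2 2 - m 1 2 * m 2 0)
     + m 0 2 * (m 1 0 * m 2 1 - m 1 1 * m 2 0)"

text \<open>The adjugate of a 3 by 3 matrix.\<close>

definition adj3 :: "(3 \<Rightarrow> 3 \<Rightarrow> 'k::comm_ring) \<Rightarrow> 3 \<Rightarrow> 3 \<Rightarrow> 'k" where
  "adj3 m = tri
    (tri (m 1 1 * m 2 2 - m 1 2 * m 2 1) (m 0 2 * m 2 1 - m 0 1 * m 2 2) (m 0 1 * m 1 2 - m 0 2 * m 1 1))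
    (tri (m 1 2 * m 2 0 - m 1 0 * m 2 2) (m 0 0 * m 2 2 - m 0 2 * m 2 0) (m 0 2 * m 1 0 - m 0 0 * m 1 2))
    (tri (m 1 0 * m 2 1 - m 1 1 * m 2 0) (m 0 1 * m 2 0 - m 0 0 * m 2 1) (m 0 0 * m 1 1 - m 0 1 * m 1 0))"

text \<open>The Aronhold form: the difference of the entries at \<open>(1, 2)\<close> and \<open>(2, 1)\<close> of
  \<open>Q 1 * adj (Q 0) * Q 2\<close> for the matrices \<open>Q i = tens x i\<close>. It is defined over every commutative
  ring, so that it can be evaluated at scalars and at polynomials.\<close>

definition aronhold :: "(nat \<Rightarrow> 'k::comm_ring) \<Rightarrow> 'k" where
  "aronhold x = (\<Sum>i\<in>UNIV. \<Sum>j\<in>UNIV. adj3 (tens x 0) i j *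
     (tens x 1 1 i * tens x 2 2 j - tens x 1 2 i * tens x 1 2 j))"

text \<open>The coefficients of the characteristic polynomial \<open>det (tens x 1 - z * tens x 0)\<close> of the
  pencil, as a cubic in \<open>z\<close>.\<close>

definition pencil_coeff :: "(nat \<Rightarrow> 'k::comm_ring) \<Rightarrow> nat \<Rightarrow> 'k" where
  "pencil_coeff x n = [det3 (tens x 1),
     - (\<Sum>i\<in>UNIV. \<Sum>j\<in>UNIV. adj3 (tens x 1) i j * tens x 0 j i),
     (\<Sum>i\<in>UNIV. \<Sum>j\<in>UNIV. adj3 (tens x 0) i j * tens x 1 j i),
     - det3 (tens x 0)] ! n"

lemma det3_pencil:
  "det3 (\<lambda>i j. tens x 1 i j - z * tens x 0 i j) =
    pencil_coeff x 0 + pencil_coeff x 1 * z + pencil_coeff x 2 * z^2 + pencil_coeff x 3 * z^3"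
  for x :: "nat \<Rightarrow> 'k::comm_ring_1"
  unfolding pencil_coeff_def det3_def adj3_def sum_UNIV3
  by (simp add: algebra_simps power2_eq_square power3_eq_cube)

text \<open>The discriminant of the cubic \<open>c 0 + c 1 * z + c 2 * z^2 + c 3 * z^3\<close>.\<close>

definition cubic_disc :: "(nat \<Rightarrow> 'k::comm_ring_1) \<Rightarrow> 'k" where
  "cubic_disc c = (c 1)^2 * (c 2)^2 - 4 * (c 1)^3 * c 3 - 4 * c 0 * (c 2)^3 - 27 * (c 0)^2 * (c 3)^2
     + 18 * c 0 * c 1 * c 2 * c 3"

lemma cubic_disc_roots:
  fixes a :: "'k::field"
  assumes "c 3 = a" "c 2 = - a * (r + s + t)" "c 1 = a * (r * s + r * t + s * t)" "c 0 = - a * (r * s * t)"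
  shows "cubic_disc c = a^4 * ((r - s) * (r - t) * (s - t))^2"
  unfolding cubic_disc_def assms by (simp add: algebra_simps power2_eq_square power3_eq_cube power4_eq_xxxx)

lemma cubic_distinct_roots:
  fixes c :: "nat \<Rightarrow> 'k::alg_closed_field"
  assumes "c 3 \<noteq> 0" "cubic_disc c \<noteq> 0"
  shows "\<exists>r. inj r \<and> (\<forall>l :: 3. c 0 + c 1 * r l + c 2 * (r l)^2 + c 3 * (r l)^3 = 0)"
proof -
  define p where "p = [:c 0, c 1, c 2, c 3:]"
  have deg: "degree p = 3" using assms(1) by (simp add: p_def)
  obtain r where r: "poly p r = 0" using alg_closed_imp_poly_has_root[of p] deg by auto
  then obtain q where q: "p = [:- r, 1:] * q" by (auto simp: poly_eq_0_iff_dvd)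
  have "q \<noteq> 0" using q deg by auto
  hence dq: "degree q = 2" using deg unfolding q by (subst (asm) degree_mult_eq) auto
  obtain s where s: "poly q s = 0" using alg_closed_imp_poly_has_root[of q] dq by auto
  then obtain u where u: "q = [:- s, 1:] * u" by (auto simp: poly_eq_0_iff_dvd)
  have "u \<noteq> 0" using u dq by auto
  hence du: "degree u = 1" using dq unfolding u by (subst (asm) degree_mult_eq) auto
  obtain t where t: "poly u t = 0" using alg_closed_imp_poly_has_root[of u] du by auto
  then obtain v where v: "u = [:- t, 1:] * v" by (auto simp: poly_eq_0_iff_dvd)
  have "v \<noteq> 0" using v du by auto
  hence "degree v = 0" using du unfolding v by (subst (asm) degree_mult_eq) auto
  then obtain a where a: "v = [:a:]" by (auto elim: degree_eq_zeroE)
  have pe: "[:c 0, c 1, c 2, c 3:] = [:- r, 1:] * ([:- s, 1:] * ([:- t, 1:] * [:a:]))"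
    using q u v a by (simp add: p_def)
  have c: "c 3 = a" "c 2 = - a * (r + s + t)" "c 1 = a * (r * s + r * t + s * t)" "c 0 = - a * (r * s * t)"
    using pe by (simp_all add: algebra_simps)
  have "r \<noteq> s" "r \<noteq> t" "s \<noteq> t"
    using assms(2) cubic_disc_roots[of c a r s t, OF c] by auto
  hence "inj (tri r s t)" by (simp add: inj_def all3)
  moreover have "c 0 + c 1 * z + c 2 * z^2 + c 3 * z^3 = a * ((z - r) * (z - s) * (z - t))" for z
    unfolding c by algebra
  hence "\<forall>l. c 0 + c 1 * tri r s t l + c 2 * (tri r s t l)^2 + c 3 * (tri r s t l)^3 = 0"
    by (simp add: all3)
  ultimately show ?thesis by blast
qed

lemma det_det3: "det A = det3 (\<lambda>i j. A $ i $ j)" for A :: "'k::comm_ring_1^3^3"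
  unfolding det_3 det3_def three_eq_zero by (simp add: algebra_simps)

lemma kernel_vector:
  fixes m :: "3 \<Rightarrow> 3 \<Rightarrow> 'k::field"
  assumes "det3 m = 0"
  shows "\<exists>y. (\<exists>i. y i \<noteq> 0) \<and> (\<forall>i. (\<Sum>j\<in>UNIV. m i j * y j) = 0)"
proof -
  define A where "A = (\<chi> i j. m i j)"
  have "det A = 0" using assms by (simp add: A_def det_det3 det3_def)
  hence "\<not> invertible A" by (simp add: invertible_det_nz)
  hence "\<not> (\<forall>y. A *v y = 0 \<longrightarrow> y = 0)"
    using matrix_left_invertible_ker[of A] by (simp add: invertible_left_inverse)
  then obtain y where "A *v y = 0" "y \<noteq> 0" by blast
  thus ?thesis
    by (intro exI[of _ "\<lambda>i. y $ i"]) (auto simp: A_def matrix_vector_mult_def vec_eq_iff)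
qed

lemma det3_nz_kernel:
  fixes m :: "3 \<Rightarrow> 3 \<Rightarrow> 'k::field"
  assumes "det3 m \<noteq> 0" "\<And>i. (\<Sum>j\<in>UNIV. m i j * y j) = 0"
  shows "y i = 0"
proof -
  define A where "A = (\<chi> i j. m i j)"
  have "det A \<noteq> 0" using assms by (simp add: A_def det_det3 det3_def)
  hence "invertible A" by (simp add: invertible_det_nz)
  hence "\<forall>y. A *v y = 0 \<longrightarrow> y = 0"
    using matrix_left_invertible_ker[of A] by (simp add: invertible_left_inverse)
  moreover have "A *v (\<chi> i. y i) = 0"
    using assms(2) by (simp add: A_def matrix_vector_mult_def vec_eq_iff)
  ultimately have "(\<chi> i. y i) = 0" by blast
  thus ?thesis by (simp add: vec_eq_iff)
qed

text \<open>Three linearly independent vectors of a three-dimensional space have a dual basis: the inverse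
  of the matrix with rows \<open>y l\<close>.\<close>

lemma dual_basis:
  fixes y :: "3 \<Rightarrow> 3 \<Rightarrow> 'k::field"
  assumes indep: "\<And>c l. (\<And>i. (\<Sum>l\<in>UNIV. c l * y l i) = 0) \<Longrightarrow> c l = 0"
  shows "\<exists>f. \<forall>i j. (\<Sum>l\<in>UNIV. f l i * y l j) = (if i = j then 1 else 0)"
proof -
  define A where "A = (\<chi> l i. y l i)"
  have "\<exists>B. A ** B = mat 1"
    unfolding matrix_right_invertible_independent_rows
    using indep by (auto simp: A_def vec_eq_iff row_def)
  then obtain B where "B ** A = mat 1" using matrix_left_right_inverse by blast
  thus ?thesis
    by (intro exI[of _ "\<lambda>l i. B $ i $ l"]) (auto simp: A_def matrix_matrix_mult_def mat_def vec_eq_iff)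
qed

section \<open>Zeros of the Aronhold form, and division by monic polynomials\<close>

text \<open>Eigenvectors of the pencil \<open>tens x 1 - z * tens x 0\<close> for different eigenvalues are orthogonal
  for \<open>tens x 0\<close> and \<open>tens x 1\<close>, as always for symmetric matrices. When the Aronhold form vanishes they
  are orthogonal for \<open>tens x 2\<close> too.\<close>

lemma pencil_orthogonal:
  fixes x :: "nat \<Rightarrow> 'k::field"
  assumes S: "aronhold x = 0" and d: "det3 (tens x 0) \<noteq> 0" and rs: "r \<noteq> s"
    and p: "\<And>i. (\<Sum>j\<in>UNIV. (tens x 1 i j - r * tens x 0 i j) * p j) = 0"
    and q: "\<And>i. (\<Sum>j\<in>UNIV. (tens x 1 i j - s * tens x 0 i j) * q j) = 0"
  shows "(\<Sum>i\<in>UNIV. \<Sum>j\<in>UNIV. p i * q j * tens x k i j) = 0"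
proof -
  define B where "B k = (\<Sum>i\<in>UNIV. \<Sum>j\<in>UNIV. p i * q j * tens x k i j)" for k
  have p': "(\<Sum>j\<in>UNIV. tens x 1 i j * p j) = r * (\<Sum>j\<in>UNIV. tens x 0 i j * p j)" for i
    using p[of i] by (simp add: sum_UNIV3 algebra_simps)
  have q': "(\<Sum>j\<in>UNIV. tens x 1 i j * q j) = s * (\<Sum>j\<in>UNIV. tens x 0 i j * q j)" for i
    using q[of i] by (simp add: sum_UNIV3 algebra_simps)
  have Bq: "B k = (\<Sum>i\<in>UNIV. p i * (\<Sum>j\<in>UNIV. tens x k i j * q j))" for k
    by (simp add: B_def sum_distrib_left mult_ac)
  have Bp: "B k = (\<Sum>i\<in>UNIV. q i * (\<Sum>j\<in>UNIV. tens x k i j * p j))" for k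
    unfolding B_def by (subst sum.swap) (simp add: sum_distrib_left mult_ac tens_sym(2)[of x k])
  have "B 1 = r * B 0"
    unfolding Bp[of 1] p' Bp[of 0] by (simp add: sum_distrib_left mult_ac)
  moreover have "B 1 = s * B 0"
    unfolding Bq[of 1] q' Bq[of 0] by (simp add: sum_distrib_left mult_ac)
  ultimately have B01: "B 0 = 0" "B 1 = 0" using rs by auto
  define u where "u i = (\<Sum>j\<in>UNIV. tens x 1 i j * p j)" for i
  define v where "v i = (\<Sum>j\<in>UNIV. tens x 1 i j * q j)" for i
  define w where "w i = (\<Sum>j\<in>UNIV. tens x 2 i j * q j)" for i
  define z where "z i = (\<Sum>j\<in>UNIV. tens x 2 i j * p j)" for i
  define C where "C a b = (\<Sum>i\<in>UNIV. \<Sum>j\<in>UNIV. adj3 (tens x 0) i j * a i * b j)" for a b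
  have adj: "C (\<lambda>i. t * (\<Sum>j\<in>UNIV. tens x 0 i j * a j)) b
      = t * (det3 (tens x 0) * (\<Sum>i\<in>UNIV. a i * b i))" for t a b
    unfolding C_def sum_UNIV3 adj3_def det3_def tens_def by (simp add: algebra_simps)
  have "C u w = r * (det3 (tens x 0) * B 2)"
    unfolding u_def p' adj Bq w_def ..
  moreover have "C v z = s * (det3 (tens x 0) * B 2)"
    unfolding v_def q' adj Bp z_def ..
  \<comment> \<open>The matrix of \<open>C u w\<close> in \<open>p\<close> and \<open>q\<close> is \<open>Q 1 * adj (Q 0) * Q 2\<close>, and that of \<open>C v z\<close> is its
    transpose.\<close>
  moreover have "C u w - C v z = aronhold x * (p 1 * q 2 - p 2 * q 1)"
    unfolding C_def u_def v_def w_def z_def aronhold_def sum_UNIV3 adj3_def tens_def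
    by (simp add: algebra_simps)
  ultimately have "(r - s) * (det3 (tens x 0) * B 2) = 0"
    using S by (simp add: algebra_simps)
  hence "B 2 = 0" using rs d by simp
  thus ?thesis using B01 cases3[of k] unfolding B_def by auto
qed

text \<open>Eigenvectors for distinct eigenvalues of a pencil \<open>m1 - z * m0\<close> with invertible \<open>m0\<close> are
  linearly independent.\<close>

lemma pencil_independent:
  fixes m0 m1 y :: "3 \<Rightarrow> 3 \<Rightarrow> 'k::field" and r c :: "3 \<Rightarrow> 'k"
  assumes d: "det3 m0 \<noteq> 0" and r: "inj r"
    and y: "\<And>l i. (\<Sum>j\<in>UNIV. (m1 i j - r l * m0 i j) * y l j) = 0"
    and nz: "\<And>l. \<exists>i. y l i \<noteq> 0"
    and c: "\<And>i. (\<Sum>l\<in>UNIV. c l * y l i) = 0"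
  shows "c l = 0"
proof -
  have y': "(\<Sum>j\<in>UNIV. m1 i j * y l j) = r l * (\<Sum>j\<in>UNIV. m0 i j * y l j)" for l i
    using y[of i l] by (simp add: sum_UNIV3 algebra_simps)
  have step: "(\<Sum>l\<in>UNIV. c l * r l * y l i) = 0" if c: "\<And>i. (\<Sum>l\<in>UNIV. c l * y l i) = 0" for c i
  proof (rule det3_nz_kernel[OF d])
    fix i
    have "(\<Sum>j\<in>UNIV. m0 i j * (\<Sum>l\<in>UNIV. c l * r l * y l j))
        = (\<Sum>l\<in>UNIV. c l * (r l * (\<Sum>j\<in>UNIV. m0 i j * y l j)))"
      unfolding sum_distrib_left by (subst sum.swap) (simp add: mult_ac)
    also have "\<dots> = (\<Sum>j\<in>UNIV. m1 i j * (\<Sum>l\<in>UNIV. c l * y l j))"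
      unfolding y'[symmetric] unfolding sum_distrib_left by (subst sum.swap) (simp add: mult_ac)
    finally show "(\<Sum>j\<in>UNIV. m0 i j * (\<Sum>l\<in>UNIV. c l * r l * y l j)) = 0"
      by (simp add: c)
  qed
  have c1: "(\<Sum>l\<in>UNIV. c l * r l * y l i) = 0" for i by (rule step[OF c])
  have c2: "(\<Sum>l\<in>UNIV. c l * r l * r l * y l i) = 0" for i by (rule step[OF c1])
  \<comment> \<open>Lagrange interpolation: a combination of the three relations isolates each summand.\<close>
  have v: "c 0 * y 0 i * ((r 0 - r 1) * (r 0 - r 2)) = 0"
     "c 1 * y 1 i * ((r 1 - r 0) * (r 1 - r 2)) = 0"
     "c 2 * y 2 i * ((r 2 - r 0) * (r 2 - r 1)) = 0" for i
    using c[of i] c1[of i] c2[of i] unfolding sum_UNIV3 by algebra+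
  have "c l * y l i = 0" for l i
    using cases3[of l] v[of i] r neq3 by (auto simp: inj_eq)
  thus ?thesis using nz[of l] by auto
qed

text \<open>A zero of the Aronhold form is a sum of three cubes, provided that the pencil
  \<open>tens x 1 - z * tens x 0\<close> is regular with three distinct eigenvalues.\<close>

lemma aronhold_zero_imp_cube_sum:
  fixes x :: "nat \<Rightarrow> 'k::{alg_closed_field, field_char_0}"
  assumes S: "aronhold x = 0" and d: "pencil_coeff x 3 \<noteq> 0" and disc: "cubic_disc (pencil_coeff x) \<noteq> 0"
  shows "\<exists>g. \<forall>n<10. x n = cube_sum g n"
proof -
  obtain r :: "3 \<Rightarrow> 'k" where r: "inj r"
    "\<And>l. pencil_coeff x 0 + pencil_coeff x 1 * r l + pencil_coeff x 2 * (r l)^2 + pencil_coeff x 3 * (r l)^3 = 0"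
    using cubic_distinct_roots[of "pencil_coeff x"] d disc by blast
  have d0: "det3 (tens x 0) \<noteq> 0" using d by (simp add: pencil_coeff_def)
  have "\<exists>y. (\<exists>i. y i \<noteq> 0) \<and> (\<forall>i. (\<Sum>j\<in>UNIV. (tens x 1 i j - r l * tens x 0 i j) * y j) = 0)" for l
    using r(2)[of l] by (intro kernel_vector) (simp add: det3_pencil)
  then obtain y where y: "\<And>l. \<exists>i. y l i \<noteq> 0"
    "\<And>l i. (\<Sum>j\<in>UNIV. (tens x 1 i j - r l * tens x 0 i j) * y l j) = 0"
    by metis
  obtain f where f: "\<And>i j. (\<Sum>l\<in>UNIV. f l i * y l j) = (if i = j then 1 else 0)"
    using dual_basis[of y] pencil_independent[OF d0 r(1) y(2) y(1)] by blast
  have "\<exists>d. \<forall>i j k. tens x i j k = (\<Sum>l\<in>UNIV. d l * (f l i * f l j * f l k))"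
  proof (rule tensor_diagonal[where y = y])
    fix l m k :: 3
    assume "l \<noteq> m"
    hence "r l \<noteq> r m" using r(1) by (simp add: inj_eq)
    have "(\<Sum>i\<in>UNIV. \<Sum>j\<in>UNIV. y l i * y m j * tens x i j k) = (\<Sum>i\<in>UNIV. \<Sum>j\<in>UNIV. y l i * y m j * tens x k i j)"
      by (intro sum.cong refl) (metis tens_sym)
    also have "\<dots> = 0" by (rule pencil_orthogonal[OF S d0 \<open>r l \<noteq> r m\<close> y(2) y(2)])
    finally show "(\<Sum>i\<in>UNIV. \<Sum>j\<in>UNIV. y l i * y m j * tens x i j k) = 0" .
  qed (use tens_sym f in blast)+
  then obtain d where d: "\<And>i j k. tens x i j k = (\<Sum>l\<in>UNIV. d l * (f l i * f l j * f l k))"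
    by blast
  have "\<exists>t. t ^ 3 = d l" for l using nth_root_exists[of 3 "d l"] by simp
  then obtain t where t: "\<And>l. t l ^ 3 = d l" by metis
  define g where "g l i = t l * f l i" for l i
  have "tens x i j k = tens (cube_sum g) i j k" for i j k
    unfolding tens_cube_sum d g_def t[symmetric] by (simp add: power3_eq_cube mult_ac)
  hence "tens x = tens (cube_sum g)" by (intro ext)
  thus ?thesis using tens_inj by blast
qed

text \<open>Division with remainder by a polynomial that is monic of degree \<open>d\<close> in the coordinate \<open>j\<close>.
  It is enough that the functions with a remainder of the required shape (\<open>red\<close> in the proof) are
  closed under sums, under multiplication by functions free of \<open>x j\<close>, and under multiplication by
  \<open>x j\<close>.\<close>

lemma monic_division:
  fixes a :: "nat \<Rightarrow> (nat \<Rightarrow> 'k::field) \<Rightarrow> 'k"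
  assumes "polyfun n g" and "j < n" and a: "\<And>i. i < d \<Longrightarrow> polyfun n (a i)" "\<And>i. i < d \<Longrightarrow> free_of j (a i)"
    and d: "d > 0"
  shows "\<exists>q b. polyfun n q \<and> (\<forall>i<d. polyfun n (b i) \<and> free_of j (b i)) \<and>
    (\<forall>x. g x = (x j ^ d + (\<Sum>i<d. a i x * x j ^ i)) * q x + (\<Sum>i<d. b i x * x j ^ i))"
proof -
  define S where "S x = x j ^ d + (\<Sum>i<d. a i x * x j ^ i)" for x
  define red where "red g \<longleftrightarrow> (\<exists>q b. polyfun n q \<and> (\<forall>i<d. polyfun n (b i) \<and> free_of j (b i)) \<and>
    (\<forall>x. g x = S x * q x + (\<Sum>i<d. b i x * x j ^ i)))" for g
  have S: "polyfun n S" unfolding S_def using a(1) \<open>j < n\<close>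
    by (intro polyfun_intros polyfun_sum) auto
  have red_free: "red f" if "polyfun n f" "free_of j f" for f
  proof -
    define b where "b i = (if i = 0 then f else (\<lambda>_. 0))" for i :: nat
    have "(\<Sum>i<d. b i x * x j ^ i) = (\<Sum>i<d. if i = 0 then f x else 0)" for x
      by (intro sum.cong) (auto simp: b_def)
    hence "f x = S x * 0 + (\<Sum>i<d. b i x * x j ^ i)" for x using d by simp
    moreover have "polyfun n (b i) \<and> free_of j (b i)" for i
      using that by (simp add: b_def polyfun_intros free_of_def)
    ultimately show ?thesis unfolding red_def
      by (intro exI[of _ "\<lambda>_. 0"] exI[of _ b]) (simp add: polyfun_const)
  qed
  have red_add: "red (\<lambda>x. f x + g x)" if f: "red f" and g: "red g" for f g
  proof -
    obtain q b where 1: "polyfun n q" "\<And>i. i < d \<Longrightarrow> polyfun n (b i)" "\<And>i. i < d \<Longrightarrow> free_of j (b i)"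
      "\<And>x. f x = S x * q x + (\<Sum>i<d. b i x * x j ^ i)" using f unfolding red_def by blast
    obtain q' b' where 2: "polyfun n q'" "\<And>i. i < d \<Longrightarrow> polyfun n (b' i)" "\<And>i. i < d \<Longrightarrow> free_of j (b' i)"
      "\<And>x. g x = S x * q' x + (\<Sum>i<d. b' i x * x j ^ i)" using g unfolding red_def by blast
    show ?thesis unfolding red_def 1(4) 2(4) using 1(1-3) 2(1-3)
      by (intro exI[of _ "\<lambda>x. q x + q' x"] exI[of _ "\<lambda>i x. b i x + b' i x"])
        (auto simp: free_of_def polyfun_intros algebra_simps sum.distrib)
  qed
  have red_scale: "red (\<lambda>x. h x * f x)" if f: "red f" and h: "polyfun n h" "free_of j h" for f h
  proof -
    obtain q b where 1: "polyfun n q" "\<And>i. i < d \<Longrightarrow> polyfun n (b i)" "\<And>i. i < d \<Longrightarrow> free_of j (b i)"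
      "\<And>x. f x = S x * q x + (\<Sum>i<d. b i x * x j ^ i)" using f unfolding red_def by blast
    show ?thesis unfolding red_def 1(4) using 1(1-3) h
      by (intro exI[of _ "\<lambda>x. h x * q x"] exI[of _ "\<lambda>i x. h x * b i x"])
        (auto simp: free_of_def polyfun_intros algebra_simps sum_distrib_left)
  qed
  have red_S: "red (\<lambda>x. S x * f x)" if "polyfun n f" for f
    unfolding red_def using that
    by (intro exI[of _ f] exI[of _ "\<lambda>i x. 0"]) (auto simp: free_of_def polyfun_intros)
  have red_shift: "red (\<lambda>x. x j * f x)" if f: "red f" for f
  proof -
    obtain q b where 1: "polyfun n q" "\<And>i. i < d \<Longrightarrow> polyfun n (b i)" "\<And>i. i < d \<Longrightarrow> free_of j (b i)"
      "\<And>x. f x = S x * q x + (\<Sum>i<d. b i x * x j ^ i)" using f unfolding red_def by blast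
    obtain e where e: "d = Suc e" using d by (cases d) auto
    \<comment> \<open>The new remainder: shift the old one and reduce its term of degree \<open>d\<close>.\<close>
    define b' where "b' i x = (if i = 0 then 0 else b (i - 1) x) - b e x * a i x" for i x
    have "x j * f x = S x * (x j * q x + b e x) + (\<Sum>i<d. b' i x * x j ^ i)" for x
    proof -
      have "x j * (\<Sum>i<d. b i x * x j ^ i) = (\<Sum>i<e. b i x * x j ^ Suc i) + b e x * x j ^ d"
        by (simp add: e sum_distrib_left algebra_simps)
      also have "(\<Sum>i<e. b i x * x j ^ Suc i) = (\<Sum>i<d. (if i = 0 then 0 else b (i - 1) x) * x j ^ i)"
        unfolding e by (subst sum.lessThan_Suc_shift) simp
      also have "b e x * x j ^ d = b e x * S x - (\<Sum>i<d. b e x * a i x * x j ^ i)"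
        by (simp add: S_def algebra_simps sum_distrib_left)
      finally have "x j * (\<Sum>i<d. b i x * x j ^ i) = b e x * S x + (\<Sum>i<d. b' i x * x j ^ i)"
        by (simp add: b'_def algebra_simps sum_subtractf)
      thus ?thesis unfolding 1(4) by (simp add: algebra_simps)
    qed
    moreover have "polyfun n (b' i) \<and> free_of j (b' i)" if "i < d" for i
      using that 1(2,3)[of "i - 1"] 1(2,3)[of e] a[of i] e
      unfolding b'_def by (cases "i = 0") (auto simp: free_of_def intro!: polyfun_intros)
    ultimately show ?thesis unfolding red_def using 1(1) 1(2)[of e] e \<open>j < n\<close>
      by (intro exI[of _ "\<lambda>x. x j * q x + b e x"] exI[of _ b']) (auto intro!: polyfun_intros)
  qed
  have red_pow: "red (\<lambda>x. x j ^ i * f x)" if "red f" for f i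
  proof (induction i)
    case (Suc i)
    thus ?case using red_shift[of "\<lambda>x. x j ^ i * f x"] by (simp add: mult.assoc)
  qed (use that in simp)
  have red_sum: "red (\<lambda>x. \<Sum>i<e. f i x)" if "\<And>i. i < e \<Longrightarrow> red (f i)" for f and e :: nat
    using that
  proof (induction e)
    case 0
    show ?case using red_free[of "\<lambda>x. 0"] by (simp add: polyfun_intros free_of_def)
  next
    case (Suc e)
    thus ?case using red_add[of "\<lambda>x. \<Sum>i<e. f i x" "f e"] by simp
  qed
  have "red g" using assms(1)
  proof (induction rule: polyfun.induct)
    case (polyfun_const c)
    show ?case by (rule red_free) (simp_all add: polyfun_intros free_of_def)
  next
    case (polyfun_coord i)
    have "red (\<lambda>x. x j * 1)"
      by (rule red_shift, rule red_free) (simp_all add: polyfun_intros free_of_def)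
    moreover have "red (\<lambda>x. x i)" if "i \<noteq> j"
      by (rule red_free) (use that polyfun_coord in \<open>simp_all add: polyfun_intros free_of_def\<close>)
    ultimately show ?case by (cases "i = j") simp_all
  next
    case (polyfun_add f g)
    thus ?case by (intro red_add)
  next
    case (polyfun_mult f g)
    obtain q b where 1: "polyfun n q" "\<And>i. i < d \<Longrightarrow> polyfun n (b i)" "\<And>i. i < d \<Longrightarrow> free_of j (b i)"
      "\<And>x. f x = S x * q x + (\<Sum>i<d. b i x * x j ^ i)"
      using polyfun_mult.IH(1) unfolding red_def by blast
    have "red (\<lambda>x. S x * (q x * g x) + (\<Sum>i<d. b i x * (x j ^ i * g x)))"
      using 1(1-3) polyfun_mult.hyps
      by (intro red_add red_sum red_S red_scale red_pow polyfun_mult.IH(2) polyfun_intros) auto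
    moreover have "(\<lambda>x. S x * (q x * g x) + (\<Sum>i<d. b i x * (x j ^ i * g x))) = (\<lambda>x. f x * g x)"
      by (simp add: 1(4) fun_eq_iff algebra_simps sum_distrib_left)
    ultimately show ?case by simp
  qed
  thus ?thesis unfolding red_def S_def .
qed

text \<open>A polynomial of degree less than \<open>d\<close> in the coordinate \<open>j\<close> that is a multiple of a monic one
  of degree \<open>d\<close> is zero.\<close>

lemma monic_multiple_eq_0:
  fixes a b :: "nat \<Rightarrow> (nat \<Rightarrow> 'k::field_char_0) \<Rightarrow> 'k"
  assumes a: "\<And>i. i < d \<Longrightarrow> free_of j (a i)" and b: "\<And>i. i < d \<Longrightarrow> free_of j (b i)"
    and q: "polyfun n q" and d: "d > 0"
    and eq: "\<And>x. (\<Sum>i<d. b i x * x j ^ i) = (x j ^ d + (\<Sum>i<d. a i x * x j ^ i)) * q x"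
  shows "(\<Sum>i<d. b i x * x j ^ i) = 0"
proof -
  obtain p where p: "\<And>s. q (x(j := s)) = poly p s" using polyfun_update[OF q] by blast
  define B where "B = (\<Sum>i<d. monom (b i x) i)"
  define A where "A = (\<Sum>i<d. monom (a i x) i)"
  have deg: "degree (\<Sum>i<d. monom (c i) i) < d" for c :: "nat \<Rightarrow> 'k"
  proof -
    have "degree (\<Sum>i<d. monom (c i) i) \<le> d - 1"
      by (rule degree_sum_le) (auto intro: order.trans[OF degree_monom_le])
    thus ?thesis using d by simp
  qed
  have "poly B s = poly ((monom 1 d + A) * p) s" for s
    using eq[of "x(j := s)"] a b
    by (simp add: A_def B_def poly_sum poly_monom p free_ofD)
  hence BA: "B = (monom 1 d + A) * p" by (rule poly_eqI_infinite)
  have dA: "degree (monom 1 d + A) = d"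
    using deg[of "\<lambda>i. a i x"] unfolding A_def by (subst degree_add_eq_left) (simp_all add: degree_monom_eq)
  have "p = 0"
  proof (rule ccontr)
    assume "p \<noteq> 0"
    moreover have "monom 1 d + A \<noteq> 0" using dA d by auto
    ultimately have "degree B = degree (monom 1 d + A) + degree p"
      unfolding BA by (intro degree_mult_eq)
    thus False using dA deg[of "\<lambda>i. b i x"] unfolding B_def by simp
  qed
  hence "poly B (x j) = 0" by (simp add: BA)
  thus ?thesis by (simp add: B_def poly_sum poly_monom)
qed

section \<open>The ideal of the sums of three cubes\<close>

text \<open>The coefficient of \<open>x 0\<close> in the Aronhold form, arranged by powers of \<open>x 9\<close>.\<close>

definition aronhold_lead :: "(nat \<Rightarrow> 'k::comm_ring) \<Rightarrow> 'k" where
  "aronhold_lead x = x 9 * (x 6 * x 8 - x 1 * x 2)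
     + (x 1 * x 7 * x 8 + x 2 * x 5 * x 6 - x 5 * x 8 * x 8 - x 6 * x 6 * x 7)"

text \<open>The part of the Aronhold form that is free of \<open>x 0\<close>.\<close>

definition aronhold_rest :: "(nat \<Rightarrow> 'k::comm_ring) \<Rightarrow> 'k" where
  "aronhold_rest x = aronhold (x(0 := 0))"

text \<open>The coefficients of the Aronhold form as a monic polynomial of degree four in \<open>x 9\<close>.\<close>

definition aronhold_coeff :: "nat \<Rightarrow> (nat \<Rightarrow> 'k::comm_ring_1) \<Rightarrow> 'k" where
  "aronhold_coeff i x = [x 0 * x 1 * x 7 * x 8 + x 0 * x 2 * x 5 * x 6 - x 0 * x 5 * x 8 * x 8
     - x 0 * x 6 * x 6 * x 7 + x 1 * x 2 * x 3 * x 4 - x 1 * x 3 * x 7 * x 7 - x 1 * x 4 * x 4 * x 8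
     - x 2 * x 3 * x 3 * x 6 - x 2 * x 4 * x 5 * x 5 + x 3 * x 3 * x 8 * x 8 - x 3 * x 4 * x 6 * x 8
     - x 3 * x 5 * x 7 * x 8 + x 4 * x 4 * x 6 * x 6 - x 4 * x 5 * x 6 * x 7 + x 5 * x 5 * x 7 * x 7,
     x 0 * x 6 * x 8 - x 0 * x 1 * x 2 + x 1 * x 4 * x 7 + x 2 * x 3 * x 5 + 3 * x 3 * x 6 * x 7
     + 3 * x 4 * x 5 * x 8,
     - 2 * x 3 * x 8 - 2 * x 4 * x 6 - 2 * x 5 * x 7,
     0] ! i"

lemma less4: "(i::nat) < 4 \<longleftrightarrow> i = 0 \<or> i = 1 \<or> i = 2 \<or> i = 3"
  by auto

lemma sum_lessThan_4: "(\<Sum>i<4. f i) = f 0 + f 1 + f 2 + f (3::nat)" for f :: "nat \<Rightarrow> 'a::comm_monoid_add"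
  by (simp add: eval_nat_numeral add.assoc)

lemma aronhold_monic:
  "aronhold x = x 9 ^ 4 + (\<Sum>i<4. aronhold_coeff i x * x 9 ^ i)" for x :: "nat \<Rightarrow> 'k::comm_ring_1"
  unfolding aronhold_def sum_UNIV3 sum_lessThan_4 adj3_def tens_def aronhold_coeff_def
  by (simp add: algebra_simps power2_eq_square power3_eq_cube power4_eq_xxxx)

lemma aronhold_linear:
  "aronhold x = x 0 * aronhold_lead x + aronhold_rest x" for x :: "nat \<Rightarrow> 'k::comm_ring_1"
  unfolding aronhold_rest_def aronhold_monic sum_lessThan_4 aronhold_coeff_def aronhold_lead_def
  by (simp add: algebra_simps power2_eq_square power3_eq_cube power4_eq_xxxx)

lemma polyfun_aronhold_lead: "polyfun 10 aronhold_lead"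
  unfolding aronhold_lead_def[abs_def] by (intro polyfun_intros) simp_all

lemma polyfun_aronhold_coeff: "i < 4 \<Longrightarrow> polyfun 10 (aronhold_coeff i)"
  unfolding less4 aronhold_coeff_def[abs_def] by (elim disjE; simp; intro polyfun_intros; simp)

lemma polyfun_aronhold: "polyfun 10 aronhold"
  unfolding aronhold_monic[abs_def]
  by (intro polyfun_intros polyfun_sum polyfun_aronhold_coeff) auto

lemma polyfun_aronhold_rest: "polyfun 10 (aronhold_rest :: (nat \<Rightarrow> 'k::field) \<Rightarrow> 'k)"
proof -
  have "aronhold_rest = (\<lambda>x :: nat \<Rightarrow> 'k. aronhold x - x 0 * aronhold_lead x)"
    by (simp add: fun_eq_iff aronhold_linear)
  moreover have "polyfun 10 (\<lambda>x :: nat \<Rightarrow> 'k. aronhold x - x 0 * aronhold_lead x)"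
    by (intro polyfun_intros polyfun_aronhold polyfun_aronhold_lead) simp
  ultimately show ?thesis by (simp only:)
qed

lemma tens_polyfun: "polyfun 10 (\<lambda>x. tens x i j k)"
proof -
  have "\<forall>i j k. polyfun 10 (\<lambda>x. tens x i j k)"
    unfolding all3 tens_def tri_simps by (intro conjI polyfun_coord) simp_all
  thus ?thesis by blast
qed

lemma polyfun_pencil_coeff: "i < 4 \<Longrightarrow> polyfun 10 (\<lambda>x. pencil_coeff x i)"
  unfolding less4 pencil_coeff_def det3_def adj3_def sum_UNIV3
  by (elim disjE; simp; intro polyfun_intros tens_polyfun)

lemma polyfun_disc: "polyfun 10 (\<lambda>x. cubic_disc (pencil_coeff x))"
  unfolding cubic_disc_def by (intro polyfun_intros polyfun_pencil_coeff) simp_all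

text \<open>The cross product.\<close>

definition cross :: "(3 \<Rightarrow> 'k::comm_ring) \<Rightarrow> (3 \<Rightarrow> 'k) \<Rightarrow> 3 \<Rightarrow> 'k" where
  "cross u v = tri (u 1 * v 2 - u 2 * v 1) (u 2 * v 0 - u 0 * v 2) (u 0 * v 1 - u 1 * v 0)"

text \<open>The Cauchy-Binet formula for the minors of the product of \<open>transpose g\<close>, the diagonal matrix
  with entries \<open>a l\<close>, and \<open>g\<close>.\<close>

lemma adj3_sum_squares:
  fixes g :: "3 \<Rightarrow> 3 \<Rightarrow> 'k::comm_ring_1"
  shows "adj3 (\<lambda>i j. \<Sum>l\<in>UNIV. a l * (g l i * g l j)) i j =
    a 1 * a 2 * (cross (g 1) (g 2) i * cross (g 1) (g 2) j)
    + a 2 * a 0 * (cross (g 2) (g 0) i * cross (g 2) (g 0) j)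
    + a 0 * a 1 * (cross (g 0) (g 1) i * cross (g 0) (g 1) j)" (is "?L i j = ?R i j")
proof -
  have "\<forall>i j. ?L i j = ?R i j"
    unfolding all3 adj3_def cross_def sum_UNIV3 tri_simps
    by (intro conjI; simp add: algebra_simps)
  thus ?thesis by blast
qed

lemma cross_dot:
  fixes g :: "3 \<Rightarrow> 3 \<Rightarrow> 'k::comm_ring_1"
  shows "(\<Sum>i\<in>UNIV. cross (g 1) (g 2) i * (\<Sum>l\<in>UNIV. p l * g l i)) = p 0 * det3 g"
    "(\<Sum>i\<in>UNIV. cross (g 2) (g 0) i * (\<Sum>l\<in>UNIV. p l * g l i)) = p 1 * det3 g"
    "(\<Sum>i\<in>UNIV. cross (g 0) (g 1) i * (\<Sum>l\<in>UNIV. p l * g l i)) = p 2 * det3 g"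
  unfolding sum_UNIV3 cross_def det3_def by (simp_all add: algebra_simps)

text \<open>On a sum of three cubes all vectors in the definition of the Aronhold form are combinations of
  the \<open>g l\<close>. The adjugate is then diagonal by \<open>adj3_sum_squares\<close> and \<open>cross_dot\<close>, and both summands
  are equal to the sum of the \<open>a l * a m * (g n 1 * g n 2)^2 * (det3 g)^2\<close> over the three choices of
  \<open>n\<close>, with \<open>l\<close> and \<open>m\<close> the other two indices.\<close>

lemma aronhold_cube_sum: "aronhold (cube_sum g) = 0" for g :: "3 \<Rightarrow> 3 \<Rightarrow> 'k::comm_ring_1"
proof -
  define a where "a l = g l 0" for l
  define F where "F p q = (\<Sum>i\<in>UNIV. \<Sum>j\<in>UNIV. adj3 (tens (cube_sum g) 0) i j *
     ((\<Sum>l\<in>UNIV. p l * g l i) * (\<Sum>l\<in>UNIV. q l * g l j)))" for p q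
  have t0: "tens (cube_sum g) 0 = (\<lambda>i j. \<Sum>l\<in>UNIV. a l * (g l i * g l j))"
    by (simp add: tens_cube_sum fun_eq_iff a_def mult_ac)
  have bilin: "(\<Sum>i\<in>UNIV. \<Sum>j\<in>UNIV. c * (w i * w j) * (u i * v j)) =
      c * (\<Sum>i\<in>UNIV. w i * u i) * (\<Sum>i\<in>UNIV. w i * v i)" for c and w u v :: "3 \<Rightarrow> 'k"
    by (simp add: sum_product sum_distrib_left mult_ac)
  have F: "F p q = (det3 g)^2 * (a 1 * a 2 * (p 0 * q 0) + a 2 * a 0 * (p 1 * q 1) + a 0 * a 1 * (p 2 * q 2))" for p q
    unfolding F_def t0 adj3_sum_squares distrib_right sum.distrib bilin cross_dot
    by (simp add: algebra_simps power2_eq_square)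
  have "aronhold (cube_sum g) = F (\<lambda>l. g l 1 * g l 1) (\<lambda>l. g l 2 * g l 2)
      - F (\<lambda>l. g l 1 * g l 2) (\<lambda>l. g l 1 * g l 2)"
    by (simp add: aronhold_def F_def tens_cube_sum sum_subtractf right_diff_distrib)
  also have "\<dots> = 0" unfolding F by (simp add: algebra_simps)
  finally show ?thesis .
qed

text \<open>\<close>

text \<open>A sum of three cubes at which none of the polynomials that have to be invertible vanishes. The
  eigenvalues of its pencil are the quotients \<open>g l 1 / g l 0\<close>, here 1, 0, 2; the leading coefficient
  is nonzero because the three vectors are independent and remain pairwise independent modulo
  \<open>(1, 0, 0)\<close>.\<close>

lemma generic_point:
  fixes g :: "3 \<Rightarrow> 3 \<Rightarrow> 'k::field_char_0"
  assumes g: "g = tri (tri 1 1 0) (tri 1 0 1) (tri 1 2 1)"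
  shows "aronhold_lead (cube_sum g) \<noteq> 0" "pencil_coeff (cube_sum g) 3 \<noteq> 0"
    "cubic_disc (pencil_coeff (cube_sum g)) \<noteq> 0"
  unfolding g aronhold_lead_def cubic_disc_def pencil_coeff_def det3_def adj3_def sum_UNIV3
    tens_cube_sum cube_sum_def mono_idx_def by simp_all

text \<open>A polynomial that vanishes on the nonzero sums of three cubes is a multiple of the Aronhold
  form.\<close>

theorem aronhold_dvd:
  fixes G :: "(nat \<Rightarrow> 'k::{alg_closed_field, field_char_0}) \<Rightarrow> 'k"
  assumes G: "polyfun 10 G"
    and vanish: "\<And>g. \<exists>n<10. cube_sum g n \<noteq> 0 \<Longrightarrow> G (cube_sum g) = 0"
  shows "\<exists>H. polyfun 10 H \<and> (\<forall>x. G x = aronhold x * H x)"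
proof -
  let ?S = "aronhold :: (nat \<Rightarrow> 'k) \<Rightarrow> 'k" and ?L = "aronhold_lead :: (nat \<Rightarrow> 'k) \<Rightarrow> 'k"
  have free: "free_of 0 ?L" "free_of 0 (aronhold_rest :: (nat \<Rightarrow> 'k) \<Rightarrow> 'k)"
    by (simp_all add: free_of_def aronhold_lead_def aronhold_rest_def)
  have coeff_free: "free_of 9 (aronhold_coeff i :: (nat \<Rightarrow> 'k) \<Rightarrow> 'k)" if "i < 4" for i
    using that unfolding less4 by (elim disjE; simp add: free_of_def aronhold_coeff_def)
  have "\<exists>q b. polyfun 10 q \<and> (\<forall>i<4. polyfun 10 (b i) \<and> free_of 9 (b i)) \<and>
      (\<forall>x. G x = ?S x * q x + (\<Sum>i<4. b i x * x 9 ^ i))"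
    unfolding aronhold_monic
    by (rule monic_division[OF G]) (simp_all add: polyfun_aronhold_coeff coeff_free)
  then obtain Q b where Qb: "polyfun 10 Q" "\<And>i. i < 4 \<Longrightarrow> polyfun 10 (b i)" "\<And>i. i < 4 \<Longrightarrow> free_of 9 (b i)"
    "\<And>x. G x = ?S x * Q x + (\<Sum>i<4. b i x * x 9 ^ i)"
    by blast
  define R1 where "R1 x = (\<Sum>i<4. b i x * x 9 ^ i)" for x
  have R1: "polyfun 10 R1" unfolding R1_def
    by (intro polyfun_sum polyfun_intros Qb(2)) auto
  obtain k Y R0 where Y: "polyfun 10 Y" "polyfun 10 R0" "free_of 0 R0"
    "\<And>x. ?L x ^ k * R1 x = ?S x * Y x + R0 x"
    using pseudo_division[OF R1 polyfun_aronhold_lead free(1) polyfun_aronhold_rest free(2)]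
    unfolding aronhold_linear by blast
  define E where "E x = pencil_coeff x 3 * cubic_disc (pencil_coeff x)" for x :: "nat \<Rightarrow> 'k"
  have E: "polyfun 10 E" unfolding E_def
    by (intro polyfun_intros polyfun_disc polyfun_pencil_coeff) simp
  obtain k' Y' E0 where Y': "polyfun 10 Y'" "polyfun 10 E0" "free_of 0 E0"
    "\<And>x. ?L x ^ k' * E x = ?S x * Y' x + E0 x"
    using pseudo_division[OF E polyfun_aronhold_lead free(1) polyfun_aronhold_rest free(2)]
    unfolding aronhold_linear by blast
  \<comment> \<open>\<open>E0\<close> is free of \<open>x 0\<close> and agrees on the zeros of \<open>S\<close> with a multiple of \<open>E\<close>. So if \<open>L\<close> and \<open>E0\<close>
    do not vanish at \<open>x\<close>, then \<open>x 0\<close> can be changed to reach a zero of \<open>S\<close> that is a sum of three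
    cubes, without changing \<open>R0\<close>.\<close>
  have R0_generic: "R0 x = 0" if x: "?L x \<noteq> 0" "E0 x \<noteq> 0" for x
  proof -
    define x' where "x' = x(0 := - aronhold_rest x / ?L x)"
    have L': "?L x' = ?L x" and E0': "E0 x' = E0 x" and R0': "R0 x' = R0 x"
      unfolding x'_def by (rule free_ofD, fact)+
    have S': "?S x' = 0"
      unfolding aronhold_linear L' using free_ofD[OF free(2)] x(1) by (simp add: x'_def)
    have "E x' \<noteq> 0" using Y'(4)[of x'] x unfolding S' E0' L' by auto
    hence E': "pencil_coeff x' 3 \<noteq> 0" "cubic_disc (pencil_coeff x') \<noteq> 0" by (simp_all add: E_def)
    obtain g where g: "\<forall>n<10. x' n = cube_sum g n"
      using aronhold_zero_imp_cube_sum[OF S' E'] by blast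
    have "\<exists>n<10. cube_sum g n \<noteq> 0"
    proof (rule ccontr)
      assume "\<not> ?thesis"
      hence "x' n = 0" if "n < 10" for n using g that by auto
      hence "pencil_coeff x' 3 = 0" unfolding pencil_coeff_def det3_def tens_def by simp
      thus False using E'(1) by simp
    qed
    hence "G (cube_sum g) = 0" by (rule vanish)
    hence "G x' = 0" using polyfun_cong[OF G, of x' "cube_sum g"] g by simp
    hence "R1 x' = 0" using Qb(4)[of x'] by (simp add: S' R1_def)
    thus ?thesis using Y(4)[of x'] by (simp add: S' R0')
  qed
  have R0: "R0 x = 0" for x
  proof -
    define g :: "3 \<Rightarrow> 3 \<Rightarrow> 'k" where "g = tri (tri 1 1 0) (tri 1 0 1) (tri 1 2 1)"
    have "?L (cube_sum g) \<noteq> 0" "E (cube_sum g) \<noteq> 0"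
      using generic_point[OF g_def] by (simp_all add: E_def)
    hence "?L (cube_sum g) * E0 (cube_sum g) \<noteq> 0"
      using Y'(4)[of "cube_sum g"] by (auto simp: aronhold_cube_sum)
    moreover have "?L x * E0 x * R0 x = 0" for x
      using R0_generic[of x] by auto
    ultimately show ?thesis
      by (rule polyfun_mult_eq_0[OF polyfun_mult[OF polyfun_aronhold_lead Y'(2)] Y(2), rotated])
  qed
  \<comment> \<open>\<open>L\<close> is linear in \<open>x 9\<close> with coefficient \<open>x 6 * x 8 - x 1 * x 2\<close>. Eliminating \<open>x 9\<close> from \<open>S\<close> and
    \<open>L\<close> gives \<open>N\<close>.\<close>
  obtain m Z N where Z: "polyfun 10 Z" "polyfun 10 N" "free_of 9 N"
    "\<And>x. (x 6 * x 8 - x 1 * x 2) ^ m * ?S x = ?L x * Z x + N x"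
    using pseudo_division[OF polyfun_aronhold, of "\<lambda>x. x 6 * x 8 - x 1 * x 2" 9
        "\<lambda>x. x 1 * x 7 * x 8 + x 2 * x 5 * x 6 - x 5 * x 8 * x 8 - x 6 * x 6 * x 7"]
    unfolding aronhold_lead_def
    by (simp add: polyfun_intros free_of_def) blast
  \<comment> \<open>A zero of \<open>L\<close> at which neither \<open>S\<close> nor the leading coefficient of \<open>L\<close> vanishes; it shows that
    \<open>N\<close> is not zero.\<close>
  define p :: "nat \<Rightarrow> 'k" where "p n = (if n \<in> {1, 2, 3, 4} then 1 else 0)" for n
  have p: "?L p = 0" "?S p = 1" "p 6 * p 8 - p 1 * p 2 = - 1"
    unfolding aronhold_lead_def aronhold_monic aronhold_coeff_def sum_lessThan_4 by (simp_all add: p_def)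
  have "N p \<noteq> 0" using Z(4)[of p] unfolding p by auto
  hence Nk: "N p ^ k \<noteq> 0" by simp
  have "\<exists>W. polyfun 10 W \<and> (\<forall>x. N x ^ k * R1 x = ?S x * W x)"
  proof -
    \<comment> \<open>Modulo \<open>S\<close>, the polynomial \<open>N\<close> is a multiple of \<open>L\<close>.\<close>
    have "\<exists>V. polyfun 10 V \<and> (\<forall>x. N x ^ i = (- ?L x * Z x) ^ i + ?S x * V x)" for i
    proof (induction i)
      case 0
      show ?case by (rule exI[of _ "\<lambda>_. 0"]) (simp add: polyfun_const)
    next
      case (Suc i)
      then obtain V where V: "polyfun 10 V" "\<And>x. N x ^ i = (- ?L x * Z x) ^ i + ?S x * V x" by blast
      have N: "N x = (- ?L x * Z x) + ?S x * (x 6 * x 8 - x 1 * x 2) ^ m" for x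
        using Z(4)[of x] by (simp add: algebra_simps)
      have "N x ^ Suc i = (- ?L x * Z x) ^ Suc i +
          ?S x * ((- ?L x * Z x) * V x + (x 6 * x 8 - x 1 * x 2) ^ m * N x ^ i)" for x
      proof -
        have "N x ^ Suc i = (- ?L x * Z x) * N x ^ i + ?S x * ((x 6 * x 8 - x 1 * x 2) ^ m * N x ^ i)"
          by (subst power_Suc, subst (1) N) (simp add: algebra_simps)
        also have "(- ?L x * Z x) * N x ^ i = (- ?L x * Z x) ^ Suc i + ?S x * ((- ?L x * Z x) * V x)"
          unfolding V(2) by (simp add: algebra_simps)
        finally show ?thesis by (simp add: algebra_simps)
      qed
      moreover have "polyfun 10 (\<lambda>x. (- ?L x * Z x) * V x + (x 6 * x 8 - x 1 * x 2) ^ m * N x ^ i)"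
        by (intro polyfun_intros polyfun_aronhold_lead Z V) simp_all
      ultimately show ?case by blast
    qed
    then obtain V where V: "polyfun 10 V" "\<And>x. N x ^ k = (- ?L x * Z x) ^ k + ?S x * V x" by blast
    have "N x ^ k * R1 x = ?S x * ((- Z x) ^ k * Y x + V x * R1 x)" for x
    proof -
      have "N x ^ k * R1 x = (- Z x) ^ k * (?L x ^ k * R1 x) + ?S x * V x * R1 x"
        unfolding V(2) by (simp add: algebra_simps flip: power_mult_distrib)
      thus ?thesis unfolding Y(4) R0 by (simp add: algebra_simps)
    qed
    moreover have "polyfun 10 (\<lambda>x. (- Z x) ^ k * Y x + V x * R1 x)"
      by (intro polyfun_intros Z Y V R1)
    ultimately show ?thesis by blast
  qed
  then obtain W where W: "polyfun 10 W" "\<And>x. N x ^ k * R1 x = ?S x * W x" by blast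
  have "N x ^ k * R1 x = 0" for x
  proof -
    have eq: "N x ^ k * R1 x = (\<Sum>i<4. (N x ^ k * b i x) * x 9 ^ i)" for x
      by (simp add: R1_def sum_distrib_left mult_ac)
    show ?thesis unfolding eq
    proof (rule monic_multiple_eq_0[where a = aronhold_coeff and q = W])
      show "free_of 9 (\<lambda>x. N x ^ k * b i x)" if "i < 4" for i
        using Z(3) Qb(3)[OF that] by (simp add: free_of_def)
    qed (use W coeff_free in \<open>simp_all add: aronhold_monic[symmetric] eq[symmetric]\<close>)
  qed
  hence "R1 x = 0" for x
    using polyfun_mult_eq_0[OF polyfun_power[OF Z(2)] R1 _ Nk] by blast
  thus ?thesis using Qb(1,4) unfolding R1_def by auto
qed

section \<open>Evaluation of polynomials on cubics\<close>

text \<open>The value of the monomial \<open>m\<close> at the point \<open>a\<close>.\<close>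

definition monom_eval :: "('x \<Rightarrow> 'k::comm_semiring_1) \<Rightarrow> ('x \<Rightarrow>\<^sub>0 nat) \<Rightarrow> 'k" where
  "monom_eval a m = (\<Prod>x\<in>Poly_Mapping.keys m. a x ^ Poly_Mapping.lookup m x)"

lemma monom_eval_superset:
  assumes "finite S" "Poly_Mapping.keys m \<subseteq> S"
  shows "monom_eval a m = (\<Prod>x\<in>S. a x ^ Poly_Mapping.lookup m x)"
  unfolding monom_eval_def
  by (rule prod.mono_neutral_left) (use assms in \<open>auto simp: in_keys_iff\<close>)

lemma monom_eval_add: "monom_eval a (m + m') = monom_eval a m * monom_eval a m'"
proof -
  let ?S = "Poly_Mapping.keys m \<union> Poly_Mapping.keys m'"
  have "Poly_Mapping.keys (m + m') \<subseteq> ?S" by (rule keys_add)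
  thus ?thesis
    by (simp add: monom_eval_superset[of ?S] lookup_add power_add prod.distrib)
qed

lemma mdeg_superset:
  assumes "finite S" "Poly_Mapping.keys m \<subseteq> S"
  shows "mdeg m = (\<Sum>x\<in>S. Poly_Mapping.lookup m x)"
  unfolding mdeg_def
  by (rule sum.mono_neutral_left) (use assms in \<open>auto simp: in_keys_iff\<close>)

lemma mdeg_add: "mdeg (m + m') = mdeg m + mdeg m'"
proof -
  let ?S = "Poly_Mapping.keys m \<union> Poly_Mapping.keys m'"
  have "Poly_Mapping.keys (m + m') \<subseteq> ?S" by (rule keys_add)
  thus ?thesis by (simp add: mdeg_superset[of ?S] lookup_add sum.distrib)
qed

lemma mdeg_0 [simp]: "mdeg 0 = 0"
  by (simp add: mdeg_def)

lemma mdeg_single [simp]: "mdeg (Poly_Mapping.single x k) = k"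
  by (simp add: mdeg_def)

lemma peval_superset:
  assumes "finite S" "Poly_Mapping.keys p \<subseteq> S"
  shows "peval a p = (\<Sum>m\<in>S. Poly_Mapping.lookup p m * monom_eval a m)"
  unfolding peval_def monom_eval_def
  by (rule sum.mono_neutral_left) (use assms in \<open>auto simp: in_keys_iff\<close>)

lemma peval_add: "peval a (p + q) = peval a p + peval a q"
proof -
  let ?S = "Poly_Mapping.keys p \<union> Poly_Mapping.keys q"
  have "Poly_Mapping.keys (p + q) \<subseteq> ?S" by (rule keys_add)
  thus ?thesis by (simp add: peval_superset[of ?S] lookup_add distrib_right sum.distrib)
qed

lemma peval_0 [simp]: "peval a 0 = 0"
  by (simp add: peval_def)

lemma peval_sum: "peval a (\<Sum>i\<in>I. p i) = (\<Sum>i\<in>I. peval a (p i))"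
  by (induction I rule: infinite_finite_induct) (simp_all add: peval_add)

lemma peval_single: "peval a (Poly_Mapping.single m c) = c * monom_eval a m"
  by (subst peval_superset[of "{m}"]) simp_all

lemma peval_const [simp]: "peval a (const c) = c"
  by (simp add: const_def peval_single monom_eval_def)

lemma peval_var [simp]: "peval a (var x) = a x"
  by (simp add: var_def peval_single monom_eval_def)

lemma poly_mapping_eq_sum_single:
  "p = (\<Sum>m\<in>Poly_Mapping.keys p. Poly_Mapping.single m (Poly_Mapping.lookup p m))"
proof (rule poly_mapping_eqI)
  fix k
  have "Poly_Mapping.lookup (\<Sum>m\<in>Poly_Mapping.keys p. Poly_Mapping.single m (Poly_Mapping.lookup p m)) k
      = (\<Sum>m\<in>Poly_Mapping.keys p. if m = k then Poly_Mapping.lookup p k else 0)"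
    unfolding lookup_sum by (intro sum.cong) (auto simp: lookup_single when_def)
  thus "Poly_Mapping.lookup p k = Poly_Mapping.lookup (\<Sum>m\<in>Poly_Mapping.keys p.
      Poly_Mapping.single m (Poly_Mapping.lookup p m)) k"
    by (simp add: in_keys_iff)
qed

lemma peval_mult: "peval a (p * q) = peval a p * peval a q"
proof -
  have "peval a (p * q) = peval a ((\<Sum>m\<in>Poly_Mapping.keys p. Poly_Mapping.single m (Poly_Mapping.lookup p m)) *
      (\<Sum>m\<in>Poly_Mapping.keys q. Poly_Mapping.single m (Poly_Mapping.lookup q m)))"
    by (simp flip: poly_mapping_eq_sum_single)
  also have "\<dots> = peval a p * peval a q"
    unfolding sum_product peval_sum mult_single peval_single monom_eval_add
    by (simp add: peval_superset[of "Poly_Mapping.keys p"] peval_superset[of "Poly_Mapping.keys q"]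
        sum_product mult_ac)
  finally show ?thesis .
qed

lemma peval_diff: "peval a (p - q) = peval a p - peval a q" for p q :: "('x, 'k::comm_ring_1) mpoly"
  using peval_add[of a "p - q" q] by (simp add: algebra_simps)

lemma homogeneous_add: "homogeneous d p \<Longrightarrow> homogeneous d q \<Longrightarrow> homogeneous d (p + q)"
  using keys_add[of p q] by (auto simp: homogeneous_def)

lemma homogeneous_uminus: "homogeneous d p \<Longrightarrow> homogeneous d (- p)"
  by (simp add: homogeneous_def in_keys_iff)

lemma homogeneous_diff: "homogeneous d p \<Longrightarrow> homogeneous d q \<Longrightarrow> homogeneous d (p - q)"
  for p q :: "('x, 'k::ab_group_add) mpoly"
  using homogeneous_add[of d p "- q"] homogeneous_uminus[of d q] by simp

lemma homogeneous_0 [simp]: "homogeneous d 0"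
  by (simp add: homogeneous_def)

lemma homogeneous_sum: "(\<And>i. i \<in> I \<Longrightarrow> homogeneous d (p i)) \<Longrightarrow> homogeneous d (\<Sum>i\<in>I. p i)"
  by (induction I rule: infinite_finite_induct) (auto intro: homogeneous_add)

lemma homogeneous_mult: "homogeneous d p \<Longrightarrow> homogeneous d' q \<Longrightarrow> homogeneous (d + d') (p * q)"
  unfolding homogeneous_def using keys_mult[of p q] by (auto simp: mdeg_add dest!: subsetD)

lemma homogeneous_const: "homogeneous 0 (const c)"
  by (simp add: homogeneous_def const_def)

lemma homogeneous_var: "homogeneous 1 (var x)"
  by (simp add: homogeneous_def var_def)

lemma coord_ring_add: "p \<in> coord_ring \<Longrightarrow> q \<in> coord_ring \<Longrightarrow> p + q \<in> coord_ring"
  using keys_add[of p q] by (auto simp: coord_ring_def)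

lemma coord_ring_uminus: "p \<in> coord_ring \<Longrightarrow> - p \<in> coord_ring"
  by (simp add: coord_ring_def in_keys_iff)

lemma coord_ring_diff: "p \<in> coord_ring \<Longrightarrow> q \<in> coord_ring \<Longrightarrow> p - q \<in> coord_ring"
  for p q :: "(3 \<Rightarrow>\<^sub>0 nat, 'k::ab_group_add) mpoly"
  using coord_ring_add[of p "- q"] coord_ring_uminus[of q] by simp

lemma coord_ring_mult: "p \<in> coord_ring \<Longrightarrow> q \<in> coord_ring \<Longrightarrow> p * q \<in> coord_ring"
proof -
  assume p: "p \<in> coord_ring" and q: "q \<in> coord_ring"
  have "mdeg m = 3" if t: "t \<in> Poly_Mapping.keys (p * q)" and m: "m \<in> Poly_Mapping.keys t" for t m
  proof -
    obtain u v where uv: "t = u + v" "u \<in> Poly_Mapping.keys p" "v \<in> Poly_Mapping.keys q"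
      using t keys_mult[of p q] by blast
    have "m \<in> Poly_Mapping.keys u \<union> Poly_Mapping.keys v" using m keys_add[of u v] uv(1) by blast
    thus ?thesis using p q uv by (auto simp: coord_ring_def)
  qed
  thus ?thesis by (simp add: coord_ring_def)
qed

lemma coord_ring_const: "const c \<in> coord_ring"
  by (simp add: coord_ring_def const_def)

lemma coord_ring_0: "0 \<in> coord_ring"
  by (simp add: coord_ring_def)

lemma coord_ring_sum: "(\<And>i. i \<in> I \<Longrightarrow> p i \<in> coord_ring) \<Longrightarrow> (\<Sum>i\<in>I. p i) \<in> coord_ring"
  by (induction I rule: infinite_finite_induct) (auto intro: coord_ring_add coord_ring_0)

lemma coord_ring_var: "mdeg m = 3 \<Longrightarrow> var m \<in> coord_ring"
  by (simp add: coord_ring_def var_def)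

lemma peval_homogeneous:
  assumes "homogeneous d p"
  shows "peval (\<lambda>x. s * a x) p = s ^ d * peval a p"
proof -
  have "monom_eval (\<lambda>x. s * a x) m = s ^ d * monom_eval a m" if "m \<in> Poly_Mapping.keys p" for m
    using assms that
    by (simp add: homogeneous_def monom_eval_def power_mult_distrib prod.distrib mdeg_def power_sum[symmetric])
  thus ?thesis
    by (simp add: peval_superset[of "Poly_Mapping.keys p"] sum_distrib_left mult_ac)
qed

text \<open>The ten monomials of degree three, in the order of the coordinates of \<open>tens\<close>.\<close>

abbreviation cubic_mon :: "nat \<Rightarrow> 3 \<Rightarrow>\<^sub>0 nat" where
  "cubic_mon n \<equiv> mon (mono_idx n)"

lemma mdeg_mon: "mdeg (mon v) = 3"
  unfolding mon_def sum_UNIV3 by (simp add: mdeg_add)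

lemma cubic_mon_inj:
  assumes "m < 10" "n < 10"
  shows "cubic_mon m = cubic_mon n \<longleftrightarrow> m = n"
proof -
  \<comment> \<open>A number that determines the first two exponents, hence the monomial.\<close>
  let ?k = "\<lambda>n. Poly_Mapping.lookup (cubic_mon n) 0 + 4 * Poly_Mapping.lookup (cubic_mon n) 1"
  let ?L = "[3, 12, 0, 6, 2, 9, 8, 1, 4, 5] :: nat list"
  have "?k n = ?L ! n" if "n < 10" for n
    using that unfolding less10 lookup_mon
    by (elim disjE; simp add: mono_idx_def neq3)
  hence "?L ! m = ?L ! n" if "cubic_mon m = cubic_mon n" using assms that by metis
  moreover have "distinct ?L" by simp
  ultimately show ?thesis using assms nth_eq_iff_index_eq[of ?L m n] by auto
qed

lemma sum3_nat: "i + j + k = 3 \<Longrightarrow>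
    i = 3 \<and> j = 0 \<and> k = 0 \<or>
    i = 0 \<and> j = 3 \<and> k = 0 \<or>
    i = 0 \<and> j = 0 \<and> k = 3 \<or>
    i = 2 \<and> j = 1 \<and> k = 0 \<or>
    i = 2 \<and> j = 0 \<and> k = 1 \<or>
    i = 1 \<and> j = 2 \<and> k = 0 \<or>
    i = 0 \<and> j = 2 \<and> k = 1 \<or>
    i = 1 \<and> j = 0 \<and> k = 2 \<or>
    i = 0 \<and> j = 1 \<and> k = 2 \<or>
    i = 1 \<and> j = 1 \<and> k = 1" for i j k :: nat
  by presburger

lemma mdeg_3_imp_cubic_mon:
  assumes "mdeg m = 3"
  shows "\<exists>n<10. m = cubic_mon n"
proof -
  let ?l = "Poly_Mapping.lookup m"
  have sum: "?l 0 + ?l 1 + ?l 2 = 3"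
    using assms mdeg_superset[of UNIV m] by (simp add: sum_UNIV3)
  have m: "m = cubic_mon n" if "?l 0 = Poly_Mapping.lookup (cubic_mon n) 0"
    "?l 1 = Poly_Mapping.lookup (cubic_mon n) 1" "?l 2 = Poly_Mapping.lookup (cubic_mon n) 2" for n
  proof (rule poly_mapping_eqI)
    fix k show "?l k = Poly_Mapping.lookup (cubic_mon n) k"
      using cases3[of k] that by (elim disjE) simp_all
  qed
  from sum3_nat[OF sum] show ?thesis
    apply (elim disjE)
    subgoal by (intro exI[of _ 0] conjI m) (simp_all add: lookup_mon mono_idx_def neq3)
    subgoal by (intro exI[of _ 1] conjI m) (simp_all add: lookup_mon mono_idx_def neq3)
    subgoal by (intro exI[of _ 2] conjI m) (simp_all add: lookup_mon mono_idx_def neq3)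
    subgoal by (intro exI[of _ 3] conjI m) (simp_all add: lookup_mon mono_idx_def neq3)
    subgoal by (intro exI[of _ 4] conjI m) (simp_all add: lookup_mon mono_idx_def neq3)
    subgoal by (intro exI[of _ 5] conjI m) (simp_all add: lookup_mon mono_idx_def neq3)
    subgoal by (intro exI[of _ 6] conjI m) (simp_all add: lookup_mon mono_idx_def neq3)
    subgoal by (intro exI[of _ 7] conjI m) (simp_all add: lookup_mon mono_idx_def neq3)
    subgoal by (intro exI[of _ 8] conjI m) (simp_all add: lookup_mon mono_idx_def neq3)
    subgoal by (intro exI[of _ 9] conjI m) (simp_all add: lookup_mon mono_idx_def neq3)
    done
qed

text \<open>The number of permutations that fix the index triple \<open>mono_idx n\<close>.\<close>

definition mon_weight :: "nat \<Rightarrow> 'k::comm_ring_1" where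
  "mon_weight n = [6, 6, 6, 2, 2, 2, 2, 2, 2, 1] ! n"

lemma mon_weight_nz: "n < 10 \<Longrightarrow> mon_weight n \<noteq> (0 :: 'k::field_char_0)"
  unfolding less10 mon_weight_def by auto

text \<open>The coordinates of the symmetric tensor of a cubic. The entry at \<open>i j k\<close> is the coefficient of
  the monomial multiplied by its weight, which is 6 times the entry of the tensor whose cubic
  form is \<open>\<phi>\<close>. With this normalization the contraction operator has integral coefficients, and the
  cube of a linear form with coefficients \<open>a\<close> has the tensor \<open>6 * a i * a j * a k\<close>.\<close>

definition coords :: "(3, 'k::comm_ring_1) mpoly \<Rightarrow> nat \<Rightarrow> 'k" where
  "coords \<phi> n = mon_weight n * Poly_Mapping.lookup \<phi> (cubic_mon n)"

text \<open>The cubic with given coordinates, the inverse of \<open>coords\<close>.\<close>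

definition cubic_of :: "(nat \<Rightarrow> 'k::field) \<Rightarrow> (3, 'k) mpoly" where
  "cubic_of x = (\<Sum>n<10. Poly_Mapping.single (cubic_mon n) (x n / mon_weight n))"

lemma cubic_of_in_cubics: "cubic_of x \<in> cubics"
  unfolding cubics_def cubic_of_def mem_Collect_eq
  by (rule homogeneous_sum) (simp add: homogeneous_def mdeg_mon)

lemma lookup_cubic_of:
  assumes "n < 10"
  shows "Poly_Mapping.lookup (cubic_of x) (cubic_mon n) = x n / mon_weight n"
proof -
  have "Poly_Mapping.lookup (cubic_of x) (cubic_mon n) = (\<Sum>m<10. if m = n then x n / mon_weight n else 0)"
    unfolding cubic_of_def lookup_sum
    by (intro sum.cong refl) (use assms cubic_mon_inj in \<open>auto simp: lookup_single when_def\<close>)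
  thus ?thesis using assms by simp
qed

lemma coords_cubic_of: "n < 10 \<Longrightarrow> coords (cubic_of x) n = (x n :: 'k::field_char_0)"
  by (simp add: coords_def lookup_cubic_of mon_weight_nz)

lemma cubics_eqI:
  assumes "\<phi> \<in> cubics" "\<psi> \<in> cubics"
    and eq: "\<And>n. n < 10 \<Longrightarrow> Poly_Mapping.lookup \<phi> (cubic_mon n) = Poly_Mapping.lookup \<psi> (cubic_mon n)"
  shows "\<phi> = \<psi>"
proof (rule poly_mapping_eqI)
  fix m
  show "Poly_Mapping.lookup \<phi> m = Poly_Mapping.lookup \<psi> m"
  proof (cases "mdeg m = 3")
    case True
    thus ?thesis using mdeg_3_imp_cubic_mon eq by blast
  next
    case False
    hence "m \<notin> Poly_Mapping.keys \<phi>" "m \<notin> Poly_Mapping.keys \<psi>"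
      using assms by (auto simp: cubics_def homogeneous_def)
    thus ?thesis by (simp add: in_keys_iff)
  qed
qed

lemma cubic_of_coords: "\<phi> \<in> cubics \<Longrightarrow> cubic_of (coords \<phi>) = \<phi>" for \<phi> :: "(3, 'k::field_char_0) mpoly"
  by (rule cubics_eqI) (simp_all add: cubic_of_in_cubics lookup_cubic_of coords_def mon_weight_nz)

lemma polyfun_lookup_cubic_of: "polyfun 10 (\<lambda>x. Poly_Mapping.lookup (cubic_of x) m)"
proof (cases "mdeg m = 3")
  case True
  then obtain n where n: "n < 10" "m = cubic_mon n" using mdeg_3_imp_cubic_mon by blast
  have "polyfun 10 (\<lambda>x. x n * (1 / mon_weight n))" using n by (intro polyfun_intros)
  thus ?thesis using n by (simp add: lookup_cubic_of)
next
  case False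
  hence "Poly_Mapping.lookup (cubic_of x) m = 0" for x :: "nat \<Rightarrow> 'a"
    using cubic_of_in_cubics[of x] by (auto simp: cubics_def homogeneous_def in_keys_iff)
  thus ?thesis by (simp add: polyfun_const)
qed

lemma polyfun_peval: "polyfun 10 (\<lambda>x. peval (Poly_Mapping.lookup (cubic_of x)) F)"
  unfolding peval_def by (intro polyfun_intros polyfun_sum polyfun_prod polyfun_lookup_cubic_of)

lemma polyfun_imp_coord_ring:
  assumes "polyfun 10 f"
  shows "\<exists>F\<in>coord_ring. \<forall>\<phi>. peval (Poly_Mapping.lookup \<phi>) F = f (coords \<phi>)"
  using assms
proof (induction rule: polyfun.induct)
  case (polyfun_const c)
  show ?case by (rule bexI[of _ "const c"]) (simp_all add: coord_ring_const)
next
  case (polyfun_coord n)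
  show ?case
    by (rule bexI[of _ "const (mon_weight n) * var (cubic_mon n)"])
      (simp_all add: peval_mult coords_def coord_ring_mult coord_ring_const coord_ring_var mdeg_mon)
next
  case (polyfun_add f g)
  then obtain F G where "F \<in> coord_ring" "\<And>\<phi>. peval (Poly_Mapping.lookup \<phi>) F = f (coords \<phi>)"
    "G \<in> coord_ring" "\<And>\<phi>. peval (Poly_Mapping.lookup \<phi>) G = g (coords \<phi>)" by blast
  thus ?case by (intro bexI[of _ "F + G"]) (simp_all add: peval_add coord_ring_add)
next
  case (polyfun_mult f g)
  then obtain F G where "F \<in> coord_ring" "\<And>\<phi>. peval (Poly_Mapping.lookup \<phi>) F = f (coords \<phi>)"
    "G \<in> coord_ring" "\<And>\<phi>. peval (Poly_Mapping.lookup \<phi>) G = g (coords \<phi>)" by blast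
  thus ?case by (intro bexI[of _ "F * G"]) (simp_all add: peval_mult coord_ring_mult)
qed

text \<open>The digits of a number in base \<open>B\<close> are unique.\<close>

lemma digits_unique:
  fixes B :: nat
  assumes "(\<Sum>n<N. a n * B ^ n) = (\<Sum>n<N. b n * B ^ n)" "\<And>n. n < N \<Longrightarrow> a n < B" "\<And>n. n < N \<Longrightarrow> b n < B"
    and "n < N"
  shows "a n = b n"
  using assms
proof (induction N arbitrary: a b n)
  case (Suc N)
  have split: "(\<Sum>n<Suc N. c n * B ^ n) = c 0 + B * (\<Sum>n<N. c (Suc n) * B ^ n)" for c
    by (subst sum.lessThan_Suc_shift) (simp add: sum_distrib_left mult_ac)
  have eq: "a 0 + B * (\<Sum>n<N. a (Suc n) * B ^ n) = b 0 + B * (\<Sum>n<N. b (Suc n) * B ^ n)"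
    using Suc.prems(1) unfolding split .
  have lt: "a 0 < B" "b 0 < B" using Suc.prems by auto
  have "a 0 = b 0" using arg_cong[OF eq, of "\<lambda>k. k mod B"] lt by simp
  moreover from this have "(\<Sum>n<N. a (Suc n) * B ^ n) = (\<Sum>n<N. b (Suc n) * B ^ n)" using eq lt by simp
  hence "a (Suc n) = b (Suc n)" if "n < N" for n
    by (rule Suc.IH) (use Suc.prems that in auto)
  ultimately show ?case using Suc.prems(4) by (cases n) auto
qed simp

text \<open>A polynomial in the ten coefficients that vanishes at all cubics is zero. By Kronecker's
  substitution, replacing the \<open>n\<close>-th variable by \<open>s ^ (B ^ n)\<close> with \<open>B\<close> larger than all exponents
  turns different monomials into different powers of \<open>s\<close>.\<close>

lemma coord_ring_eq_0:
  fixes F :: "(3 \<Rightarrow>\<^sub>0 nat, 'k::field_char_0) mpoly"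
  assumes F: "F \<in> coord_ring" and zero: "\<And>x. peval (Poly_Mapping.lookup (cubic_of x)) F = 0"
  shows "F = 0"
proof (rule ccontr)
  assume "F \<noteq> 0"
  let ?K = "Poly_Mapping.keys F"
  obtain t0 where t0: "t0 \<in> ?K" using \<open>F \<noteq> 0\<close> by (metis keys_eq_empty ex_in_conv)
  define B where "B = Suc (\<Sum>t\<in>?K. \<Sum>n<10. Poly_Mapping.lookup t (cubic_mon n))"
  define wt where "wt t = (\<Sum>n<10. Poly_Mapping.lookup t (cubic_mon n) * B ^ n)" for t
  have keys: "Poly_Mapping.keys t \<subseteq> cubic_mon ` {..<10}" if "t \<in> ?K" for t
    using F that mdeg_3_imp_cubic_mon unfolding coord_ring_def by blast
  have lt: "Poly_Mapping.lookup t (cubic_mon n) < B" if "t \<in> ?K" "n < 10" for t n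
  proof -
    have "Poly_Mapping.lookup t (cubic_mon n) \<le> (\<Sum>n<10. Poly_Mapping.lookup t (cubic_mon n))"
      by (rule member_le_sum) (use that in auto)
    also have "\<dots> \<le> (\<Sum>t\<in>?K. \<Sum>n<10. Poly_Mapping.lookup t (cubic_mon n))"
      by (rule member_le_sum[of t ?K "\<lambda>t. \<Sum>n<10. Poly_Mapping.lookup t (cubic_mon n)"]) (use that in auto)
    finally show ?thesis by (simp add: B_def)
  qed
  have inj: "t = t0" if t: "t \<in> ?K" "wt t = wt t0" for t
  proof (rule poly_mapping_eqI)
    fix m
    have "Poly_Mapping.lookup t (cubic_mon n) = Poly_Mapping.lookup t0 (cubic_mon n)" if "n < 10" for n
      by (rule digits_unique[OF t(2)[unfolded wt_def]]) (use lt t t0 that in auto)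
    moreover have "Poly_Mapping.lookup t m = 0" "Poly_Mapping.lookup t0 m = 0" if "m \<notin> cubic_mon ` {..<10}"
      using keys[OF t(1)] keys[OF t0] that by (auto simp: in_keys_iff)
    ultimately show "Poly_Mapping.lookup t m = Poly_Mapping.lookup t0 m"
      by (cases "m \<in> cubic_mon ` {..<10}") auto
  qed
  define p where "p = (\<Sum>t\<in>?K. monom (Poly_Mapping.lookup F t) (wt t))"
  have "poly p s = 0" for s
  proof -
    define x where "x n = mon_weight n * s ^ (B ^ n)" for n
    have "monom_eval (Poly_Mapping.lookup (cubic_of x)) t = s ^ wt t" if "t \<in> ?K" for t
    proof -
      have "monom_eval (Poly_Mapping.lookup (cubic_of x)) t =
          (\<Prod>m\<in>cubic_mon ` {..<10}. Poly_Mapping.lookup (cubic_of x) m ^ Poly_Mapping.lookup t m)"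
        by (rule monom_eval_superset) (use keys[OF that] in auto)
      also have "\<dots> = (\<Prod>n<10. Poly_Mapping.lookup (cubic_of x) (cubic_mon n) ^ Poly_Mapping.lookup t (cubic_mon n))"
        by (subst prod.reindex) (auto simp: inj_on_def cubic_mon_inj)
      also have "\<dots> = (\<Prod>n<10. s ^ (Poly_Mapping.lookup t (cubic_mon n) * B ^ n))"
        by (intro prod.cong refl) (simp add: lookup_cubic_of x_def mon_weight_nz power_mult[symmetric] mult.commute)
      finally show ?thesis by (simp add: wt_def power_sum)
    qed
    thus ?thesis using zero[of x]
      by (simp add: peval_superset[of ?K] p_def poly_sum poly_monom)
  qed
  hence "p = 0" by (intro poly_eqI_infinite) simp
  hence "0 = coeff p (wt t0)" by simp
  also have "\<dots> = (\<Sum>t\<in>?K. if t = t0 then Poly_Mapping.lookup F t0 else 0)"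
    unfolding p_def coeff_sum coeff_monom by (intro sum.cong refl) (use inj in auto)
  also have "\<dots> = Poly_Mapping.lookup F t0" using t0 by simp
  finally show False using t0 by (simp add: in_keys_iff)
qed

section \<open>Pfaffians: change of basis and expansion along a row\<close>

lemma prod_double_sum:
  fixes h :: "nat \<Rightarrow> 'b \<Rightarrow> 'b \<Rightarrow> 'k::comm_semiring_1"
  assumes "finite X"
  shows "(\<Prod>i<n. \<Sum>k\<in>X. \<Sum>l\<in>X. h i k l) =
    (\<Sum>f\<in>{..<2*n} \<rightarrow>\<^sub>E X. \<Prod>i<n. h i (f (2*i)) (f (2*i+1)))"
proof -
  have "(\<Prod>i<n. \<Sum>k\<in>X. \<Sum>l\<in>X. h i k l) = (\<Prod>i<n. \<Sum>z\<in>X \<times> X. h i (fst z) (snd z))"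
    by (simp add: sum.cartesian_product split_def)
  also have "\<dots> = (\<Sum>g\<in>{..<n} \<rightarrow>\<^sub>E X \<times> X. \<Prod>i<n. h i (fst (g i)) (snd (g i)))"
    using assms by (intro prod_sum_PiE) auto
  also have "\<dots> = (\<Sum>f\<in>{..<2*n} \<rightarrow>\<^sub>E X. \<Prod>i<n. h i (f (2*i)) (f (2*i+1)))"
  proof -
    define enc :: "(nat \<Rightarrow> 'b \<times> 'b) \<Rightarrow> nat \<Rightarrow> 'b" where
      "enc g = (\<lambda>j\<in>{..<2*n}. (if even j then fst else snd) (g (j div 2)))" for g
    define dec where "dec f = (\<lambda>i\<in>{..<n}. (f (2*i), f (2*i+1)))" for f :: "nat \<Rightarrow> 'b"
    have enc: "enc g (2*i) = fst (g i)" "enc g (2*i+1) = snd (g i)" if "i < n" for g i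
      using that by (simp_all add: enc_def)
    have dec: "dec f i = (f (2*i), f (2*i+1))" if "i < n" for f i
      using that by (simp add: dec_def)
    show ?thesis
    proof (rule sum.reindex_bij_witness[where i = dec and j = enc])
      fix g assume g: "g \<in> {..<n} \<rightarrow>\<^sub>E X \<times> X"
      show "enc g \<in> {..<2*n} \<rightarrow>\<^sub>E X"
        unfolding enc_def
      proof (rule restrict_PiE_iff[THEN iffD2], rule ballI)
        fix j assume "j \<in> {..<2*n}"
        hence "g (j div 2) \<in> X \<times> X" using g by (intro PiE_mem[OF g]) auto
        thus "(if even j then fst else snd) (g (j div 2)) \<in> X" by (simp add: mem_Times_iff)
      qed
      show "dec (enc g) = g"
      proof (rule ext)
        fix i show "dec (enc g) i = g i"
          using enc[of i g] PiE_arb[OF g, of i] by (cases "i < n") (simp_all add: dec_def)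
      qed
      show "(\<Prod>i<n. h i (enc g (2*i)) (enc g (2*i+1))) = (\<Prod>i<n. h i (fst (g i)) (snd (g i)))"
        by (rule prod.cong[OF refl]) (simp only: lessThan_iff enc)
    next
      fix f assume f: "f \<in> {..<2*n} \<rightarrow>\<^sub>E X"
      show "dec f \<in> {..<n} \<rightarrow>\<^sub>E X \<times> X"
        unfolding dec_def
      proof (rule restrict_PiE_iff[THEN iffD2], rule ballI)
        fix i assume "i \<in> {..<n}"
        hence "f (2*i) \<in> X" "f (2*i+1) \<in> X" by (auto intro!: PiE_mem[OF f])
        thus "(f (2*i), f (2*i+1)) \<in> X \<times> X" by simp
      qed
      show "enc (dec f) = f"
      proof (rule ext)
        fix j
        show "enc (dec f) j = f j"
        proof (cases "j < 2 * n")
          case True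
          hence "j div 2 < n" by simp
          moreover have "2 * (j div 2) + 1 = j" if "odd j" using that by presburger
          ultimately show ?thesis using True by (simp add: enc_def dec)
        next
          case False
          thus ?thesis using PiE_arb[OF f, of j] by (simp add: enc_def)
        qed
      qed
    qed
  qed
  finally show ?thesis .
qed

lemma prod_pairs: "(\<Prod>j<2*n. g j) = (\<Prod>i<n. g (2*i) * g (2*i+1))" for g :: "nat \<Rightarrow> 'k::comm_monoid_mult"
  by (induction n) (simp_all add: mult.assoc)

text \<open>The determinant of a matrix with two equal columns vanishes.\<close>

lemma alternating_sum_noninj:
  fixes C :: "'b \<Rightarrow> 'c \<Rightarrow> 'k::field_char_0"
  assumes "finite X" "\<not> inj_on f X"
  shows "(\<Sum>p | p permutes X. of_int (sign p) * (\<Prod>j\<in>X. C (p j) (f j))) = 0" (is "?D = 0")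
proof -
  obtain a b where ab: "a \<in> X" "b \<in> X" "a \<noteq> b" "f a = f b" using assms(2) by (auto simp: inj_on_def)
  define t where "t = Transposition.transpose a b"
  have t: "t permutes X" unfolding t_def using ab by (intro permutes_swap_id)
  have ft: "f (t j) = f j" for j using ab by (simp add: t_def Transposition.transpose_def)
  have "?D = (\<Sum>p | p permutes X. of_int (sign (p \<circ> t)) * (\<Prod>j\<in>X. C ((p \<circ> t) j) (f j)))"
    by (rule sum_permutations_compose_right[OF t])
  also have "\<dots> = (\<Sum>p | p permutes X. - (of_int (sign p) * (\<Prod>j\<in>X. C (p j) (f j))))"
  proof (rule sum.cong[OF refl])
    fix p assume "p \<in> {p. p permutes X}"
    hence p: "p permutes X" by simp
    have "sign (p \<circ> t) = - sign p"
      using p t assms(1) ab by (subst sign_compose) (auto simp: permutation_permutes t_def sign_swap_id)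
    moreover have "(\<Prod>j\<in>X. C ((p \<circ> t) j) (f j)) = (\<Prod>j\<in>X. C (p j) (f j))"
      using prod.permute[OF t, of "\<lambda>j. C (p j) (f j)"] by (simp add: o_def ft)
    ultimately show "of_int (sign (p \<circ> t)) * (\<Prod>j\<in>X. C ((p \<circ> t) j) (f j)) = - (of_int (sign p) * (\<Prod>j\<in>X. C (p j) (f j)))"
      by simp
  qed
  also have "\<dots> = - ?D" by (rule sum_negf)
  finally show ?thesis by simp
qed

text \<open>Permuting the columns of a determinant by \<open>q\<close> multiplies it by the sign of \<open>q\<close>.\<close>

lemma alternating_sum_permutes:
  fixes C :: "'b \<Rightarrow> 'b \<Rightarrow> 'k::field_char_0"
  assumes "finite X" "q permutes X"
  shows "(\<Sum>p | p permutes X. of_int (sign p) * (\<Prod>j\<in>X. C (p j) (q j))) =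
    of_int (sign q) * (\<Sum>p | p permutes X. of_int (sign p) * (\<Prod>j\<in>X. C (p j) j))"
proof -
  have "(\<Sum>p | p permutes X. of_int (sign p) * (\<Prod>j\<in>X. C (p j) (q j)))
      = (\<Sum>p | p permutes X. of_int (sign (p \<circ> q)) * (\<Prod>j\<in>X. C ((p \<circ> q) j) (q j)))"
    by (rule sum_permutations_compose_right[OF assms(2)])
  also have "\<dots> = (\<Sum>p | p permutes X. of_int (sign q) * (of_int (sign p) * (\<Prod>j\<in>X. C (p j) j)))"
  proof (rule sum.cong[OF refl])
    fix p assume "p \<in> {p. p permutes X}"
    hence p: "p permutes X" by simp
    have "sign (p \<circ> q) = sign p * sign q"
      using p assms by (intro sign_compose) (auto simp: permutation_permutes)
    moreover have "(\<Prod>j\<in>X. C ((p \<circ> q) j) (q j)) = (\<Prod>j\<in>X. C (p j) j)"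
      using prod.permute[OF assms(2), of "\<lambda>j. C (p j) j"] by (simp add: o_def)
    ultimately show "of_int (sign (p \<circ> q)) * (\<Prod>j\<in>X. C ((p \<circ> q) j) (q j))
        = of_int (sign q) * (of_int (sign p) * (\<Prod>j\<in>X. C (p j) j))" by simp
  qed
  finally show ?thesis by (simp add: sum_distrib_left)
qed

text \<open>The pfaffian of \<open>C * T * transpose C\<close> is \<open>det C\<close> times the pfaffian of \<open>T\<close>, with \<open>det C\<close>
  written out by the Leibniz formula. Expand the product over all choices \<open>f\<close> of column indices; the
  sum over the permutations vanishes unless \<open>f\<close> is a permutation.\<close>

lemma pfaffian_congruence:
  fixes C T :: "nat \<Rightarrow> nat \<Rightarrow> 'k::field_char_0"
  shows "pfaffian n (\<lambda>i j. \<Sum>k<2*n. \<Sum>l<2*n. C i k * C j l * T k l) =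
    (\<Sum>p | p permutes {..<2*n}. of_int (sign p) * (\<Prod>j<2*n. C (p j) j)) * pfaffian n T"
proof -
  let ?X = "{..<2*n}"
  define P where "P = {p. p permutes ?X}"
  define D where "D f = (\<Sum>p\<in>P. of_int (sign p) * (\<Prod>j\<in>?X. C (p j) (f j)))" for f
  define m where "m f = (\<Prod>i<n. T (f (2*i)) (f (2*i+1)))" for f
  have "(\<Sum>p\<in>P. of_int (sign p) * (\<Prod>i<n. \<Sum>k\<in>?X. \<Sum>l\<in>?X. C (p (2*i)) k * C (p (2*i+1)) l * T k l))
      = (\<Sum>p\<in>P. \<Sum>f\<in>?X \<rightarrow>\<^sub>E ?X. of_int (sign p) * ((\<Prod>j\<in>?X. C (p j) (f j)) * m f))"
  proof (rule sum.cong[OF refl])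
    fix p
    have "(\<Prod>i<n. \<Sum>k\<in>?X. \<Sum>l\<in>?X. C (p (2*i)) k * C (p (2*i+1)) l * T k l) =
        (\<Sum>f\<in>?X \<rightarrow>\<^sub>E ?X. \<Prod>i<n. C (p (2*i)) (f (2*i)) * C (p (2*i+1)) (f (2*i+1)) * T (f (2*i)) (f (2*i+1)))"
      by (rule prod_double_sum) simp
    thus "of_int (sign p) * (\<Prod>i<n. \<Sum>k\<in>?X. \<Sum>l\<in>?X. C (p (2*i)) k * C (p (2*i+1)) l * T k l)
        = (\<Sum>f\<in>?X \<rightarrow>\<^sub>E ?X. of_int (sign p) * ((\<Prod>j\<in>?X. C (p j) (f j)) * m f))"
      unfolding m_def prod_pairs[of "\<lambda>j. C (p j) (_ j)"]
      by (simp only: sum_distrib_left prod.distrib)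
  qed
  also have "\<dots> = (\<Sum>f\<in>?X \<rightarrow>\<^sub>E ?X. D f * m f)"
    unfolding D_def by (subst sum.swap) (simp add: sum_distrib_right mult.assoc)
  also have "\<dots> = (\<Sum>f\<in>(\<lambda>q. restrict q ?X) ` P. D f * m f)"
  proof (rule sum.mono_neutral_right)
    show "finite (?X \<rightarrow>\<^sub>E ?X)" by (intro finite_PiE) auto
    show "(\<lambda>q. restrict q ?X) ` P \<subseteq> ?X \<rightarrow>\<^sub>E ?X"
    proof (rule image_subsetI)
      fix q assume "q \<in> P"
      thus "restrict q ?X \<in> ?X \<rightarrow>\<^sub>E ?X"
        using permutes_in_image[of q ?X] by (simp add: P_def restrict_PiE_iff)
    qed
    show "\<forall>f\<in>(?X \<rightarrow>\<^sub>E ?X) - (\<lambda>q. restrict q ?X) ` P. D f * m f = 0"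
    proof
      fix f assume f: "f \<in> (?X \<rightarrow>\<^sub>E ?X) - (\<lambda>q. restrict q ?X) ` P"
      have "\<not> inj_on f ?X"
      proof
        assume inj: "inj_on f ?X"
        define q where "q j = (if j \<in> ?X then f j else j)" for j
        have "f ` ?X = ?X" using f inj by (intro endo_inj_surj) auto
        hence "bij_betw f ?X ?X" using inj by (simp add: bij_betw_def)
        hence "bij_betw q ?X ?X" by (rule bij_betw_cong[THEN iffD1, rotated]) (simp add: q_def)
        hence "q \<in> P" unfolding P_def by (auto intro!: bij_imp_permutes simp: q_def split: if_splits)
        moreover have "f = restrict q ?X" using f by (auto simp: q_def fun_eq_iff PiE_def extensional_def)
        ultimately show False using f by blast
      qed
      thus "D f * m f = 0" unfolding D_def P_def by (simp add: alternating_sum_noninj)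
    qed
  qed
  also have "\<dots> = (\<Sum>q\<in>P. D (restrict q ?X) * m (restrict q ?X))"
  proof (rule sum.reindex_cong[OF _ refl refl])
    show "inj_on (\<lambda>q. restrict q ?X) P"
    proof (rule inj_onI, rule ext)
      fix q q' j assume qq: "q \<in> P" "q' \<in> P" "restrict q ?X = restrict q' ?X"
      show "q j = q' j"
        using qq(1,2) fun_cong[OF qq(3), of j] unfolding P_def
        by (cases "j \<in> ?X") (auto simp: permutes_not_in)
    qed
  qed
  also have "\<dots> = (\<Sum>q\<in>P. D id * (of_int (sign q) * m q))"
  proof (rule sum.cong[OF refl])
    fix q assume q: "q \<in> P"
    have "D (restrict q ?X) = D q" "m (restrict q ?X) = m q"
      unfolding D_def m_def by (rule sum.cong[OF refl], rule arg_cong2[where f = "(*)"], rule refl,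
          rule prod.cong[OF refl], simp) (rule prod.cong[OF refl], simp)
    moreover have "D q = of_int (sign q) * D id"
      using q unfolding D_def P_def by (simp add: alternating_sum_permutes)
    ultimately show "D (restrict q ?X) * m (restrict q ?X) = D id * (of_int (sign q) * m q)"
      by simp
  qed
  finally show ?thesis
    by (simp add: pfaffian_def P_def D_def m_def sum_distrib_left)
qed

text \<open>The pfaffian of the submatrix with rows and columns \<open>2*k, \<dots>, 2*n-1\<close>.\<close>

definition pf_tail :: "nat \<Rightarrow> nat \<Rightarrow> (nat \<Rightarrow> nat \<Rightarrow> 'k::field) \<Rightarrow> 'k" where
  "pf_tail k n a = (\<Sum>p | p permutes {2*k..<2*n}.
      of_int (sign p) * (\<Prod>i\<in>{k..<n}. a (p (2*i)) (p (2*i+1)))) / (2^(n-k) * of_nat (fact (n-k)))"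

lemma pfaffian_eq_tail: "pfaffian n a = pf_tail 0 n a"
  by (simp add: pfaffian_def pf_tail_def lessThan_atLeast0)

lemma pf_tail_refl [simp]: "pf_tail n n a = 1"
  by (simp add: pf_tail_def)

text \<open>Expansion along the first row, for a matrix that is skew-symmetric. The submatrix without the
  rows and columns \<open>2*k\<close> and \<open>b\<close> appears with the index \<open>2*k+1\<close> moved to the place of \<open>b\<close>, which
  makes all signs but the first negative.\<close>

lemma pf_tail_laplace:
  fixes a :: "nat \<Rightarrow> nat \<Rightarrow> 'k::field_char_0"
  assumes skew: "\<And>i j. a i j = - a j i" and k: "k < n"
  shows "pf_tail k n a = (\<Sum>b\<in>{2*k+1..<2*n}. (if b = 2*k+1 then 1 else - 1) * a (2*k) b *
    pf_tail (Suc k) n (\<lambda>i j. a (Transposition.transpose (2*k+1) b i) (Transposition.transpose (2*k+1) b j)))"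
proof -
  let ?X = "{2*k..<2*n}"
  define P where "P = {p. p permutes ?X}"
  have finP: "finite P" unfolding P_def by (rule finite_permutations) simp
  define m where "m p = (\<Prod>i\<in>{k..<n}. a (p (2*i)) (p (2*i+1)))" for p
  define w where "w p = of_int (sign p) * m p" for p
  \<comment> \<open>The terms are sorted by the position \<open>j\<close> of the index \<open>2*k\<close>. Exchanging two entries of a pair, or
    two pairs, does not change a term, so all positions contribute the same.\<close>
  define W where "W j = (\<Sum>p | p \<in> P \<and> p j = 2*k. w p)" for j
  have reindex: "W (t j) = (\<Sum>p | p \<in> P \<and> p j = 2*k. w (p \<circ> t))"
    if t: "t permutes ?X" "t \<circ> t = id" for t j
  proof -
    have tt: "t (t i) = i" for i using t(2) by (simp add: fun_eq_iff)
    show ?thesis unfolding W_def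
      using t(1) by (intro sum.reindex_bij_witness[where i = "\<lambda>p. p \<circ> t" and j = "\<lambda>p. p \<circ> t"])
        (auto simp: P_def tt o_assoc[symmetric] t(2) intro: permutes_compose)
  qed
  have sgn: "sign (p \<circ> t) = sign p * sign t" if "p \<in> P" "t permutes ?X" for p t
    using that by (intro sign_compose) (auto simp: P_def permutation_permutes)
  have odd: "W (2*i+1) = W (2*i)" if i: "k \<le> i" "i < n" for i
  proof -
    define t where "t = Transposition.transpose (2*i) (2*i+1)"
    have t: "t permutes ?X" "t \<circ> t = id" unfolding t_def using i by (auto intro!: permutes_swap_id)
    have w: "w (p \<circ> t) = w p" if "p \<in> P" for p
    proof -
      have "m (p \<circ> t) = (\<Prod>j\<in>{k..<n}. (if j = i then - 1 else 1) * a (p (2*j)) (p (2*j+1)))"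
        unfolding m_def
      proof (rule prod.cong[OF refl])
        fix j
        have "2 * j + 1 \<noteq> 2 * i" "2 * i + 1 \<noteq> 2 * j" by presburger+
        thus "a ((p \<circ> t) (2*j)) ((p \<circ> t) (2*j+1)) = (if j = i then - 1 else 1) * a (p (2*j)) (p (2*j+1))"
          using skew[of "p (Suc (2*i))" "p (2*i)"] by (auto simp: t_def Transposition.transpose_def)
      qed
      also have "\<dots> = - m p" using i by (simp add: prod.distrib m_def)
      finally show ?thesis using sgn[OF that t(1)] by (simp add: w_def t_def sign_swap_id)
    qed
    have "W (2*i+1) = W (t (2*i))" by (simp add: t_def)
    also have "\<dots> = W (2*i)" unfolding reindex[OF t] W_def[of "2*i"] by (intro sum.cong) (auto simp: w)
    finally show ?thesis .
  qed
  have even: "W (2*i) = W (2*k)" if i: "k \<le> i" "i < n" for i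
  proof (cases "i = k")
    case False
    define t where "t = Transposition.transpose (2*k) (2*i) \<circ> Transposition.transpose (2*k+1) (2*i+1)"
    have tp: "Transposition.transpose (2*k) (2*i) permutes ?X" "Transposition.transpose (2*k+1) (2*i+1) permutes ?X"
      using i k by (auto intro!: permutes_swap_id)
    hence t1: "t permutes ?X" unfolding t_def by (intro permutes_compose)
    have ne: "2 * k + 1 \<noteq> 2 * j" "2 * i + 1 \<noteq> 2 * j" for j by presburger+
    have tev: "t (2*j) = 2 * Transposition.transpose k i j" for j
      using ne[of j] by (auto simp: t_def Transposition.transpose_def)
    have tod: "t (2*j+1) = 2 * Transposition.transpose k i j + 1" for j
      using ne[of k] ne[of i] ne[of j] by (auto simp: t_def Transposition.transpose_def; presburger)
    have t2: "t \<circ> t = id"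
    proof (rule ext)
      fix j
      show "(t \<circ> t) j = id j"
      proof (cases "even j")
        case True
        then obtain l where "j = 2 * l" by blast
        thus ?thesis by (simp add: tev)
      next
        case False
        then obtain l where "j = 2 * l + 1" by (rule oddE)
        thus ?thesis using tod by simp
      qed
    qed
    have st: "sign t = 1" unfolding t_def using tp False
      by (subst sign_compose) (auto simp: permutation_permutes sign_swap_id intro: permutation_swap_id)
    have w: "w (p \<circ> t) = w p" if "p \<in> P" for p
    proof -
      have "Transposition.transpose k i permutes {k..<n}" using i k by (intro permutes_swap_id) auto
      from prod.permute[OF this, of "\<lambda>i. a (p (2*i)) (p (2*i+1))"]
      have "m (p \<circ> t) = m p" unfolding m_def o_def tev tod by simp
      thus ?thesis using sgn[OF that t1] st by (simp add: w_def)
    qed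
    have "W (2*i) = W (t (2*k))" by (simp add: tev)
    also have "\<dots> = W (2*k)" unfolding reindex[OF t1 t2] W_def[of "2*k"] by (intro sum.cong) (auto simp: w)
    finally show ?thesis .
  qed simp
  have "(\<Sum>p\<in>P. w p) = (\<Sum>j\<in>?X. W j)"
  proof -
    have "(\<Sum>j\<in>?X. W j) = (\<Sum>p\<in>P. \<Sum>j | j \<in> ?X \<and> p j = 2*k. w p)"
      unfolding W_def by (rule sum.swap_restrict) (simp_all add: finP)
    also have "\<dots> = (\<Sum>p\<in>P. w p)"
    proof (rule sum.cong[OF refl])
      fix p assume p: "p \<in> P"
      hence p': "p permutes ?X" by (simp add: P_def)
      have "inv p (2*k) \<in> ?X" using permutes_in_image[OF permutes_inv[OF p']] k by simp
      hence "{j. j \<in> ?X \<and> p j = 2*k} = {inv p (2*k)}"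
        by (auto simp flip: permutes_inv_eq[OF p'])
      thus "(\<Sum>j | j \<in> ?X \<and> p j = 2*k. w p) = w p" by simp
    qed
    finally show ?thesis by simp
  qed
  also have "(\<Sum>j\<in>?X. W j) = (\<Sum>i\<in>{k..<n}. W (2*i) + W (2*i+1))"
    using less_imp_le[OF k]
  proof (induction n rule: dec_induct)
    case base
    show ?case by simp
  next
    case (step n)
    have "{2*k..<2 * Suc n} = insert (2*n+1) (insert (2*n) {2*k..<2*n})" using step.hyps by auto
    thus ?case using step by (simp add: add_ac)
  qed
  also have "\<dots> = (\<Sum>i\<in>{k..<n}. 2 * W (2*k))"
  proof (rule sum.cong[OF refl])
    fix i assume "i \<in> {k..<n}"
    hence i: "k \<le> i" "i < n" by simp_all
    show "W (2*i) + W (2*i+1) = 2 * W (2*k)" unfolding odd[OF i] even[OF i] by (rule mult_2[symmetric])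
  qed
  also have "\<dots> = 2 * of_nat (n - k) * W (2*k)"
    by simp
  also have "W (2*k) = (\<Sum>p | p permutes {2*k+1..<2*n}. w p)"
  proof -
    have "p permutes {2*k+1..<2*n}" if "p permutes ?X" "p (2*k) = 2*k" for p
    proof (rule permutes_superset[OF that(1)])
      fix x assume "x \<in> ?X - {2*k+1..<2*n}"
      hence "x = 2 * k" by auto
      thus "p x = x" using that(2) by simp
    qed
    moreover have "p permutes ?X" "p (2*k) = 2*k" if "p permutes {2*k+1..<2*n}" for p
      using that by (auto intro: permutes_subset simp: permutes_not_in)
    ultimately have "{p. p \<in> P \<and> p (2*k) = 2*k} = {p. p permutes {2*k+1..<2*n}}"
      unfolding P_def by blast
    thus ?thesis by (simp add: W_def)
  qed
  also have "{2*k+1..<2*n} = insert (2*k+1) {2 * Suc k..<2*n}" using k by auto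
  also have "(\<Sum>p | p permutes \<dots>. w p) = (\<Sum>b\<in>insert (2*k+1) {2 * Suc k..<2*n}.
      \<Sum>q | q permutes {2 * Suc k..<2*n}. w (Transposition.transpose (2*k+1) b \<circ> q))"
    by (rule sum_over_permutations_insert) simp_all
  also have "insert (2*k+1) {2 * Suc k..<2*n} = {2*k+1..<2*n}" using k by auto
  also have "(\<Sum>b\<in>{2*k+1..<2*n}. \<Sum>q | q permutes {2 * Suc k..<2*n}. w (Transposition.transpose (2*k+1) b \<circ> q))
    = (\<Sum>b\<in>{2*k+1..<2*n}. (if b = 2*k+1 then 1 else - 1) * a (2*k) b *
       (\<Sum>q | q permutes {2 * Suc k..<2*n}. of_int (sign q) * (\<Prod>i\<in>{Suc k..<n}.
          a (Transposition.transpose (2*k+1) b (q (2*i))) (Transposition.transpose (2*k+1) b (q (2*i+1))))))"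
    unfolding sum_distrib_left
  proof (intro sum.cong[OF refl])
    fix b q assume b: "b \<in> {2*k+1..<2*n}" and "q \<in> {q. q permutes {2 * Suc k..<2*n}}"
    hence q: "q permutes {2 * Suc k..<2*n}" by simp
    let ?t = "Transposition.transpose (2*k+1) b"
    have "sign (?t \<circ> q) = sign ?t * sign q"
      using q by (intro sign_compose permutation_swap_id) (auto simp: permutation_permutes)
    hence "sign (?t \<circ> q) = (if b = 2*k+1 then 1 else - 1) * sign q"
      by (auto simp: sign_swap_id)
    moreover have "q (2*k) = 2*k" "q (2*k+1) = 2*k+1" using q by (auto intro!: permutes_not_in)
    moreover have "{k..<n} = insert k {Suc k..<n}" using k by auto
    moreover have "?t (2*k) = 2*k" using b by (intro transpose_apply_other) auto
    ultimately have "m (?t \<circ> q) = a (2*k) b * (\<Prod>i\<in>{Suc k..<n}. a (?t (q (2*i))) (?t (q (2*i+1))))"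
      and "sign (?t \<circ> q) = (if b = 2*k+1 then 1 else - 1) * sign q"
      by (simp_all add: m_def)
    thus "w (?t \<circ> q) = (if b = 2*k+1 then 1 else - 1) * a (2*k) b *
      (of_int (sign q) * (\<Prod>i\<in>{Suc k..<n}. a (?t (q (2*i))) (?t (q (2*i+1)))))"
      by (simp add: w_def)
  qed
  finally have *: "(\<Sum>p\<in>P. w p) = 2 * of_nat (n - k) * \<dots>" .
  have "n - k = Suc (n - Suc k)" using k by simp
  hence f: "2 ^ (n - k) * of_nat (fact (n - k)) = 2 * of_nat (n - k) * (2 ^ (n - Suc k) * of_nat (fact (n - Suc k)) :: 'k)"
    by (simp only: fact_Suc power_Suc of_nat_mult of_nat_id mult_ac)
  have nz: "2 * of_nat (n - k) \<noteq> (0 :: 'k)" using k by simp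
  have "pf_tail k n a = (\<Sum>p\<in>P. w p) / (2 ^ (n - k) * of_nat (fact (n - k)))"
    by (simp add: pf_tail_def P_def w_def m_def)
  thus ?thesis unfolding * f mult_divide_mult_cancel_left[OF nz]
    by (simp only: pf_tail_def[of "Suc k"] times_divide_eq_right sum_divide_distrib[symmetric])
qed

text \<open>The pfaffians of the skew-symmetric submatrices of sizes 4, 6 and 8 on the listed rows and
  columns, as iterated expansions along the first row.\<close>

definition pf4 :: "(nat \<Rightarrow> nat \<Rightarrow> 'k::comm_ring) \<Rightarrow> nat \<Rightarrow> nat \<Rightarrow> nat \<Rightarrow> nat \<Rightarrow> 'k" where
  "pf4 a i j k l = a i j * a k l - a i k * a j l + a i l * a j k"

definition pf6 :: "(nat \<Rightarrow> nat \<Rightarrow> 'k::comm_ring) \<Rightarrow> nat \<Rightarrow> nat \<Rightarrow> nat \<Rightarrow> nat \<Rightarrow> nat \<Rightarrow> nat \<Rightarrow> 'k" where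
  "pf6 a i j k l m n = a i j * pf4 a k l m n - a i k * pf4 a j l m n + a i l * pf4 a j k m n
     - a i m * pf4 a j k l n + a i n * pf4 a j k l m"

definition pf8 :: "(nat \<Rightarrow> nat \<Rightarrow> 'k::comm_ring) \<Rightarrow> nat \<Rightarrow> nat \<Rightarrow> nat \<Rightarrow> nat \<Rightarrow> nat \<Rightarrow> nat \<Rightarrow> nat \<Rightarrow> nat \<Rightarrow> 'k" where
  "pf8 a h i j k l m n p = a h i * pf6 a j k l m n p - a h j * pf6 a i k l m n p + a h k * pf6 a i j l m n p
     - a h l * pf6 a i j k m n p + a h m * pf6 a i j k l n p - a h n * pf6 a i j k l m p
     + a h p * pf6 a i j k l m n"

lemma pf_tail_2:
  fixes a :: "nat \<Rightarrow> nat \<Rightarrow> 'k::field_char_0"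
  assumes skew: "\<And>i j. a i j = - a j i"
  shows "pf_tail 2 4 a = pf4 a 4 5 6 7"
proof -
  have last: "pf_tail 3 4 a = a 6 7" if "\<And>i j. a i j = - a j i" for a :: "nat \<Rightarrow> nat \<Rightarrow> 'k"
  proof -
    have "{2*3+1..<2*4} = {7::nat}" by auto
    thus ?thesis by (subst pf_tail_laplace[OF that]) simp_all
  qed
  have "{2*2+1..<2*4} = {5, 6, 7::nat}" by auto
  moreover have "pf_tail 3 4 (\<lambda>i j. a (f i) (f j)) = a (f 6) (f 7)" for f :: "nat \<Rightarrow> nat"
    by (rule last[OF skew])
  ultimately show ?thesis
    using skew[of 6 5]
    by (subst pf_tail_laplace[OF skew]) (simp_all add: Transposition.transpose_def pf4_def)
qed

lemma pf_tail_1: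
  fixes a :: "nat \<Rightarrow> nat \<Rightarrow> 'k::field_char_0"
  assumes skew: "\<And>i j. a i j = - a j i"
  shows "pf_tail 1 4 a = pf6 a 2 3 4 5 6 7"
proof -
  have t: "pf_tail (Suc 1) 4 (\<lambda>i j. a (f i) (f j)) = pf4 a (f 4) (f 5) (f 6) (f 7)" for f :: "nat \<Rightarrow> nat"
    using pf_tail_2[of "\<lambda>i j. a (f i) (f j)", OF skew] by (simp add: numeral_2_eq_2 pf4_def)
  have X: "{2*1+1..<2*4} = {3, 4, 5, 6, 7::nat}" by auto
  have s: "a i 3 = - a 3 i" if "3 < i" for i by (rule skew)
  have "pf_tail 1 4 a = (\<Sum>b\<in>{3, 4, 5, 6, 7}. (if b = 3 then 1 else - 1) * a 2 b *
      pf4 a (Transposition.transpose 3 b 4) (Transposition.transpose 3 b 5)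
        (Transposition.transpose 3 b 6) (Transposition.transpose 3 b 7))"
    by (subst pf_tail_laplace[OF skew]) (simp_all only: X t, simp_all)
  also have "\<dots> = pf6 a 2 3 4 5 6 7" (is "?l = _")
  proof -
    have "(\<Sum>b\<in>{3, 4, 5, 6, 7}. g b) = g 3 + g 4 + g 5 + g 6 + g (7::nat)" for g :: "nat \<Rightarrow> 'k"
      by (simp add: add.assoc)
    hence "?l = a 2 3 * pf4 a 4 5 6 7 - a 2 4 * pf4 a 3 5 6 7 - a 2 5 * pf4 a 4 3 6 7
        - a 2 6 * pf4 a 4 5 3 7 - a 2 7 * pf4 a 4 5 6 3"
      by (simp add: Transposition.transpose_def)
    thus ?thesis by (simp add: pf4_def pf6_def s algebra_simps)
  qed
  finally show ?thesis .
qed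

lemma pfaffian_4:
  fixes a :: "nat \<Rightarrow> nat \<Rightarrow> 'k::field_char_0"
  assumes skew: "\<And>i j. a i j = - a j i"
  shows "pfaffian 4 a = pf8 a 0 1 2 3 4 5 6 7"
proof -
  have t: "pf_tail (Suc 0) 4 (\<lambda>i j. a (f i) (f j)) = pf6 a (f 2) (f 3) (f 4) (f 5) (f 6) (f 7)"
    for f :: "nat \<Rightarrow> nat"
    using pf_tail_1[of "\<lambda>i j. a (f i) (f j)", OF skew] by (simp add: pf4_def pf6_def)
  have X: "{2*0+1..<2*4} = {1, 2, 3, 4, 5, 6, 7::nat}" by auto
  have s: "a i 1 = - a 1 i" if "1 < i" for i by (rule skew)
  have "pf_tail 0 4 a = (\<Sum>b\<in>{1, 2, 3, 4, 5, 6, 7}. (if b = 1 then 1 else - 1) * a 0 b *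
      pf6 a (Transposition.transpose 1 b 2) (Transposition.transpose 1 b 3) (Transposition.transpose 1 b 4)
        (Transposition.transpose 1 b 5) (Transposition.transpose 1 b 6) (Transposition.transpose 1 b 7))"
    by (subst pf_tail_laplace[OF skew]) (simp_all only: X t, simp_all)
  also have "\<dots> = pf8 a 0 1 2 3 4 5 6 7" (is "?l = _")
  proof -
    have "(\<Sum>b\<in>{1, 2, 3, 4, 5, 6, 7}. g b) = g 1 + g 2 + g 3 + g 4 + g 5 + g 6 + g (7::nat)" for g :: "nat \<Rightarrow> 'k"
      by (simp add: add.assoc)
    hence "?l = a 0 1 * pf6 a 2 3 4 5 6 7 - a 0 2 * pf6 a 1 3 4 5 6 7 - a 0 3 * pf6 a 2 1 4 5 6 7
        - a 0 4 * pf6 a 2 3 1 5 6 7 - a 0 5 * pf6 a 2 3 4 1 6 7 - a 0 6 * pf6 a 2 3 4 5 1 7 - a 0 7 * pf6 a 2 3 4 5 6 1"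
      by (simp add: Transposition.transpose_def del: One_nat_def)
    thus ?thesis
      by (simp add: pf4_def pf6_def pf8_def s algebra_simps del: One_nat_def)
  qed
  finally show ?thesis by (simp add: pfaffian_eq_tail)
qed

section \<open>The bilinear form of the contraction operator\<close>

lemma permutes3: "{\<sigma> :: 3 \<Rightarrow> 3. \<sigma> permutes UNIV} =
    {tri 0 1 2, tri 0 2 1, tri 1 0 2, tri 1 2 0, tri 2 0 1, tri 2 1 0}" (is "?L = ?R")
proof
  show "?R \<subseteq> ?L" by (auto intro!: tri_permutes simp: neq3)
  show "?L \<subseteq> ?R"
  proof
    fix \<sigma> :: "3 \<Rightarrow> 3" assume "\<sigma> \<in> ?L"
    hence inj: "inj \<sigma>" by (simp add: permutes_inj)
    have s: "\<sigma> = tri (\<sigma> 0) (\<sigma> 1) (\<sigma> 2)" unfolding fun_eq_iff all3 by simp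
    have "\<sigma> 0 \<noteq> \<sigma> 1" "\<sigma> 0 \<noteq> \<sigma> 2" "\<sigma> 1 \<noteq> \<sigma> 2" using inj by (simp_all add: inj_eq neq3)
    thus "\<sigma> \<in> ?R"
      using cases3[of "\<sigma> 0"] cases3[of "\<sigma> 1"] cases3[of "\<sigma> 2"]
      by (subst s) (elim disjE; simp)
  qed
qed

lemma tri_eq_iff: "tri a b c = tri a' b' c' \<longleftrightarrow> a = a' \<and> b = b' \<and> c = c'"
  unfolding fun_eq_iff all3 by simp

lemma sum_permutes3: "(\<Sum>\<sigma> | \<sigma> permutes (UNIV :: 3 set). h \<sigma>) = h (tri 0 1 2) + h (tri 0 2 1)
    + h (tri 1 0 2) + h (tri 1 2 0) + h (tri 2 0 1) + h (tri 2 1 0)"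
  for h :: "(3 \<Rightarrow> 3) \<Rightarrow> 'a::comm_monoid_add"
  unfolding permutes3 by (simp add: tri_eq_iff neq3 add.assoc)

lemma mono_eq_mono_idx: "{v :: 3 \<Rightarrow> 3. mono v} = mono_idx ` {..<10}"
proof
  have m: "mono (mono_idx n)" if "n < 10" for n
    using that less3[THEN less_imp_le] unfolding less10 mono3
    by (elim disjE; simp add: mono_idx_def)
  thus "mono_idx ` {..<10} \<subseteq> {v :: 3 \<Rightarrow> 3. mono v}" by auto
  show "{v :: 3 \<Rightarrow> 3. mono v} \<subseteq> mono_idx ` {..<10}"
  proof
    fix v :: "3 \<Rightarrow> 3" assume "v \<in> {v. mono v}"
    hence v: "mono v" by simp
    obtain n where n: "n < 10" "mon v = cubic_mon n"
      using mdeg_3_imp_cubic_mon[OF mdeg_mon] by blast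
    have "v = mono_idx n" by (rule mon_inj[OF v m[OF n(1)] n(2)])
    thus "v \<in> mono_idx ` {..<10}" using n(1) by blast
  qed
qed

lemma sum_lessThan_10: "(\<Sum>i<10. f i) = f 0 + f 1 + f 2 + f 3 + f 4 + f 5 + f 6 + f 7 + f 8 + f (9::nat)"
  for f :: "nat \<Rightarrow> 'a::comm_monoid_add"
  by (simp add: eval_nat_numeral add.assoc)

text \<open>The sum over the monomials and the permutations in the definition of the contraction operator
  is a contraction with the symmetric tensor of \<open>\<phi>\<close>: the weight of a monomial counts how often each
  of its index triples occurs.\<close>

lemma sum_mono_eq_tens:
  fixes h :: "3 \<Rightarrow> 3 \<Rightarrow> 3 \<Rightarrow> 'k::comm_ring_1"
  shows "(\<Sum>v | mono v. Poly_Mapping.lookup \<phi> (mon v) *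
      (\<Sum>\<sigma> | \<sigma> permutes UNIV. h (v (\<sigma> 0)) (v (\<sigma> 1)) (v (\<sigma> 2)))) =
    (\<Sum>i\<in>UNIV. \<Sum>j\<in>UNIV. \<Sum>k\<in>UNIV. tens (coords \<phi>) i j k * h i j k)"
proof -
  have "inj_on mono_idx {..<10}"
    by (rule inj_onI) (metis cubic_mon_inj lessThan_iff)
  hence "(\<Sum>v | mono v. Poly_Mapping.lookup \<phi> (mon v) *
      (\<Sum>\<sigma> | \<sigma> permutes UNIV. h (v (\<sigma> 0)) (v (\<sigma> 1)) (v (\<sigma> 2)))) =
    (\<Sum>n<10. Poly_Mapping.lookup \<phi> (cubic_mon n) *
      (\<Sum>\<sigma> | \<sigma> permutes UNIV. h (mono_idx n (\<sigma> 0)) (mono_idx n (\<sigma> 1)) (mono_idx n (\<sigma> 2))))"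
    unfolding mono_eq_mono_idx by (simp add: sum.reindex)
  also have "\<dots> = (\<Sum>i\<in>UNIV. \<Sum>j\<in>UNIV. \<Sum>k\<in>UNIV. tens (coords \<phi>) i j k * h i j k)"
  proof -
    define l where "l n = Poly_Mapping.lookup \<phi> (cubic_mon n)" for n
    show ?thesis
      unfolding l_def[symmetric] sum_lessThan_10 sum_permutes3 sum_UNIV3 tens_def coords_def tri_simps
      by (simp add: mono_idx_def mon_weight_def algebra_simps)
  qed
  finally show ?thesis .
qed

text \<open>The triple product of three vectors.\<close>

definition triple :: "(3 \<Rightarrow> 'k::comm_ring) \<Rightarrow> (3 \<Rightarrow> 'k) \<Rightarrow> (3 \<Rightarrow> 'k) \<Rightarrow> 'k" where
  "triple u v w = det3 (tri u v w)"

text \<open>The bilinear form of the contraction operator of the tensor \<open>t\<close>. Here and below, an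
  endomorphism of \<open>W\<close> is given by the family of the images of the basis vectors: \<open>m i p\<close> is the
  coordinate \<open>p\<close> of the image of the basis vector \<open>i\<close>. So \<open>m\<close> is the transpose of the usual
  matrix.\<close>

definition contr_form :: "(3 \<Rightarrow> 3 \<Rightarrow> 3 \<Rightarrow> 'k::comm_ring_1) \<Rightarrow> (3 \<Rightarrow> 3 \<Rightarrow> 'k) \<Rightarrow> (3 \<Rightarrow> 3 \<Rightarrow> 'k) \<Rightarrow> 'k" where
  "contr_form t m n = (\<Sum>i\<in>UNIV. \<Sum>j\<in>UNIV. \<Sum>k\<in>UNIV. t i j k *
     triple (m i) (\<lambda>l. if j = l then 1 else 0) (n k))"

lemma contr_form_skew:
  assumes "\<And>i j k. t i j k = t k j i"
  shows "contr_form t m n = - contr_form t n m"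
proof -
  have "contr_form t m n = (\<Sum>k\<in>UNIV. \<Sum>j\<in>UNIV. \<Sum>i\<in>UNIV. t i j k *
     triple (m i) (\<lambda>l. if j = l then 1 else 0) (n k))"
    unfolding contr_form_def by (rule sum_swap3)
  also have "\<dots> = - contr_form t n m"
    unfolding contr_form_def sum_negf[symmetric]
    by (intro sum.cong refl) (simp add: assms triple_def det3_def algebra_simps)
  finally show ?thesis .
qed

lemma contr_form_sum_left:
  "contr_form t (\<lambda>i p. \<Sum>a\<in>A. c a * m a i p) n = (\<Sum>a\<in>A. c a * contr_form t (m a) n)"
proof -
  have "triple (\<lambda>p. \<Sum>a\<in>A. c a * u a p) v w = (\<Sum>a\<in>A. c a * triple (u a) v w)" for u and v w :: "3 \<Rightarrow> 'a"
    by (simp add: triple_def det3_def sum_distrib_left sum_distrib_right sum.distrib sum_subtractf algebra_simps)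
  thus ?thesis
    unfolding contr_form_def sum_UNIV3
    by (simp add: sum_distrib_left sum.distrib algebra_simps)
qed

text \<open>A basis of the traceless matrices: the matrix units off the diagonal, followed by
  \<open>diag (1, -1, 0)\<close> and \<open>diag (0, 1, -1)\<close>.\<close>

definition sl3_basis :: "nat \<Rightarrow> 3 \<Rightarrow> 3 \<Rightarrow> 'k::comm_ring_1" where
  "sl3_basis n =
    [tri (tri 0 0 0) (tri 1 0 0) (tri 0 0 0),
     tri (tri 0 0 0) (tri 0 0 0) (tri 1 0 0),
     tri (tri 0 1 0) (tri 0 0 0) (tri 0 0 0),
     tri (tri 0 0 0) (tri 0 0 0) (tri 0 1 0),
     tri (tri 0 0 1) (tri 0 0 0) (tri 0 0 0),
     tri (tri 0 0 0) (tri 0 0 1) (tri 0 0 0),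
     tri (tri 1 0 0) (tri 0 (- 1) 0) (tri 0 0 0),
     tri (tri 0 0 0) (tri 0 1 0) (tri 0 0 (- 1))] ! n"

lemma contr_form_eq:
  "contr_form t m n = (\<Sum>i\<in>UNIV. \<Sum>k\<in>UNIV. t i 0 k * (m i 2 * n k 1 - m i 1 * n k 2)
     + t i 1 k * (m i 0 * n k 2 - m i 2 * n k 0) + t i 2 k * (m i 1 * n k 0 - m i 0 * n k 1))"
  unfolding contr_form_def triple_def det3_def sum_UNIV3[of "\<lambda>j. \<Sum>k\<in>UNIV. _ j k"] sum.distrib[symmetric]
  by (intro sum.cong refl) (simp add: neq3 algebra_simps)

text \<open>The 8 by 8 matrix of the form above the diagonal. Each entry is a multiple of a single
  coordinate.\<close>

lemma contr_form_sl3_basis: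
  fixes x :: "nat \<Rightarrow> 'k::comm_ring_1"
  defines "F \<equiv> \<lambda>i j. contr_form (tens x) (sl3_basis i) (sl3_basis j)"
  shows "F 0 1 = 0 \<and> F 0 2 = - x 9 \<and> F 0 3 = - x 8 \<and> F 0 4 = x 5 \<and> F 0 5 = x 1 \<and> F 0 6 = x 6 \<and> F 0 7 = - 2 * x 6 \<and>
    F 1 2 = - x 7 \<and> F 1 3 = - x 2 \<and> F 1 4 = x 9 \<and> F 1 5 = x 6 \<and> F 1 6 = x 8 \<and> F 1 7 = - 2 * x 8 \<and>
    F 2 3 = 0 \<and> F 2 4 = - x 0 \<and> F 2 5 = - x 3 \<and> F 2 6 = x 4 \<and> F 2 7 = x 4 \<and>
    F 3 4 = - x 4 \<and> F 3 5 = - x 9 \<and> F 3 6 = x 7 \<and> F 3 7 = x 7 \<and>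
    F 4 5 = 0 \<and> F 4 6 = - 2 * x 3 \<and> F 4 7 = x 3 \<and>
    F 5 6 = - 2 * x 5 \<and> F 5 7 = x 5 \<and>
    F 6 7 = - 3 * x 9"
  unfolding F_def contr_form_eq sum_UNIV3
  by (intro conjI; simp add: sl3_basis_def tens_def)

lemma pfaffian_sl3_basis:
  fixes x :: "nat \<Rightarrow> 'k::field_char_0"
  shows "pfaffian 4 (\<lambda>i j. contr_form (tens x) (sl3_basis i) (sl3_basis j)) = - 3 * aronhold x"
proof -
  define F where "F i j = contr_form (tens x) (sl3_basis i) (sl3_basis j)" for i j
  have "tens x i j k = tens x k j i" for i j k by (metis tens_sym)
  hence "F i j = - F j i" for i j unfolding F_def by (rule contr_form_skew)
  hence "pfaffian 4 F = pf8 F 0 1 2 3 4 5 6 7" by (rule pfaffian_4)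
  also have "\<dots> = - 3 * aronhold x"
    using contr_form_sl3_basis[of x, folded F_def]
    unfolding pf8_def pf6_def pf4_def aronhold_monic sum_lessThan_4 aronhold_coeff_def
    by (simp add: algebra_simps power2_eq_square power4_eq_xxxx)
  finally show ?thesis unfolding F_def[abs_def] .
qed

section \<open>The contraction operator and its pfaffian\<close>

lemma pfaffian_cong:
  assumes "\<And>i j. i < 2*n \<Longrightarrow> j < 2*n \<Longrightarrow> a i j = b i j"
  shows "pfaffian n a = pfaffian n b"
proof -
  have "(\<Prod>i<n. a (p (2*i)) (p (2*i+1))) = (\<Prod>i<n. b (p (2*i)) (p (2*i+1)))"
    if p: "p permutes {..<2*n}" for p
  proof (rule prod.cong[OF refl])
    fix i assume "i \<in> {..<n}"
    hence "p (2*i) \<in> {..<2*n}" "p (2*i+1) \<in> {..<2*n}"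
      by (simp_all only: permutes_in_image[OF p]) auto
    thus "a (p (2*i)) (p (2*i+1)) = b (p (2*i)) (p (2*i+1))" by (intro assms) simp_all
  qed
  thus ?thesis by (simp add: pfaffian_def)
qed

context ternary_space
begin

lemma coord_vec: "coord (\<Sum>p\<in>UNIV. scale (c p) (e p)) i = c i"
  by (simp add: coord_sum coord_scale coord_e if_distrib cong: if_cong)

text \<open>The family of the coordinates of the images of the basis vectors under \<open>M\<close>.\<close>

definition mat_of :: "('w \<Rightarrow> 'w) \<Rightarrow> 3 \<Rightarrow> 3 \<Rightarrow> 'k" where
  "mat_of M i = coord (M (e i))"

lemma wedge3_eq_triple: "wedge3 x y z = triple (coord x) (coord y) (coord z)"
  by (simp add: wedge3_eq triple_def det3_def)

lemma tr_eq: "tr M = (\<Sum>i\<in>UNIV. mat_of M i i)"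
  by (simp add: tr_def trace_def mat_of_def)

lemma coord_contraction: "coord (contraction \<phi> M w) c =
    (\<Sum>i\<in>UNIV. \<Sum>j\<in>UNIV. \<Sum>k\<in>UNIV. tens (coords \<phi>) i j k * (wedge3 (M (e i)) (e j) w * coord (e k) c))"
  unfolding sum_mono_eq_tens[symmetric] contraction_def contraction_prod_def mon_def[symmetric]
  by (simp add: coord_sum coord_scale)

lemma tr_contraction:
  "tr (contraction \<phi> M \<circ> N) = contr_form (tens (coords \<phi>)) (mat_of M) (mat_of N)"
proof -
  have "tr (contraction \<phi> M \<circ> N) = (\<Sum>s\<in>UNIV. \<Sum>i\<in>UNIV. \<Sum>j\<in>UNIV.
      tens (coords \<phi>) i j s * wedge3 (M (e i)) (e j) (N (e s)))"
    unfolding tr_eq mat_of_def o_def coord_contraction coord_e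
    by (intro sum.cong refl) (simp add: if_distrib cong: if_cong)
  also have "\<dots> = (\<Sum>j\<in>UNIV. \<Sum>i\<in>UNIV. \<Sum>s\<in>UNIV. tens (coords \<phi>) i j s * wedge3 (M (e i)) (e j) (N (e s)))"
    by (rule sum_swap3)
  also have "\<dots> = (\<Sum>i\<in>UNIV. \<Sum>j\<in>UNIV. \<Sum>s\<in>UNIV. tens (coords \<phi>) i j s * wedge3 (M (e i)) (e j) (N (e s)))"
    by (rule sum.swap)
  finally show ?thesis
    unfolding contr_form_def wedge3_eq_triple mat_of_def coord_e[abs_def]
    by (simp add: coord_e[abs_def] cong: if_cong)
qed

lemma tr_contraction_skew: "tr (contraction \<phi> M \<circ> N) = - tr (contraction \<phi> N \<circ> M)"
  unfolding tr_contraction by (rule contr_form_skew) (metis tens_sym)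

lemma endoI:
  assumes "\<And>x y. f (x + y) = f x + f y" "\<And>c x. f (scale c x) = scale c (f x)"
  shows "f \<in> endo"
  unfolding endo_def mem_Collect_eq
  by unfold_locales (use assms in \<open>auto simp: algebra_simps\<close>)

lemma contraction_in_ad: "contraction \<phi> M \<in> ad"
proof -
  have "contraction \<phi> M \<in> endo"
  proof (rule endoI)
    show "contraction \<phi> M (x + y) = contraction \<phi> M x + contraction \<phi> M y" for x y
    proof -
      have "wedge3 u v (x + y) = wedge3 u v x + wedge3 u v y" for u v
        by (simp add: wedge3_eq coord_add algebra_simps)
      thus ?thesis
        by (simp add: contraction_def contraction_prod_def scale_left_distrib scale_right_distrib sum.distrib)
    qed
    show "contraction \<phi> M (scale c x) = scale c (contraction \<phi> M x)" for c x
    proof -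
      have "wedge3 u v (scale c x) = c * wedge3 u v x" for u v
        by (simp add: wedge3_eq coord_scale algebra_simps)
      thus ?thesis
        by (simp add: contraction_def contraction_prod_def scale_sum_right mult_ac)
    qed
  qed
  moreover have "tr (contraction \<phi> M) = 0"
  proof -
    have "tr (contraction \<phi> M) = contr_form (tens (coords \<phi>)) (mat_of M) (mat_of id)"
      using tr_contraction[of \<phi> M id] by simp
    also have "\<dots> = 0"
      unfolding contr_form_eq sum_UNIV3 mat_of_def id_apply coord_e tens_def tri_simps
      by (simp add: neq3 algebra_simps)
    finally show ?thesis .
  qed
  ultimately show ?thesis by (simp add: ad_def)
qed

lemma vector_space_fun: "vector_space scale_fun"
  by unfold_locales (simp_all add: scale_fun_def fun_eq_iff algebra_simps)

lemma mat_of_sum: "mat_of (\<Sum>n\<in>A. scale_fun (c n) (M n)) i p = (\<Sum>n\<in>A. c n * mat_of (M n) i p)"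
proof -
  have "(\<Sum>n\<in>A. scale_fun (c n) (M n)) w = (\<Sum>n\<in>A. scale (c n) (M n w))" for w
    by (induction A rule: infinite_finite_induct) (simp_all add: scale_fun_def)
  thus ?thesis by (simp add: mat_of_def coord_sum coord_scale)
qed

text \<open>The endomorphism with the family \<open>m\<close>, the inverse of \<open>mat_of\<close>.\<close>

definition op_of :: "(3 \<Rightarrow> 3 \<Rightarrow> 'k) \<Rightarrow> 'w \<Rightarrow> 'w" where
  "op_of m w = (\<Sum>p\<in>UNIV. scale (\<Sum>i\<in>UNIV. coord w i * m i p) (e p))"

lemma mat_of_op_of: "mat_of (op_of m) = m"
  by (simp add: fun_eq_iff mat_of_def op_of_def coord_vec coord_e
      if_distrib[where f = "\<lambda>a. a * _"] cong: if_cong)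

lemma op_of_in_endo: "op_of m \<in> endo"
  by (rule endoI)
    (simp_all add: op_of_def coord_add coord_scale distrib_left distrib_right sum.distrib scale_left_distrib
      scale_sum_right sum_distrib_left mult_ac)

lemma op_of_sl3_basis: "n < 8 \<Longrightarrow> op_of (sl3_basis n) \<in> ad"
proof -
  assume "n < 8"
  hence "n = 0 \<or> n = 1 \<or> n = 2 \<or> n = 3 \<or> n = 4 \<or> n = 5 \<or> n = 6 \<or> n = 7" by auto
  hence "(\<Sum>i\<in>UNIV. sl3_basis n i i) = (0 :: 'k)"
    unfolding sum_UNIV3 by (elim disjE; simp add: sl3_basis_def)
  thus ?thesis by (simp add: ad_def op_of_in_endo tr_eq mat_of_op_of)
qed

lemma ad_expand:
  assumes "M \<in> ad"
  shows "\<exists>c. \<forall>i p. mat_of M i p = (\<Sum>n<8. c n * sl3_basis n i p)"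
proof -
  let ?m = "mat_of M"
  have sum8: "(\<Sum>i<8. f i) = f 0 + f 1 + f 2 + f 3 + f 4 + f 5 + f 6 + f (7::nat)" for f :: "nat \<Rightarrow> 'k"
    by (simp add: eval_nat_numeral add.assoc)
  have t: "?m 2 2 = - ?m 0 0 - ?m 1 1"
    using assms unfolding ad_def tr_eq sum_UNIV3 by (simp add: algebra_simps eq_neg_iff_add_eq_0)
  define c where "c n = [?m 1 0, ?m 2 0, ?m 0 1, ?m 2 1, ?m 0 2, ?m 1 2, ?m 0 0, ?m 0 0 + ?m 1 1] ! n" for n
  have "\<forall>i p. mat_of M i p = (\<Sum>n<8. c n * sl3_basis n i p)"
    unfolding all3 sum8 c_def sl3_basis_def t by simp
  thus ?thesis by blast
qed

lemma contr_form_sum_both: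
  fixes x :: "nat \<Rightarrow> 'k"
  shows "contr_form (tens x) (\<lambda>i p. \<Sum>a\<in>A. c a * m a i p) (\<lambda>i p. \<Sum>b\<in>A. d b * m b i p) =
    (\<Sum>a\<in>A. \<Sum>b\<in>A. c a * d b * contr_form (tens x) (m a) (m b))"
proof -
  have skew: "contr_form (tens x) u v = - contr_form (tens x) v u" for u v
    by (rule contr_form_skew) (metis tens_sym)
  have right: "contr_form (tens x) u (\<lambda>i p. \<Sum>b\<in>A. d b * m b i p) = (\<Sum>b\<in>A. d b * contr_form (tens x) u (m b))" for u
    unfolding skew[of u] contr_form_sum_left by (simp add: sum_negf)
  show ?thesis unfolding contr_form_sum_left right by (simp add: sum_distrib_left mult_ac)
qed

lemma contraction_pf_eq:
  "contraction_pf B \<phi> = pfaffian 4 (\<lambda>i j. contr_form (tens (coords \<phi>)) (mat_of (B i)) (mat_of (B j)))"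
  by (simp add: contraction_pf_def tr_contraction)

end

lemma aronhold_nonzero: "\<exists>x. aronhold x = (1 :: 'k::comm_ring_1)"
proof
  show "aronhold (\<lambda>n. if n \<in> {1, 2, 3, 4} then 1 else 0) = (1 :: 'k)"
    unfolding aronhold_monic aronhold_coeff_def sum_lessThan_4 by simp
qed

text \<open>In every basis of the traceless endomorphisms, the pfaffian is a nonzero constant times the
  Aronhold form.\<close>

lemma contraction_pf_eq_aronhold:
  fixes scale :: "'k::field_char_0 \<Rightarrow> 'w::ab_group_add \<Rightarrow> 'w"
  assumes W: "ternary_space scale e" and B: "ternary_space.is_ad_basis scale e B"
  shows "\<exists>c. c \<noteq> 0 \<and> (\<forall>\<phi>. ternary_space.contraction_pf scale e B \<phi> = c * aronhold (coords \<phi>))"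
proof -
  interpret ternary_space scale e by (rule W)
  interpret F: vector_space scale_fun by (rule vector_space_fun)
  let ?b = "\<lambda>i. mat_of (B i)"
  have inj: "inj_on B {..<8}" and span: "F.span (B ` {..<8}) = ad"
    using B by (simp_all add: is_ad_basis_def)
  have comb: "\<exists>d. M = (\<Sum>n<8. scale_fun (d n) (B n))" if "M \<in> ad" for M
  proof -
    have "M \<in> range (\<lambda>u. \<Sum>v\<in>B ` {..<8}. scale_fun (u v) v)"
      using that F.span_finite[of "B ` {..<8}"] span by simp
    then obtain u where "M = (\<Sum>v\<in>B ` {..<8}. scale_fun (u v) v)" by blast
    also have "\<dots> = (\<Sum>n<8. scale_fun (u (B n)) (B n))" by (simp add: sum.reindex[OF inj])
    finally show ?thesis by (intro exI[of _ "\<lambda>n. u (B n)"])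
  qed
  have "B n \<in> ad" if "n < 8" for n
    using that span F.span_base[of "B n" "B ` {..<8}"] by auto
  hence "\<exists>c. \<forall>i p. ?b n i p = (\<Sum>k<8. c k * sl3_basis k i p)" if "n < 8" for n
    using that ad_expand by blast
  then obtain C where C: "\<And>n i p. n < 8 \<Longrightarrow> ?b n i p = (\<Sum>k<8. C n k * sl3_basis k i p)"
    by metis
  have "\<exists>d. \<forall>i p. sl3_basis n i p = (\<Sum>k<8. d k * ?b k i p)" if n: "n < 8" for n
  proof -
    obtain d where "op_of (sl3_basis n) = (\<Sum>k<8. scale_fun (d k) (B k))"
      using comb[OF op_of_sl3_basis[OF n]] by blast
    hence "mat_of (op_of (sl3_basis n)) i p = (\<Sum>k<8. d k * ?b k i p)" for i p
      by (simp only: mat_of_sum)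
    thus ?thesis unfolding mat_of_op_of by blast
  qed
  then obtain D where D: "\<And>n i p. n < 8 \<Longrightarrow> sl3_basis n i p = (\<Sum>k<8. D n k * ?b k i p)"
    by metis
  define \<delta> where "\<delta> C = (\<Sum>p | p permutes {..<2*4}. of_int (sign p) * (\<Prod>j<2*4. C (p j) j))" for C :: "nat \<Rightarrow> nat \<Rightarrow> 'k"
  have change: "pfaffian 4 (\<lambda>i j. contr_form (tens x) (m i) (m j)) =
      \<delta> K * pfaffian 4 (\<lambda>i j. contr_form (tens x) (m' i) (m' j))"
    if K: "\<And>n i p. n < 8 \<Longrightarrow> m n i p = (\<Sum>k<8. K n k * m' k i p)" for x K and m m' :: "nat \<Rightarrow> 3 \<Rightarrow> 3 \<Rightarrow> 'k"
  proof -
    have "pfaffian 4 (\<lambda>i j. contr_form (tens x) (m i) (m j)) =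
      pfaffian 4 (\<lambda>i j. \<Sum>k<2*4. \<Sum>l<2*4. K i k * K j l * contr_form (tens x) (m' k) (m' l))"
    proof (rule pfaffian_cong)
      fix i j :: nat assume ij: "i < 2*4" "j < 2*4"
      hence "m i = (\<lambda>a p. \<Sum>k<8. K i k * m' k a p)" "m j = (\<lambda>a p. \<Sum>k<8. K j k * m' k a p)"
        using K by (auto simp: fun_eq_iff)
      thus "contr_form (tens x) (m i) (m j) = (\<Sum>k<2*4. \<Sum>l<2*4. K i k * K j l * contr_form (tens x) (m' k) (m' l))"
        by (simp add: contr_form_sum_both)
    qed
    thus ?thesis unfolding pfaffian_congruence \<delta>_def .
  qed
  have pf: "contraction_pf B \<phi> = \<delta> C * (- 3 * aronhold (coords \<phi>))" for \<phi>
    unfolding contraction_pf_eq pfaffian_sl3_basis[symmetric] by (rule change[OF C])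
  have "- 3 * aronhold x = \<delta> D * (\<delta> C * (- 3 * aronhold x))" for x
  proof -
    have "- 3 * aronhold x = \<delta> D * pfaffian 4 (\<lambda>i j. contr_form (tens x) (?b i) (?b j))"
      unfolding pfaffian_sl3_basis[symmetric] by (rule change[OF D])
    also have "pfaffian 4 (\<lambda>i j. contr_form (tens x) (?b i) (?b j)) = \<delta> C * (- 3 * aronhold x)"
      unfolding pfaffian_sl3_basis[symmetric] by (rule change[OF C])
    finally show ?thesis .
  qed
  moreover obtain x :: "nat \<Rightarrow> 'k" where "aronhold x = 1" using aronhold_nonzero by blast
  \<comment> \<open>The base change can be undone, so its determinant is not zero.\<close>
  ultimately have "\<delta> C \<noteq> 0" by (metis mult_zero_left mult_zero_right mult.right_neutral neg_equal_0_iff_equal zero_neq_numeral)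
  thus ?thesis using pf by (intro exI[of _ "- 3 * \<delta> C"]) simp
qed

section \<open>The Aronhold invariant as an element of the coordinate ring\<close>

lemma const_mult: "const (a * b) = const a * const (b :: 'k::field)"
  by (simp add: const_def mult_single)

lemma const_1: "const 1 = 1"
  by (simp add: const_def)

lemma const_numeral: "const (numeral n) = numeral n"
  by (simp add: const_def)

lemma single_mon: "Poly_Mapping.single (mon v) c = const c * (var (v 0) * var (v 1) * var (v 2))"
  for c :: "'k::field"
  unfolding mon_def sum_UNIV3 by (simp add: const_def var_def mult_single)

lemma cube_of_sum3:
  "(p + q + r) ^ 3 = p * p * p + q * q * q + r * r * r + 3 * (p * p * q) + 3 * (p * p * r)
     + 3 * (p * q * q) + 3 * (q * q * r) + 3 * (p * r * r) + 3 * (q * r * r) + 6 * (p * q * r)"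
  for p q r :: "'r::comm_ring_1"
  by (simp add: power3_eq_cube algebra_simps)

text \<open>The cube of a linear form with coefficients \<open>a\<close> has the tensor \<open>6 * a i * a j * a k\<close>.\<close>

lemma linear_form_cube:
  fixes a :: "3 \<Rightarrow> 'k::field_char_0"
  shows "(\<Sum>i\<in>UNIV. const (a i) * var i) ^ 3 =
    cubic_of (\<lambda>n. 6 * (a (mono_idx n 0) * a (mono_idx n 1) * a (mono_idx n 2)))"
proof -
  have "cubic_of (\<lambda>n. 6 * (a (mono_idx n 0) * a (mono_idx n 1) * a (mono_idx n 2))) =
    (\<Sum>n<10. const (6 * (a (mono_idx n 0) * a (mono_idx n 1) * a (mono_idx n 2)) / mon_weight n) *
      (var (mono_idx n 0) * var (mono_idx n 1) * var (mono_idx n 2)))"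
    by (simp only: cubic_of_def single_mon)
  also have "\<dots> = (const (a 0) * var 0 + const (a 1) * var 1 + const (a 2) * var 2) ^ 3"
    unfolding sum_lessThan_10 cube_of_sum3
    by (simp add: mono_idx_def mon_weight_def const_mult const_numeral mult_ac
        del: times_divide_eq_left mult_numeral_left)
  finally show ?thesis by (simp add: sum_UNIV3)
qed

lemma cubic_of_add: "cubic_of (\<lambda>n. x n + y n) = cubic_of x + cubic_of y"
  by (simp add: cubic_of_def add_divide_distrib single_add sum.distrib)

lemma cubic_of_cong: "(\<And>n. n < 10 \<Longrightarrow> x n = y n) \<Longrightarrow> cubic_of x = cubic_of y"
  by (simp add: cubic_of_def)


lemma aronhold_hom:
  fixes X :: "nat \<Rightarrow> ('x, 'k::comm_ring_1) mpoly"
  shows "peval a (aronhold X) = aronhold (\<lambda>n. peval a (X n))"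
  unfolding aronhold_def adj3_def tens_def sum_UNIV3 tri_simps
  by (simp only: peval_add peval_mult peval_diff)

text \<open>The Aronhold invariant as a polynomial in the ten coefficients of a cubic. The factors
  \<open>mon_weight n\<close> turn coefficients into coordinates of the symmetric tensor.\<close>

definition aronhold_poly :: "(3 \<Rightarrow>\<^sub>0 nat, 'k::comm_ring_1) mpoly" where
  "aronhold_poly = aronhold (\<lambda>n. const (mon_weight n) * var (cubic_mon n))"

lemma peval_aronhold_poly: "peval (Poly_Mapping.lookup \<phi>) aronhold_poly = aronhold (coords \<phi>)"
  by (simp add: aronhold_poly_def aronhold_hom peval_mult coords_def[abs_def])

lemma tens_of_prop:
  assumes "\<And>n. P (x n)"
  shows "P (tens x i j k)"
proof -
  have "\<forall>i j k. P (tens x i j k)" unfolding all3 tens_def tri_simps using assms by blast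
  thus ?thesis by blast
qed

lemma adj3_eq_minor: "\<exists>p q r s p' q' r' s'. adj3 m i j = m p q * m r s - m p' q' * m r' s'"
proof -
  have minor: "\<exists>p q r s p' q' r' s'. m a b * m c d - m a' b' * m c' d' = m p q * m r s - m p' q' * m r' s'"
    for a b c d a' b' c' d' by (rule exI)+ (rule refl)
  have "\<forall>i j. \<exists>p q r s p' q' r' s'. adj3 m i j = m p q * m r s - m p' q' * m r' s'"
    unfolding all3 adj3_def tri_simps by (intro conjI minor)
  thus ?thesis by (elim allE)
qed

lemma homogeneous_aronhold_poly: "homogeneous 4 (aronhold_poly :: (3 \<Rightarrow>\<^sub>0 nat, 'k::comm_ring_1) mpoly)"
proof -
  let ?X = "\<lambda>n. const (mon_weight n) * var (cubic_mon n) :: (3 \<Rightarrow>\<^sub>0 nat, 'k) mpoly"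
  have t: "homogeneous 1 (tens ?X i j k)" for i j k
    by (rule tens_of_prop[where P = "homogeneous 1"])
      (use homogeneous_mult[OF homogeneous_const homogeneous_var] in simp)
  have tt: "homogeneous 2 (tens ?X i j k * tens ?X i' j' k')" for i j k i' j' k'
    using homogeneous_mult[OF t t] by (simp add: numeral_2_eq_2)
  have a: "homogeneous 2 (adj3 (tens ?X 0) i j)" for i j
  proof -
    obtain p q r s p' q' r' s' where
      "adj3 (tens ?X 0) i j = tens ?X 0 p q * tens ?X 0 r s - tens ?X 0 p' q' * tens ?X 0 r' s'"
      using adj3_eq_minor[of "tens ?X 0" i j] by blast
    thus ?thesis using homogeneous_diff[OF tt tt] by simp
  qed
  have "homogeneous (2 + 2) (adj3 (tens ?X 0) i j * (tens ?X 1 1 i * tens ?X 2 2 j - tens ?X 1 2 i * tens ?X 1 2 j))" for i j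
    by (intro homogeneous_mult a homogeneous_diff tt)
  thus ?thesis unfolding aronhold_poly_def aronhold_def by (intro homogeneous_sum) simp
qed

lemma aronhold_poly_in_coord_ring:
  "(aronhold_poly :: (3 \<Rightarrow>\<^sub>0 nat, 'k::comm_ring_1) mpoly) \<in> coord_ring"
proof -
  let ?X = "\<lambda>n. const (mon_weight n) * var (cubic_mon n) :: (3 \<Rightarrow>\<^sub>0 nat, 'k) mpoly"
  have t: "tens ?X i j k \<in> coord_ring" for i j k
    by (rule tens_of_prop[where P = "\<lambda>p. p \<in> coord_ring"])
      (intro coord_ring_mult coord_ring_const coord_ring_var mdeg_mon)
  have a: "adj3 (tens ?X 0) i j \<in> coord_ring" for i j
  proof -
    obtain p q r s p' q' r' s' where
      "adj3 (tens ?X 0) i j = tens ?X 0 p q * tens ?X 0 r s - tens ?X 0 p' q' * tens ?X 0 r' s'"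
      using adj3_eq_minor[of "tens ?X 0" i j] by blast
    thus ?thesis using coord_ring_diff[OF coord_ring_mult[OF t t] coord_ring_mult[OF t t]] by simp
  qed
  show ?thesis unfolding aronhold_poly_def aronhold_def
    by (intro coord_ring_sum coord_ring_mult coord_ring_diff t a)
qed

lemma coord_ring_eqI:
  fixes F G :: "(3 \<Rightarrow>\<^sub>0 nat, 'k::field_char_0) mpoly"
  assumes "F \<in> coord_ring" "G \<in> coord_ring"
    and "\<And>\<phi>. \<phi> \<in> cubics \<Longrightarrow> peval (Poly_Mapping.lookup \<phi>) F = peval (Poly_Mapping.lookup \<phi>) G"
  shows "F = G"
proof -
  have "F - G = 0"
    by (rule coord_ring_eq_0) (simp_all add: assms coord_ring_diff peval_diff cubic_of_in_cubics)
  thus ?thesis by simp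
qed

lemma proj_class_self: "\<phi> \<in> proj_class \<phi>"
  unfolding proj_class_def by (auto intro!: exI[of _ 1] simp: const_1)

lemma vanishes_at_proj_class:
  assumes "homogeneous d F" "peval (Poly_Mapping.lookup \<phi>) F = 0"
  shows "vanishes_at F (proj_class \<phi>)"
proof -
  have "Poly_Mapping.lookup (const c * \<phi>) = (\<lambda>m. c * Poly_Mapping.lookup \<phi> m)" for c
    by (simp add: fun_eq_iff lookup_const_mult)
  thus ?thesis using assms by (auto simp: vanishes_at_def proj_class_def peval_homogeneous)
qed

section \<open>The equation of the secant variety\<close>

context ternary_space
begin

text \<open>The classes of the nonzero sums of three cubes, whose Zariski closure is \<open>sigma3\<close>.\<close>

definition cube_classes :: "(3, 'k) mpoly set set" where
  "cube_classes =
     {proj_class (\<Sum>i\<in>UNIV. lin (g i) ^ 3) | g :: 3 \<Rightarrow> 'w. (\<Sum>i\<in>UNIV. lin (g i) ^ 3) \<noteq> 0}"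

end

text \<open>From here on the field is algebraically closed of characteristic zero. A locale is needed
  because the sort of the field is fixed in \<open>ternary_space\<close>.\<close>

locale ternary_space_alg_closed = ternary_space scale e
  for scale :: "'k::{alg_closed_field, field_char_0} \<Rightarrow> 'w::ab_group_add \<Rightarrow> 'w" and e :: "3 \<Rightarrow> 'w"
begin

lemma sum_lin_cubes: "(\<Sum>i\<in>UNIV. lin (g i) ^ 3) = cubic_of (\<lambda>n. 6 * cube_sum (\<lambda>i. coord (g i)) n)"
  for g :: "3 \<Rightarrow> 'w"
proof -
  have "cubic_of (\<lambda>n. 6 * cube_sum (\<lambda>i. coord (g i)) n) = cubic_of (\<lambda>n.
      6 * (coord (g 0) (mono_idx n 0) * coord (g 0) (mono_idx n 1) * coord (g 0) (mono_idx n 2)) +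
      6 * (coord (g 1) (mono_idx n 0) * coord (g 1) (mono_idx n 1) * coord (g 1) (mono_idx n 2)) +
      6 * (coord (g 2) (mono_idx n 0) * coord (g 2) (mono_idx n 1) * coord (g 2) (mono_idx n 2)))"
    by (intro cubic_of_cong) (simp add: cube_sum_def sum_UNIV3 algebra_simps)
  thus ?thesis unfolding cubic_of_add linear_form_cube[symmetric] by (simp add: lin_def sum_UNIV3)
qed

text \<open>Up to a cube root of \<open>1 / 6\<close>, every \<open>cube_sum\<close> comes from three vectors of \<open>W\<close>.\<close>

lemma cube_sum_is_sum_lin_cubes:
  "\<exists>g :: 3 \<Rightarrow> 'w. cubic_of (cube_sum m) = (\<Sum>i\<in>UNIV. lin (g i) ^ 3)"
proof -
  have "\<exists>t. t ^ 3 = (1 / 6 :: 'k)" using nth_root_exists[of 3 "1 / 6 :: 'k"] by simp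
  then obtain t :: 'k where t: "t ^ 3 = 1 / 6" by blast
  define g where "g i = (\<Sum>p\<in>UNIV. scale (t * m i p) (e p))" for i
  have t6: "6 * (t * (t * (t * z))) = z" for z
  proof -
    have "6 * (t * (t * (t * z))) = 6 * t ^ 3 * z" by (simp add: power3_eq_cube mult_ac)
    thus ?thesis by (simp add: t)
  qed
  have "cube_sum m n = 6 * cube_sum (\<lambda>i. coord (g i)) n" for n
  proof -
    have "6 * cube_sum (\<lambda>i. coord (g i)) n =
        (\<Sum>l\<in>UNIV. 6 * (t * (t * (t * (m l (mono_idx n 0) * m l (mono_idx n 1) * m l (mono_idx n 2))))))"
      unfolding cube_sum_def g_def coord_vec sum_distrib_left
      by (intro sum.cong refl) (simp only: mult_ac)
    thus ?thesis unfolding t6 cube_sum_def by simp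
  qed
  hence "cubic_of (cube_sum m) = cubic_of (\<lambda>n. 6 * cube_sum (\<lambda>i. coord (g i)) n)"
    by (intro cubic_of_cong)
  thus ?thesis unfolding sum_lin_cubes[symmetric] by blast
qed

text \<open>The polynomials vanishing on the sums of three cubes are the multiples of the Aronhold
  invariant. This is \<open>aronhold_dvd\<close> in the coordinate ring.\<close>

lemma vanishes_on_cube_classes_imp_dvd:
  assumes F: "F \<in> coord_ring" and vanish: "\<And>x. x \<in> cube_classes \<Longrightarrow> vanishes_at F x"
  shows "\<exists>H\<in>coord_ring. F = aronhold_poly * H"
proof -
  define f where "f x = peval (Poly_Mapping.lookup (cubic_of x)) F" for x
  have f: "polyfun 10 f" unfolding f_def by (rule polyfun_peval)
  have "\<exists>H. polyfun 10 H \<and> (\<forall>x. f x = aronhold x * H x)"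
  proof (rule aronhold_dvd[OF f])
    fix m :: "3 \<Rightarrow> 3 \<Rightarrow> 'k"
    assume "\<exists>n<10. cube_sum m n \<noteq> 0"
    then obtain n where n: "n < 10" "cube_sum m n \<noteq> 0" by blast
    have nz: "cubic_of (cube_sum m) \<noteq> 0"
    proof
      assume "cubic_of (cube_sum m) = 0"
      hence "coords (cubic_of (cube_sum m)) n = 0" by (simp add: coords_def)
      thus False using n by (simp add: coords_cubic_of)
    qed
    obtain g :: "3 \<Rightarrow> 'w" where g: "cubic_of (cube_sum m) = (\<Sum>i\<in>UNIV. lin (g i) ^ 3)"
      using cube_sum_is_sum_lin_cubes by blast
    have "proj_class (cubic_of (cube_sum m)) \<in> cube_classes"
      using nz unfolding cube_classes_def g by blast
    thus "f (cube_sum m) = 0"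
      using vanish proj_class_self unfolding f_def vanishes_at_def by blast
  qed
  then obtain H where H: "polyfun 10 H" "\<And>x. f x = aronhold x * H x" by blast
  obtain G where G: "G \<in> coord_ring" "\<And>\<phi>. peval (Poly_Mapping.lookup \<phi>) G = H (coords \<phi>)"
    using polyfun_imp_coord_ring[OF H(1)] by blast
  have "F = aronhold_poly * G"
  proof (rule coord_ring_eqI)
    fix \<phi> :: "(3, 'k) mpoly" assume "\<phi> \<in> cubics"
    hence "peval (Poly_Mapping.lookup \<phi>) F = f (coords \<phi>)" by (simp add: f_def cubic_of_coords)
    thus "peval (Poly_Mapping.lookup \<phi>) F = peval (Poly_Mapping.lookup \<phi>) (aronhold_poly * G)"
      by (simp add: H peval_mult peval_aronhold_poly G)
  qed (use F G in \<open>auto intro: coord_ring_mult aronhold_poly_in_coord_ring\<close>)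
  thus ?thesis using G by blast
qed

lemma cube_classes_subset: "cube_classes \<subseteq> zero_locus {aronhold_poly}"
proof
  fix x assume "x \<in> cube_classes"
  then obtain g :: "3 \<Rightarrow> 'w" where g: "x = proj_class (\<Sum>i\<in>UNIV. lin (g i) ^ 3)" "(\<Sum>i\<in>UNIV. lin (g i) ^ 3) \<noteq> 0"
    unfolding cube_classes_def by blast
  let ?\<phi> = "\<Sum>i\<in>UNIV. lin (g i) ^ 3"
  define y where "y n = 6 * cube_sum (\<lambda>i. coord (g i)) n" for n
  have phi: "?\<phi> = cubic_of y" unfolding y_def by (rule sum_lin_cubes)
  have "x \<in> proj_cubics"
    using g unfolding proj_cubics_def phi by (auto simp: cubic_of_in_cubics)
  moreover have "vanishes_at aronhold_poly x"
    unfolding g(1)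
  proof (rule vanishes_at_proj_class[OF homogeneous_aronhold_poly])
    obtain m where m: "?\<phi> = cubic_of m" "aronhold m = 0"
    proof -
      have "aronhold y = 0"
      proof -
        have "\<exists>t. t ^ 3 = (6 :: 'k)" using nth_root_exists[of 3 "6 :: 'k"] by simp
        then obtain t :: 'k where t: "t ^ 3 = 6" by blast
        have "y = cube_sum (\<lambda>i p. t * coord (g i) p)"
          unfolding y_def cube_sum_def fun_eq_iff t[symmetric]
          by (simp add: sum_distrib_left power3_eq_cube mult_ac)
        thus ?thesis by (simp add: aronhold_cube_sum)
      qed
      thus ?thesis using that phi by blast
    qed
    have "aronhold (coords (cubic_of m)) = aronhold m"
      by (rule polyfun_cong[OF polyfun_aronhold]) (simp add: coords_cubic_of)
    thus "peval (Poly_Mapping.lookup ?\<phi>) aronhold_poly = 0"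
      unfolding m(1) peval_aronhold_poly using m(2) by simp
  qed
  ultimately show "x \<in> zero_locus {aronhold_poly}" by (simp add: zero_locus_def)
qed

lemma sigma3_eq: "sigma3 = zero_locus {aronhold_poly}"
proof
  have "zariski_closed (zero_locus {aronhold_poly :: (3 \<Rightarrow>\<^sub>0 nat, 'k) mpoly})"
    unfolding zariski_closed_def
    by (rule exI[of _ "{aronhold_poly}"])
      (use aronhold_poly_in_coord_ring homogeneous_aronhold_poly in blast)
  thus "sigma3 \<subseteq> zero_locus {aronhold_poly}"
    using cube_classes_subset unfolding sigma3_def zariski_closure_def cube_classes_def by blast
  show "zero_locus {aronhold_poly} \<subseteq> sigma3"
    unfolding sigma3_def zariski_closure_def cube_classes_def[symmetric]
  proof (rule Inter_greatest)
    fix Y assume "Y \<in> {Y. zariski_closed Y \<and> cube_classes \<subseteq> Y}"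
    then obtain S where S: "S \<subseteq> coord_ring" "Y = zero_locus S" "cube_classes \<subseteq> Y"
      unfolding zariski_closed_def by blast
    have "\<exists>H. F = aronhold_poly * H" if "F \<in> S" for F
    proof -
      have "F \<in> coord_ring" using S(1) that by blast
      moreover have "vanishes_at F x" if "x \<in> cube_classes" for x
        using S(2,3) that \<open>F \<in> S\<close> unfolding zero_locus_def by blast
      ultimately show ?thesis using vanishes_on_cube_classes_imp_dvd by blast
    qed
    thus "zero_locus {aronhold_poly} \<subseteq> Y"
      unfolding S(2) zero_locus_def vanishes_at_def by (fastforce simp: peval_mult)
  qed
qed

lemma cube_classes_subset_sigma3: "cube_classes \<subseteq> sigma3"
  unfolding sigma3_eq by (rule cube_classes_subset)

lemma const_aronhold_poly_nonzero:
  assumes "c \<noteq> (0 :: 'k)"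
  shows "const c * aronhold_poly \<noteq> 0"
proof
  assume z: "const c * aronhold_poly = 0"
  obtain x :: "nat \<Rightarrow> 'k" where x: "aronhold x = 1" using aronhold_nonzero by blast
  have "aronhold (coords (cubic_of x)) = aronhold x"
    by (rule polyfun_cong[OF polyfun_aronhold]) (simp add: coords_cubic_of)
  hence "peval (Poly_Mapping.lookup (cubic_of x)) (const c * aronhold_poly) = c"
    by (simp add: peval_mult peval_aronhold_poly x)
  thus False using assms unfolding z by simp
qed

lemma is_aronhold_invariant_const_mult:
  assumes c: "c \<noteq> 0"
  shows "is_aronhold_invariant (const c * aronhold_poly)"
proof -
  let ?P = "const c * aronhold_poly :: (3 \<Rightarrow>\<^sub>0 nat, 'k) mpoly"
  have P: "?P \<in> coord_ring" by (intro coord_ring_mult coord_ring_const aronhold_poly_in_coord_ring)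
  have hom: "homogeneous 4 ?P"
    using homogeneous_mult[OF homogeneous_const homogeneous_aronhold_poly, of c] by simp
  have van: "vanishes_at ?P x \<longleftrightarrow> vanishes_at aronhold_poly x" for x
    using c by (simp add: vanishes_at_def peval_mult)
  have locus: "zero_locus {?P} = sigma3" unfolding sigma3_eq zero_locus_def by (simp add: van)
  have "vanishing_ideal sigma3 = {?P * H | H. H \<in> coord_ring}"
  proof
    show "{?P * H | H. H \<in> coord_ring} \<subseteq> vanishing_ideal sigma3"
      unfolding vanishing_ideal_def locus[symmetric] zero_locus_def vanishes_at_def
      using coord_ring_mult[OF P] by (auto simp: peval_mult)
    show "vanishing_ideal sigma3 \<subseteq> {?P * H | H. H \<in> coord_ring}"
    proof
      fix F assume "F \<in> vanishing_ideal sigma3"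
      hence F: "F \<in> coord_ring" "\<And>x. x \<in> sigma3 \<Longrightarrow> vanishes_at F x" by (auto simp: vanishing_ideal_def)
      obtain H where H: "H \<in> coord_ring" "F = aronhold_poly * H"
        using vanishes_on_cube_classes_imp_dvd[OF F(1)] F(2) cube_classes_subset_sigma3 by blast
      have "const c * const (1 / c) = (1 :: (3 \<Rightarrow>\<^sub>0 nat, 'k) mpoly)"
        using c by (simp add: const_mult[symmetric] const_1)
      hence "F = (const c * const (1 / c)) * (aronhold_poly * H)" using H(2) by simp
      hence "F = ?P * (const (1 / c) * H)" by (simp only: mult_ac)
      thus "F \<in> {?P * H | H. H \<in> coord_ring}" using H(1) coord_ring_mult coord_ring_const by blast
    qed
  qed
  thus ?thesis
    unfolding is_aronhold_invariant_def is_equation_of_def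
    using P hom locus const_aronhold_poly_nonzero[OF c] by blast
qed

text \<open>Another equation \<open>F\<close> of degree four is the Aronhold invariant times a polynomial \<open>H\<close>. Both are
  homogeneous of the same degree, so \<open>H\<close> is constant on each line through the origin that is not
  contained in the zero locus, with the value \<open>H 0\<close>.\<close>

lemma is_aronhold_invariant_imp_const_mult:
  assumes "is_aronhold_invariant F"
  shows "\<exists>c. c \<noteq> 0 \<and> F = const c * aronhold_poly"
proof -
  have F: "F \<in> coord_ring" "F \<noteq> 0" "homogeneous 4 F" "zero_locus {F} = sigma3"
    using assms by (auto simp: is_aronhold_invariant_def is_equation_of_def)
  have "vanishes_at F x" if "x \<in> cube_classes" for x
    using that cube_classes_subset_sigma3 unfolding F(4)[symmetric] zero_locus_def by blast
  then obtain H where H: "H \<in> coord_ring" "F = aronhold_poly * H"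
    using vanishes_on_cube_classes_imp_dvd[OF F(1)] by blast
  define h where "h x = peval (Poly_Mapping.lookup (cubic_of x)) H" for x
  have h: "polyfun 10 h" unfolding h_def by (rule polyfun_peval)
  have ev: "peval (Poly_Mapping.lookup (cubic_of x)) F = aronhold x * h x" for x
  proof -
    have "aronhold (coords (cubic_of x)) = aronhold x"
      by (rule polyfun_cong[OF polyfun_aronhold]) (simp add: coords_cubic_of)
    thus ?thesis by (simp add: H(2) peval_mult peval_aronhold_poly h_def)
  qed
  have hom: "peval (Poly_Mapping.lookup (cubic_of (\<lambda>n. s * x n))) G =
      s ^ 4 * peval (Poly_Mapping.lookup (cubic_of x)) G" if "homogeneous 4 G" for s x and G :: "(3 \<Rightarrow>\<^sub>0 nat, 'k) mpoly"
  proof -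
    have "cubic_of (\<lambda>n. s * x n) = const s * cubic_of x"
      unfolding cubic_of_def sum_distrib_left by (simp add: const_def mult_single)
    hence "Poly_Mapping.lookup (cubic_of (\<lambda>n. s * x n)) = (\<lambda>m. s * Poly_Mapping.lookup (cubic_of x) m)"
      by (simp add: fun_eq_iff lookup_const_mult)
    thus ?thesis using peval_homogeneous[OF that] by simp
  qed
  have "aronhold x * h x = h (\<lambda>_. 0) * aronhold x" for x
  proof (cases "aronhold x = 0")
    case False
    obtain q where q: "\<And>s. h (\<lambda>n. s * x n) = poly q s"
      using polyfun_line[OF h, of "\<lambda>_. 0" x] by auto
    have "poly ([:0, 1:] ^ 4 * q) s = poly ([:0, 1:] ^ 4 * [:h x:]) s" for s
    proof -
      have "aronhold (\<lambda>n. s * x n) = s ^ 4 * aronhold x"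
        unfolding aronhold_monic sum_lessThan_4 aronhold_coeff_def
        by (simp add: algebra_simps power2_eq_square power4_eq_xxxx)
      hence "(s ^ 4 * aronhold x) * poly q s = s ^ 4 * (aronhold x * h x)"
        using hom[OF F(3), of s x] unfolding ev q by simp
      thus ?thesis using False by (simp add: mult_ac)
    qed
    hence "[:0, 1:] ^ 4 * q = [:0, 1:] ^ 4 * [:h x:]" by (rule poly_eqI_infinite)
    hence "q = [:h x:]" by (subst (asm) mult_left_cancel) simp_all
    thus ?thesis using q[of 0] by simp
  qed simp
  hence eq: "F = const (h (\<lambda>_. 0)) * aronhold_poly"
  proof (intro coord_ring_eqI)
    fix \<phi> :: "(3, 'k) mpoly" assume *: "\<And>x. aronhold x * h x = h (\<lambda>_. 0) * aronhold x" and "\<phi> \<in> cubics"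
    thus "peval (Poly_Mapping.lookup \<phi>) F = peval (Poly_Mapping.lookup \<phi>) (const (h (\<lambda>_. 0)) * aronhold_poly)"
      using ev[of "coords \<phi>"] by (simp add: cubic_of_coords peval_mult peval_aronhold_poly)
  qed (use F(1) in \<open>auto intro: coord_ring_mult coord_ring_const aronhold_poly_in_coord_ring\<close>)
  moreover have "h (\<lambda>_. 0) \<noteq> 0" using eq F(2) by (auto simp: const_def)
  ultimately show ?thesis by blast
qed

end

theorem theorem1p2:
  fixes scale :: "'k::{alg_closed_field, field_char_0} \<Rightarrow> 'w::ab_group_add \<Rightarrow> 'w"
    and e :: "3 \<Rightarrow> 'w"
    and B :: "nat \<Rightarrow> 'w \<Rightarrow> 'w"
  assumes W: "ternary_space scale e"
    and B: "ternary_space.is_ad_basis scale e B"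
  defines "A \<equiv> ternary_space.contraction scale e"
    and "ad \<equiv> ternary_space.ad scale e"
    and "tr \<equiv> ternary_space.tr scale e"
  shows "(\<forall>\<phi>\<in>cubics. \<forall>M\<in>ad. A \<phi> M \<in> ad) \<and>
    (\<forall>\<phi>\<in>cubics. \<forall>M\<in>ad. \<forall>N\<in>ad. tr (A \<phi> M \<circ> N) = - tr (A \<phi> N \<circ> M)) \<and>
    (\<exists>P\<in>coord_ring.
       (\<forall>\<phi>\<in>cubics. peval (Poly_Mapping.lookup \<phi>) P = ternary_space.contraction_pf scale e B \<phi>) \<and>
       {F. ternary_space.is_aronhold_invariant scale e F} = {const c * P | c. c \<noteq> 0})"
proof -
  \<comment> \<open>The interpretation below hides these names.\<close>
  note defs = A_def ad_def tr_def
  interpret ternary_space scale e by (rule W)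
  interpret ternary_space_alg_closed scale e ..
  obtain c where c: "c \<noteq> 0" "\<And>\<phi>. contraction_pf B \<phi> = c * aronhold (coords \<phi>)"
    using contraction_pf_eq_aronhold[OF W B] by blast
  define P where "P = const c * aronhold_poly"
  have "P \<in> coord_ring" unfolding P_def
    by (intro coord_ring_mult coord_ring_const aronhold_poly_in_coord_ring)
  moreover have "\<forall>\<phi>\<in>cubics. peval (Poly_Mapping.lookup \<phi>) P = contraction_pf B \<phi>"
    by (simp add: P_def peval_mult peval_aronhold_poly c(2))
  moreover have "{F. is_aronhold_invariant F} = {const d * P | d. d \<noteq> 0}"
  proof (intro equalityI subsetI)
    fix F assume "F \<in> {F. is_aronhold_invariant F}"
    then obtain b where b: "b \<noteq> 0" "F = const b * aronhold_poly"
      using is_aronhold_invariant_imp_const_mult by blast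
    have "F = const (b / c) * P"
      unfolding P_def b(2) using c(1) by (simp add: mult.assoc[symmetric] const_mult[symmetric])
    moreover have "b / c \<noteq> 0" using b(1) c(1) by simp
    ultimately show "F \<in> {const d * P | d. d \<noteq> 0}" by blast
  next
    fix F assume "F \<in> {const d * P | d. d \<noteq> 0}"
    then obtain d where d: "d \<noteq> 0" "F = const (d * c) * aronhold_poly"
      by (auto simp: P_def const_mult mult.assoc)
    thus "F \<in> {F. is_aronhold_invariant F}"
      using is_aronhold_invariant_const_mult[of "d * c"] c(1) by simp
  qed
  ultimately show ?thesis
    unfolding defs using contraction_in_ad tr_contraction_skew by blast
qed

end
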